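(* If $(\mathcal{H},\phi,D)$ is a continuous $p$-summable spectral triple over a locally convex algebra $\mathcal{A}$ such that the multiplication $\mathcal{A}\times\mathcal{A}\to\mathcal{A}$ is surjective and open, then $(\mathbb{B}(\mathcal{H}),\phi,q(D))$, where $q(x)=x/\sqrt{1+x^2}$, is a locally convex Kasparov $(\mathcal{A},\mathcal{L}^{2p})$-module.
   Context: A locally convex algebra is a complete locally convex complex vector space with a jointly continuous associative multiplication. $\mathcal{L}^r=\mathcal{L}^r(\mathcal{H})$ is the $r$-Schatten ideal. A spectral triple over an involutive algebra $\mathcal{A}$ is given by a representation $\phi:\mathcal{A}\to\mathbb{B}(\mathcal{H})$ on a Hilbert space and a selfadjoint (unbounded) operator $D$ on $\mathcal{H}$ such that for all $a\in\mathcal A$: $[\phi(a),D]\in\mathbb{B}(\mathcal{H})$ (meaning that $\phi(a)$ preserves the domain of $D$ and the commutator extends to a bounded operator) and $\phi(a)(1+D^2)^{-1/2}$ is compact. It is called even if $\mathcal{H}$ is graded, $\phi$ is even with respect to the induced grading on $\mathbb{B}(\mathcal{H})$ and $D$ is odd; it is called odd if $\mathcal{H}$ is ungraded. A continuous $p$-summable spectral triple is a spectral triple over a locally convex algebra $\mathcal{A}$ such that $a\mapsto[D,\phi(a)]$ is continuous with values in $\mathbb{B}(\mathcal{H})$, and $a\mapsto\phi(a)(1+D^2)^{-1/2}$, $a\mapsto(1+D^2)^{-1/2}\phi(a)$ are continuous with values in $\mathcal{L}^p$. A locally convex Kasparov $(\mathcal{A},\mathcal{B})$-module $(\hat{\mathcal{B}},\phi,F)$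 consists of a unital algebra $\hat{\mathcal{B}}$ containing the locally convex algebra $\mathcal{B}$, elements $\varepsilon,F\in\hat{\mathcal{B}}$ ($\varepsilon$ is the grading) and an algebra homomorphism $\phi:\mathcal{A}\to\hat{\mathcal{B}}$ with $\varepsilon^2=1$, $F\varepsilon=-\varepsilon F$, $[\phi(a),\varepsilon]=0$, such that the maps $b\mapsto bF,Fb,\varepsilon b,b\varepsilon$; $(a,b)\mapsto\phi(a)b,\,b\phi(a)$; $a\mapsto\phi(a)(1-F^2),\,(1-F^2)\phi(a)$; $a\mapsto[\phi(a),F]$ ($a\in\mathcal{A},b\in\mathcal{B}$) are $\mathcal{B}$-valued and continuous. For the module in the claim the grading $\varepsilon$ is the grading operator of $\mathcal{H}$.
   Formalization: The representation φ is additionally assumed continuous into B(H) in operator norm; without this the claim fails, and continuity of (a,b) ↦ φ(a)b on A × L^{2p} forces it. The triple is even and p ≥ 1. *)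

theory Defs
  imports "HOL-Analysis.Analysis"
begin

class complex_vector = real_vector +
  fixes scaleC :: "complex \<Rightarrow> 'a \<Rightarrow> 'a"  (infixr "*\<^sub>C" 75)
  assumes scaleC_add_right: "c *\<^sub>C (x + y) = c *\<^sub>C x + c *\<^sub>C y"
    and scaleC_add_left: "(c + d) *\<^sub>C x = c *\<^sub>C x + d *\<^sub>C x"
    and scaleC_scaleC: "c *\<^sub>C (d *\<^sub>C x) = (c * d) *\<^sub>C x"
    and scaleC_of_real: "complex_of_real r *\<^sub>C x = r *\<^sub>R x"

class complex_algebra = complex_vector + ring +
  assumes mult_scaleC_left: "(c *\<^sub>C x) * y = c *\<^sub>C (x * y)"
    and mult_scaleC_right: "x * (c *\<^sub>C y) = c *\<^sub>C (x * y)"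

text \<open>
  The inner product is linear in the second argument. The class extends \<^class>\<open>real_inner\<close>, whose
  real inner product is the real part of the complex one, so that norm and topology are the usual
  ones.
\<close>

class complex_inner = complex_vector + real_inner +
  fixes cinner :: "'a \<Rightarrow> 'a \<Rightarrow> complex"
  assumes cinner_commute: "cinner x y = cnj (cinner y x)"
    and cinner_add_right: "cinner x (y + z) = cinner x y + cinner x z"
    and cinner_scaleC_right: "cinner x (c *\<^sub>C y) = c * cinner x y"
    and Re_cinner: "Re (cinner x y) = inner x y"

class complex_hilbert = complex_inner + complete_space

lemma cinner_scaleC_left:
  fixes x y :: "'a::complex_inner"
  shows "cinner (c *\<^sub>C x) y = cnj c * cinner x y"
  by (metis cinner_commute cinner_scaleC_right complex_cnj_mult)

lemma norm_scaleC:
  fixes x :: "'a::complex_inner"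
  shows "norm (c *\<^sub>C x) = cmod c * norm x"
proof -
  have "Im (cinner x x) = 0"
    by (metis cinner_commute add.inverse_neutral complex_cnj_cancel_iff complex.expand
        cnj.simps(2) complex_surj equal_neg_zero)
  then have xx: "cinner x x = complex_of_real (inner x x)"
    by (simp add: complex_eq_iff Re_cinner)
  have "cinner (c *\<^sub>C x) (c *\<^sub>C x) = (c * cnj c) * cinner x x"
    by (simp add: cinner_scaleC_left cinner_scaleC_right)
  also have "\<dots> = complex_of_real ((cmod c)\<^sup>2 * inner x x)"
    by (simp only: complex_norm_square[symmetric] xx of_real_mult)
  finally have "inner (c *\<^sub>C x) (c *\<^sub>C x) = (cmod c)\<^sup>2 * inner x x"
    by (metis Re_cinner Re_complex_of_real)
  then show ?thesis
    by (simp add: norm_eq_sqrt_inner real_sqrt_mult)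
qed

definition csubspace :: "'a::complex_vector set \<Rightarrow> bool" where
  "csubspace S \<longleftrightarrow> 0 \<in> S \<and> (\<forall>x\<in>S. \<forall>y\<in>S. x + y \<in> S) \<and> (\<forall>c. \<forall>x\<in>S. c *\<^sub>C x \<in> S)"

definition clinear_on :: "'a::complex_vector set \<Rightarrow> ('a \<Rightarrow> 'b::complex_vector) \<Rightarrow> bool" where
  "clinear_on S f \<longleftrightarrow>
     (\<forall>x\<in>S. \<forall>y\<in>S. f (x + y) = f x + f y) \<and> (\<forall>c. \<forall>x\<in>S. f (c *\<^sub>C x) = c *\<^sub>C f x)"

text \<open>
  The type \<open>'h bop\<close> is the algebra of bounded complex linear operators. It has a unit but is
  deliberately not made an instance of \<^class>\<open>ring_1\<close>, because the zero space is allowed.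
\<close>

typedef (overloaded) 'h bop =
  "{T :: 'h::complex_inner \<Rightarrow>\<^sub>L 'h. \<forall>c x. blinfun_apply T (c *\<^sub>C x) = c *\<^sub>C blinfun_apply T x}"
proof -
  have "(id_blinfun :: 'h \<Rightarrow>\<^sub>L 'h) \<in> {T. \<forall>c x. blinfun_apply T (c *\<^sub>C x) = c *\<^sub>C blinfun_apply T x}"
    by simp
  then show ?thesis by blast
qed

setup_lifting type_definition_bop

lift_definition app :: "'h::complex_inner bop \<Rightarrow> 'h \<Rightarrow> 'h" is blinfun_apply .

lemma scaleC_zero_right: "c *\<^sub>C (0 :: 'a::complex_vector) = 0"
  by (metis add_cancel_right_right scaleC_add_right)

lemma scaleC_minus_right: "c *\<^sub>C (- x) = - (c *\<^sub>C (x :: 'a::complex_vector))"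
  by (metis add_eq_0_iff scaleC_add_right scaleC_zero_right)

lemma scaleC_diff_right: "c *\<^sub>C (x - y) = c *\<^sub>C x - c *\<^sub>C (y :: 'a::complex_vector)"
  by (metis diff_conv_add_uminus scaleC_add_right scaleC_minus_right)

lemma scaleC_scaleR: "c *\<^sub>C (r *\<^sub>R x) = r *\<^sub>R (c *\<^sub>C (x :: 'a::complex_vector))"
  by (metis mult.commute scaleC_of_real scaleC_scaleC)

lemma bounded_linear_scaleC: "bounded_linear (\<lambda>x :: 'a::complex_inner. c *\<^sub>C x)"
  by (rule bounded_linear_intro[where K = "cmod c"])
    (simp_all add: scaleC_add_right scaleC_scaleR norm_scaleC mult.commute)

instantiation bop :: (complex_inner) "{complex_algebra, real_normed_algebra, monoid_mult}"
begin

lift_definition zero_bop :: "'a bop" is 0 by (simp add: scaleC_zero_right)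
lift_definition one_bop :: "'a bop" is id_blinfun by simp
lift_definition plus_bop :: "'a bop \<Rightarrow> 'a bop \<Rightarrow> 'a bop" is "(+)"
  by (simp add: blinfun.add_left scaleC_add_right)
lift_definition uminus_bop :: "'a bop \<Rightarrow> 'a bop" is uminus
  by (simp add: blinfun.minus_left scaleC_minus_right)
lift_definition minus_bop :: "'a bop \<Rightarrow> 'a bop \<Rightarrow> 'a bop" is "(-)"
  by (simp add: blinfun.diff_left scaleC_diff_right)
lift_definition times_bop :: "'a bop \<Rightarrow> 'a bop \<Rightarrow> 'a bop" is blinfun_compose
  by simp
lift_definition scaleR_bop :: "real \<Rightarrow> 'a bop \<Rightarrow> 'a bop" is scaleR
  by (simp add: blinfun.scaleR_left scaleC_scaleR)
lift_definition scaleC_bop :: "complex \<Rightarrow> 'a bop \<Rightarrow> 'a bop"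
  is "\<lambda>c T. blinfun_compose (Blinfun (\<lambda>x. c *\<^sub>C x)) T"
  by (simp add: bounded_linear_Blinfun_apply[OF bounded_linear_scaleC] scaleC_scaleC mult.commute)
lift_definition norm_bop :: "'a bop \<Rightarrow> real" is norm .
definition dist_bop :: "'a bop \<Rightarrow> 'a bop \<Rightarrow> real" where "dist_bop S T = norm (S - T)"
definition sgn_bop :: "'a bop \<Rightarrow> 'a bop" where "sgn_bop T = inverse (norm T) *\<^sub>R T"
definition uniformity_bop :: "('a bop \<times> 'a bop) filter" where
  "uniformity_bop = (INF e\<in>{0 <..}. principal {(S, T). dist S T < e})"
definition open_bop :: "'a bop set \<Rightarrow> bool" where
  "open_bop U \<longleftrightarrow> (\<forall>S\<in>U. eventually (\<lambda>(S', T). S' = S \<longrightarrow> T \<in> U) uniformity)"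

instance
proof
  fix S T U :: "'a bop" and r s :: real and c d :: complex
  show "S + T + U = S + (T + U)" "S + T = T + S" "0 + S = S" "- S + S = 0" "S - T = S + - T"
    "r *\<^sub>R (S + T) = r *\<^sub>R S + r *\<^sub>R T" "(r + s) *\<^sub>R S = r *\<^sub>R S + s *\<^sub>R S"
    "r *\<^sub>R s *\<^sub>R S = (r * s) *\<^sub>R S" "1 *\<^sub>R S = S"
    by (transfer; simp add: algebra_simps)+
  show "S * T * U = S * (T * U)" "1 * S = S" "S * 1 = S"
    by (transfer; simp add: blinfun_eqI)+
  show "(S + T) * U = S * U + T * U" "S * (T + U) = S * T + S * U"
    "r *\<^sub>R S * T = r *\<^sub>R (S * T)" "S * r *\<^sub>R T = r *\<^sub>R (S * T)"
    by (transfer; simp add: blinfun_eqI blinfun.bilinear_simps)+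
  show "c *\<^sub>C (S + T) = c *\<^sub>C S + c *\<^sub>C T" "(c + d) *\<^sub>C S = c *\<^sub>C S + d *\<^sub>C S"
    "c *\<^sub>C d *\<^sub>C S = (c * d) *\<^sub>C S" "complex_of_real r *\<^sub>C S = r *\<^sub>R S"
    "c *\<^sub>C S * T = c *\<^sub>C (S * T)" "S * c *\<^sub>C T = c *\<^sub>C (S * T)"
    by (transfer; rule blinfun_eqI; simp add: blinfun.bilinear_simps
        bounded_linear_Blinfun_apply[OF bounded_linear_scaleC]
        scaleC_add_right scaleC_add_left scaleC_scaleC scaleC_of_real)+
  show "dist S T = norm (S - T)" by (rule dist_bop_def)
  show "sgn S = inverse (norm S) *\<^sub>R S" by (rule sgn_bop_def)
  show "uniformity = (INF e\<in>{0 <..}. principal {(S :: 'a bop, T). dist S T < e})"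
    by (rule uniformity_bop_def)
  show "open A \<longleftrightarrow> (\<forall>S\<in>A. \<forall>\<^sub>F (S', T) in uniformity. S' = S \<longrightarrow> T \<in> A)" for A :: "'a bop set"
    by (rule open_bop_def)
  show "(norm S = 0) = (S = 0)" "norm (S + T) \<le> norm S + norm T" "norm (r *\<^sub>R S) = \<bar>r\<bar> * norm S"
    by (transfer; simp add: norm_triangle_ineq)+
  show "norm (S * T) \<le> norm S * norm T"
    by (transfer; rule norm_blinfun_compose)
qed

end

definition is_adjoint :: "'h::complex_inner bop \<Rightarrow> 'h bop \<Rightarrow> bool" where
  "is_adjoint T T' \<longleftrightarrow> (\<forall>x y. cinner (app T' x) y = cinner x (app T y))"

definition compact_op :: "'h::complex_inner bop \<Rightarrow> bool" where
  "compact_op T \<longleftrightarrow> compact (closure (app T ` cball 0 1))"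

definition rank_le :: "nat \<Rightarrow> 'h::complex_inner bop \<Rightarrow> bool" where
  "rank_le n T \<longleftrightarrow>
     (\<exists>B. finite B \<and> card B \<le> n \<and> (\<forall>x. \<exists>c. app T x = (\<Sum>b\<in>B. c b *\<^sub>C b)))"

text \<open>
  The singular numbers \<open>s\<^sub>0(T) \<ge> s\<^sub>1(T) \<ge> \<dots>\<close> are defined for every bounded operator as the
  distances to the operators of rank at most \<open>n\<close>. For compact \<open>T\<close> these are the
  eigenvalues of \<open>(T\<^sup>*T)\<^sup>1\<^sup>/\<^sup>2\<close> in decreasing order, with multiplicity; and an operator
  with \<open>\<Sum>n. s\<^sub>n(T)\<^sup>r < \<infinity>\<close> has \<open>s\<^sub>n(T) \<longlonglongrightarrow> 0\<close>, hence is compact.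
\<close>

definition singular_number :: "nat \<Rightarrow> 'h::complex_inner bop \<Rightarrow> real" where
  "singular_number n T = Inf {norm (T - S) | S. rank_le n S}"

definition schatten :: "real \<Rightarrow> 'h::complex_inner bop set" where
  "schatten r = {T. summable (\<lambda>n. singular_number n T powr r)}"

definition schatten_norm :: "real \<Rightarrow> 'h::complex_inner bop \<Rightarrow> real" where
  "schatten_norm r T = (\<Sum>n. singular_number n T powr r) powr (1 / r)"

definition schatten_topology :: "real \<Rightarrow> 'h::complex_inner bop topology" where
  "schatten_topology r =
     topology (\<lambda>U. U \<subseteq> schatten r \<and>
       (\<forall>T\<in>U. \<exists>e>0. \<forall>S\<in>schatten r. schatten_norm r (S - T) < e \<longrightarrow> S \<in> U))"

lemma openin_schatten_topology:
  fixes U :: "'h::complex_inner bop set"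
  shows "openin (schatten_topology r) U \<longleftrightarrow> U \<subseteq> schatten r \<and>
     (\<forall>T\<in>U. \<exists>e>0. \<forall>S\<in>schatten r. schatten_norm r (S - T) < e \<longrightarrow> S \<in> U)"
proof -
  let ?P = "\<lambda>U :: 'h bop set. U \<subseteq> schatten r \<and>
    (\<forall>T\<in>U. \<exists>e>0. \<forall>S\<in>schatten r. schatten_norm r (S - T) < e \<longrightarrow> S \<in> U)"
  have "istopology ?P"
    unfolding istopology_def
  proof (intro conjI allI impI)
    fix U V :: "'h bop set" assume U: "?P U" and V: "?P V"
    then show "U \<inter> V \<subseteq> schatten r" by blast
    show "\<forall>T\<in>U \<inter> V. \<exists>e>0. \<forall>S\<in>schatten r. schatten_norm r (S - T) < e \<longrightarrow> S \<in> U \<inter> V"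
    proof
      fix T assume "T \<in> U \<inter> V"
      with U V obtain d e where "d > 0" "e > 0"
        "\<forall>S\<in>schatten r. schatten_norm r (S - T) < d \<longrightarrow> S \<in> U"
        "\<forall>S\<in>schatten r. schatten_norm r (S - T) < e \<longrightarrow> S \<in> V"
        by blast
      then show "\<exists>e>0. \<forall>S\<in>schatten r. schatten_norm r (S - T) < e \<longrightarrow> S \<in> U \<inter> V"
        by (intro exI[of _ "min d e"]) auto
    qed
  next
    fix K :: "'h bop set set" assume K: "\<forall>U\<in>K. ?P U"
    then show "\<Union>K \<subseteq> schatten r" by blast
    show "\<forall>T\<in>\<Union>K. \<exists>e>0. \<forall>S\<in>schatten r. schatten_norm r (S - T) < e \<longrightarrow> S \<in> \<Union>K"
      using K by (meson Union_iff)
  qed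
  then show ?thesis
    unfolding schatten_topology_def by (simp add: topology_inverse')
qed

lemma topspace_schatten_topology [simp]:
  "topspace (schatten_topology r) = (schatten r :: 'h::complex_inner bop set)"
proof -
  have "openin (schatten_topology r) (schatten r :: 'h bop set)"
    unfolding openin_schatten_topology using zero_less_one by blast
  then show ?thesis
    by (metis openin_schatten_topology openin_subset openin_topspace subset_antisym)
qed

text \<open>
  An unbounded operator is given by its domain \<open>S\<close> and a function \<open>D\<close>, whose values outside
  \<open>S\<close> are irrelevant.
\<close>

definition densely_defined :: "'h::complex_inner set \<Rightarrow> ('h \<Rightarrow> 'h) \<Rightarrow> bool" where
  "densely_defined S D \<longleftrightarrow> csubspace S \<and> clinear_on S D \<and> closure S = UNIV"

definition adjoint_domain :: "'h::complex_inner set \<Rightarrow> ('h \<Rightarrow> 'h) \<Rightarrow> 'h set" where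
  "adjoint_domain S D = {y. \<exists>z. \<forall>x\<in>S. cinner y (D x) = cinner z x}"

definition selfadjoint :: "'h::complex_inner set \<Rightarrow> ('h \<Rightarrow> 'h) \<Rightarrow> bool" where
  "selfadjoint S D \<longleftrightarrow>
     densely_defined S D \<and>
     (\<forall>x\<in>S. \<forall>y\<in>S. cinner (D x) y = cinner x (D y)) \<and>
     adjoint_domain S D = S"

definition is_resolvent :: "'h::complex_inner set \<Rightarrow> ('h \<Rightarrow> 'h) \<Rightarrow> complex \<Rightarrow> 'h bop \<Rightarrow> bool" where
  "is_resolvent S D z R \<longleftrightarrow>
     (\<forall>v. app R v \<in> S \<and> D (app R v) - z *\<^sub>C app R v = v) \<and>
     (\<forall>x\<in>S. app R (D x - z *\<^sub>C x) = x)"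

definition bounded_continuous :: "(real \<Rightarrow> complex) \<Rightarrow> bool" where
  "bounded_continuous f \<longleftrightarrow> continuous_on UNIV f \<and> bounded (range f)"

text \<open>
  The continuous functional calculus of a selfadjoint \<open>D\<close> is the unital *-homomorphism from the
  bounded continuous functions on the real line to the bounded operators that takes
  \<open>x \<mapsto> 1 / (x - z)\<close> to the resolvent \<open>(D - z)\<^sup>-\<^sup>1\<close> for every nonreal \<open>z\<close>.
  It is unique: resolvents determine it on the functions vanishing at infinity, and
  these act nondegenerately because the resolvents have dense range.
\<close>

definition functional_calculus ::
    "'h::complex_inner set \<Rightarrow> ('h \<Rightarrow> 'h) \<Rightarrow> ((real \<Rightarrow> complex) \<Rightarrow> 'h bop) \<Rightarrow> bool" where
  "functional_calculus S D \<Phi> \<longleftrightarrow>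
     (\<forall>f g. bounded_continuous f \<longrightarrow> bounded_continuous g \<longrightarrow>
        \<Phi> (\<lambda>x. f x + g x) = \<Phi> f + \<Phi> g \<and> \<Phi> (\<lambda>x. f x * g x) = \<Phi> f * \<Phi> g) \<and>
     (\<forall>c f. bounded_continuous f \<longrightarrow> \<Phi> (\<lambda>x. c * f x) = c *\<^sub>C \<Phi> f) \<and>
     (\<forall>f. bounded_continuous f \<longrightarrow> is_adjoint (\<Phi> f) (\<Phi> (\<lambda>x. cnj (f x)))) \<and>
     \<Phi> (\<lambda>x. 1) = 1 \<and>
     (\<forall>z. Im z \<noteq> 0 \<longrightarrow> is_resolvent S D z (\<Phi> (\<lambda>x. 1 / (complex_of_real x - z))))"

definition fun_of_op ::
    "'h::complex_inner set \<Rightarrow> ('h \<Rightarrow> 'h) \<Rightarrow> (real \<Rightarrow> real) \<Rightarrow> 'h bop" where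
  "fun_of_op S D f = (THE T. \<exists>\<Phi>. functional_calculus S D \<Phi> \<and> T = \<Phi> (\<lambda>x. complex_of_real (f x)))"

abbreviation inv_sqrt_op :: "'h::complex_inner set \<Rightarrow> ('h \<Rightarrow> 'h) \<Rightarrow> 'h bop" where
  "inv_sqrt_op S D \<equiv> fun_of_op S D (\<lambda>x. 1 / sqrt (1 + x\<^sup>2))"

text \<open>
  The carrier is the topspace of \<open>X\<close>. Continuity of the three operations includes that the carrier
  is closed under them. Hausdorffness is not required.
\<close>

definition locally_convex_algebra :: "'a::complex_algebra topology \<Rightarrow> bool" where
  "locally_convex_algebra X \<longleftrightarrow>
     0 \<in> topspace X \<and>
     continuous_map (prod_topology X X) X (\<lambda>(x, y). x + y) \<and>
     continuous_map (prod_topology euclidean X) X (\<lambda>(c, x). c *\<^sub>C x) \<and>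
     continuous_map (prod_topology X X) X (\<lambda>(x, y). x * y) \<and>
     (\<forall>U. openin X U \<and> 0 \<in> U \<longrightarrow> (\<exists>V. openin X V \<and> 0 \<in> V \<and> convex V \<and> V \<subseteq> U)) \<and>
     (\<forall>F. F \<noteq> bot \<and> (\<forall>\<^sub>F x in F. x \<in> topspace X) \<and>
        (\<forall>U. openin X U \<and> 0 \<in> U \<longrightarrow> (\<forall>\<^sub>F (x, y) in F \<times>\<^sub>F F. x - y \<in> U)) \<longrightarrow>
        (\<exists>l. limitin X (\<lambda>x. x) l F))"

definition algebra_hom_on ::
    "'a::complex_algebra set \<Rightarrow> ('a \<Rightarrow> 'b::complex_algebra) \<Rightarrow> bool" where
  "algebra_hom_on A \<phi> \<longleftrightarrow> clinear_on A \<phi> \<and> (\<forall>x\<in>A. \<forall>y\<in>A. \<phi> (x * y) = \<phi> x * \<phi> y)"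

definition involution_on :: "'a::complex_algebra set \<Rightarrow> ('a \<Rightarrow> 'a) \<Rightarrow> bool" where
  "involution_on A star \<longleftrightarrow>
     (\<forall>x\<in>A. star x \<in> A \<and> star (star x) = x) \<and>
     (\<forall>x\<in>A. \<forall>y\<in>A. star (x + y) = star x + star y \<and> star (x * y) = star y * star x) \<and>
     (\<forall>c. \<forall>x\<in>A. star (c *\<^sub>C x) = cnj c *\<^sub>C star x)"

definition has_bounded_commutator ::
    "'h::complex_inner set \<Rightarrow> ('h \<Rightarrow> 'h) \<Rightarrow> 'h bop \<Rightarrow> 'h bop \<Rightarrow> bool" where
  "has_bounded_commutator S D T K \<longleftrightarrow>
     app T ` S \<subseteq> S \<and> (\<forall>x\<in>S. D (app T x) - app T (D x) = app K x)"

definition commutator_op :: "'h::complex_inner set \<Rightarrow> ('h \<Rightarrow> 'h) \<Rightarrow> 'h bop \<Rightarrow> 'h bop" where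
  "commutator_op S D T = (THE K. has_bounded_commutator S D T K)"

definition spectral_triple ::
    "'a::complex_algebra set \<Rightarrow> ('a \<Rightarrow> 'a) \<Rightarrow> ('a \<Rightarrow> 'h::complex_hilbert bop) \<Rightarrow>
     'h set \<Rightarrow> ('h \<Rightarrow> 'h) \<Rightarrow> bool" where
  "spectral_triple A star \<phi> S D \<longleftrightarrow>
     involution_on A star \<and>
     algebra_hom_on A \<phi> \<and> (\<forall>a\<in>A. is_adjoint (\<phi> a) (\<phi> (star a))) \<and>
     selfadjoint S D \<and>
     (\<forall>a\<in>A. \<exists>K. has_bounded_commutator S D (\<phi> a) K) \<and>
     (\<forall>a\<in>A. compact_op (\<phi> a * inv_sqrt_op S D))"

definition even_spectral_triple ::
    "'a::complex_algebra set \<Rightarrow> ('a \<Rightarrow> 'a) \<Rightarrow> ('a \<Rightarrow> 'h::complex_hilbert bop) \<Rightarrow> 'h bop \<Rightarrow>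
     'h set \<Rightarrow> ('h \<Rightarrow> 'h) \<Rightarrow> bool" where
  "even_spectral_triple A star \<phi> \<epsilon> S D \<longleftrightarrow>
     spectral_triple A star \<phi> S D \<and>
     \<epsilon> * \<epsilon> = 1 \<and> is_adjoint \<epsilon> \<epsilon> \<and>
     (\<forall>a\<in>A. \<phi> a * \<epsilon> = \<epsilon> * \<phi> a) \<and>
     (\<forall>x\<in>S. app \<epsilon> x \<in> S \<and> D (app \<epsilon> x) = - app \<epsilon> (D x))"

text \<open>
  A representation of a locally convex algebra is required to be continuous for the operator norm.
  This does not follow from the continuity of the other three maps: take
  \<open>\<ell>\<^sup>\<infinity>\<close> with its strict topology, acting by multiplication on \<open>\<ell>\<^sup>2\<close>, and \<open>D\<close> a diagonal
  operator with exponentially growing entries.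
\<close>

definition continuous_summable_spectral_triple ::
    "real \<Rightarrow> 'a::complex_algebra topology \<Rightarrow> ('a \<Rightarrow> 'a) \<Rightarrow> ('a \<Rightarrow> 'h::complex_hilbert bop) \<Rightarrow>
     'h set \<Rightarrow> ('h \<Rightarrow> 'h) \<Rightarrow> bool" where
  "continuous_summable_spectral_triple p X star \<phi> S D \<longleftrightarrow>
     locally_convex_algebra X \<and>
     spectral_triple (topspace X) star \<phi> S D \<and>
     continuous_map X euclidean \<phi> \<and>
     continuous_map X euclidean (\<lambda>a. commutator_op S D (\<phi> a)) \<and>
     continuous_map X (schatten_topology p) (\<lambda>a. \<phi> a * inv_sqrt_op S D) \<and>
     continuous_map X (schatten_topology p) (\<lambda>a. inv_sqrt_op S D * \<phi> a)"

text \<open>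
  The ambient unital algebra is the type \<open>'b\<close>; it is not topologised. The algebra \<open>\<B>\<close> is a
  subset of it with its own topology \<open>Y\<close>, and continuity of a map into \<open>Y\<close> includes that the map
  is \<open>\<B>\<close>-valued.
\<close>

definition locally_convex_kasparov_module ::
    "'a::complex_algebra topology \<Rightarrow> 'b::{complex_algebra, monoid_mult} topology \<Rightarrow>
     ('a \<Rightarrow> 'b) \<Rightarrow> 'b \<Rightarrow> 'b \<Rightarrow> bool" where
  "locally_convex_kasparov_module X Y \<phi> \<epsilon> F \<longleftrightarrow>
     locally_convex_algebra X \<and> locally_convex_algebra Y \<and>
     algebra_hom_on (topspace X) \<phi> \<and>
     \<epsilon> * \<epsilon> = 1 \<and> F * \<epsilon> = - (\<epsilon> * F) \<and>
     (\<forall>a\<in>topspace X. \<phi> a * \<epsilon> - \<epsilon> * \<phi> a = 0) \<and>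
     continuous_map Y Y (\<lambda>b. b * F) \<and> continuous_map Y Y (\<lambda>b. F * b) \<and>
     continuous_map Y Y (\<lambda>b. \<epsilon> * b) \<and> continuous_map Y Y (\<lambda>b. b * \<epsilon>) \<and>
     continuous_map (prod_topology X Y) Y (\<lambda>(a, b). \<phi> a * b) \<and>
     continuous_map (prod_topology X Y) Y (\<lambda>(a, b). b * \<phi> a) \<and>
     continuous_map X Y (\<lambda>a. \<phi> a * (1 - F * F)) \<and>
     continuous_map X Y (\<lambda>a. (1 - F * F) * \<phi> a) \<and>
     continuous_map X Y (\<lambda>a. \<phi> a * F - F * \<phi> a)"

end

theory Submission
  imports Defs
begin

text \<open>
  Write \<open>F = q(D)\<close>, \<open>G = (1 + D\<^sup>2)\<^sup>-\<^sup>1\<^sup>/\<^sup>2\<close> and \<open>T = tanh(s/2)\<close> where \<open>D = sinh s\<close>, so that \<open>F = tanh s\<close>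
  and \<open>G = 1 / cosh s\<close>. If \<open>K = [D, a]\<close> is bounded, then \<open>G K G = F a G - G a F\<close>, and the relations
  \<open>T F = 1 - G\<close> and \<open>T (1 + G) = F\<close> give the identity
  \<open>[F, a] + T [F, a] T = G K G - T G K G T\<close>. Iterating it expands \<open>[F, a]\<close> into an alternating series;
  since \<open>\<parallel>G T\<^sup>k\<parallel> \<le> 2 / (k + 1)\<close>, this yields \<open>\<parallel>[F, a] y\<parallel>\<^sup>2 \<le> C\<^sup>2 \<parallel>K\<parallel>\<^sup>2 \<parallel>y\<parallel> \<parallel>G y\<parallel>\<close>. Applied on the complement
  of finitely many dimensions, it bounds the squares of the singular numbers of \<open>[F, a] b\<close> by those of
  \<open>G b\<close>, so \<open>[F, a] b\<close> is in \<open>\<L>\<^sup>2\<^sup>p\<close> and depends continuously on \<open>a\<close> and \<open>b\<close>. The adjoint statement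
  handles \<open>a [F, b]\<close>, and \<open>[F, a b] = [F, a] b + a [F, b]\<close> together with the multiplication being a
  quotient map makes \<open>a \<mapsto> [F, a]\<close> continuous.

  The Schatten norm, defined through distances to operators of finite rank, is equivalent to the supremum
  of \<open>\<Sum> w\<^sub>i \<bar>\<langle>y\<^sub>i, T x\<^sub>i\<rangle>\<bar>\<close> over orthonormal systems \<open>x\<close>, \<open>y\<close> and decreasing weights \<open>w\<close> in the dual unit
  ball, which is a norm; this makes the Schatten topology locally convex.

  The functional calculus of \<open>D\<close> is the strong limit of discretised Fejer sums of the Cayley transform.
  It is unique because a *-homomorphism on bounded continuous functions is contractive and the resolvents
  generate, by Stone-Weierstrass, all functions vanishing at infinity.
\<close>

text \<open>\<open>G\<close> by itself need not be compact; only \<open>G b\<close> and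
  \<open>a G\<close> are summable, which is why the commutator is estimated on products. The
  exponent \<open>2 p\<close> comes from the geometric mean in the bound on \<open>[F, a] y\<close>.
  In the k-th term \<open>T\<^sup>k G K G T\<^sup>k y\<close> the left \<open>G\<close> yields decay
  1/k. Bounding the right half by the norm of \<open>G y\<close> leaves the divergent sum of 1/k;
  bounding it by the norm of \<open>y\<close> loses all smallness. Splitting \<open>G\<close> into
  two square roots gives 1/k times 1/sqrt k, which is summable, and keeps one root on
  \<open>y\<close>. \<open>T\<close> may have norm 1, so the remainder of the series is controlled
  on the domain of \<open>D\<close> only, and the estimate extends by density. The recursion is the
  operator form of a scalar identity, given at \<open>commutator_recursion\<close>. Since singular
  numbers are distances here, vectors nearly attaining them are chosen greedily instead of
  spectrally. Constants such as 9, 4 and 36 compare topologies and are not optimised.\<close>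

lemma cinner_add_left: "cinner (x + y) z = cinner x z + cinner y (z :: 'a::complex_inner)"
  by (metis cinner_add_right cinner_commute complex_cnj_add)

lemma cinner_scaleR_right: "cinner x (r *\<^sub>R y) = r *\<^sub>R cinner x (y :: 'a::complex_inner)"
  by (simp add: cinner_scaleC_right scaleR_conv_of_real flip: scaleC_of_real)

lemma cinner_scaleR_left: "cinner (r *\<^sub>R x) y = r *\<^sub>R cinner x (y :: 'a::complex_inner)"
  by (simp add: cinner_scaleC_left scaleR_conv_of_real flip: scaleC_of_real)

lemma cinner_self: "cinner x x = complex_of_real ((norm (x :: 'a::complex_inner))\<^sup>2)"
proof -
  have "Im (cinner x x) = 0"
    by (metis cinner_commute cnj.simps(2) equal_neg_zero)
  then show ?thesis
    by (simp add: complex_eq_iff Re_cinner power2_norm_eq_inner)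
qed

lemma cinner_Cauchy_Schwarz: "cmod (cinner x y) \<le> norm x * norm (y :: 'a::complex_inner)"
proof (cases "cinner x y = 0")
  case False
  \<comment> \<open>This phase turns \<open>cinner x y\<close> into its modulus, so that the real
    Cauchy-Schwarz inequality applies.\<close>
  define c where "c = cnj (sgn (cinner x y))"
  have c: "cmod c = 1"
    using False by (simp add: c_def norm_sgn)
  have "cinner x (c *\<^sub>C y) = c * cinner x y"
    by (rule cinner_scaleC_right)
  also have "\<dots> = complex_of_real (cmod (cinner x y))"
    using False unfolding c_def sgn_eq
    by (simp add: complex_norm_square[symmetric] power2_eq_square mult.commute divide_simps)
  finally have "cmod (cinner x y) = inner x (c *\<^sub>C y)"
    by (metis Re_cinner Re_complex_of_real)
  also have "\<dots> \<le> norm x * norm (c *\<^sub>C y)"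
    by (rule norm_cauchy_schwarz)
  finally show ?thesis
    by (simp add: norm_scaleC c)
qed simp

interpretation cinner: bounded_bilinear "cinner :: 'a::complex_inner \<Rightarrow> 'a \<Rightarrow> complex"
  by standard (auto simp: cinner_add_left cinner_add_right cinner_scaleR_left cinner_scaleR_right
      intro!: exI[of _ 1] cinner_Cauchy_Schwarz)

interpretation scaleC: bounded_bilinear "scaleC :: complex \<Rightarrow> 'a::complex_inner \<Rightarrow> 'a"
proof
  show "(r *\<^sub>R c) *\<^sub>C x = r *\<^sub>R c *\<^sub>C x" for r c and x :: 'a
    by (metis scaleC_of_real scaleC_scaleC scaleR_conv_of_real)
qed (auto simp: scaleC_add_left scaleC_add_right scaleC_scaleR norm_scaleC intro!: exI[of _ 1])

lemma scaleC_one [simp]: "1 *\<^sub>C (x :: 'a::complex_vector) = x"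
  using scaleC_of_real[of 1 x] by simp

lemma scaleC_zero [simp]: "0 *\<^sub>C (x :: 'a::complex_vector) = 0"
  using scaleC_of_real[of 0 x] by simp

lemma scaleC_minus_left [simp]: "(- c) *\<^sub>C (x :: 'a::complex_vector) = - (c *\<^sub>C x)"
  by (metis add.right_inverse add_eq_0_iff scaleC_add_left scaleC_zero)

lemma scaleC_diff_left: "(c - d) *\<^sub>C (x :: 'a::complex_vector) = c *\<^sub>C x - d *\<^sub>C x"
  by (metis add_diff_cancel diff_add_cancel scaleC_add_left)

lemma scaleC_sum_right: "c *\<^sub>C (\<Sum>i\<in>I. f i) = (\<Sum>i\<in>I. c *\<^sub>C (f i :: 'a::complex_vector))"
  by (induction I rule: infinite_finite_induct) (simp_all add: scaleC_zero_right scaleC_add_right)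

declare scaleC_zero_right [simp] cinner.zero_left [simp] cinner.zero_right [simp]

lemma cinner_ext_right:
  fixes x y :: "'a::complex_inner"
  assumes "\<And>z. cinner z x = cinner z y"
  shows "x = y"
proof -
  have "cinner (x - y) (x - y) = 0"
    using assms[of "x - y"] by (simp add: cinner.diff_right)
  then show ?thesis by (simp add: cinner_self)
qed

lemma cinner_ext_left:
  fixes x y :: "'a::complex_inner"
  assumes "\<And>z. cinner x z = cinner y z"
  shows "x = y"
  by (rule cinner_ext_right) (subst (1 2) cinner_commute, simp add: assms)

lemma cinner_commute_zero: "cinner x y = 0 \<longleftrightarrow> cinner y x = (0 :: complex)" for x y :: "'a::complex_inner"
  by (metis cinner_commute complex_cnj_zero)

lemma norm_le_of_cinner:
  fixes x :: "'a::complex_inner"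
  assumes "0 \<le> c" "\<And>y. cmod (cinner y x) \<le> norm y * c"
  shows "norm x \<le> c"
proof (cases "x = 0")
  case False
  have "norm x * norm x \<le> norm x * c"
    using assms(2)[of x] by (simp add: cinner_self power2_eq_square norm_mult)
  then show ?thesis using False by simp
qed (use assms in simp)

lemma norm_add_orthogonal:
  fixes x y :: "'a::complex_inner"
  assumes "cinner x y = 0"
  shows "(norm (x + y))\<^sup>2 = (norm x)\<^sup>2 + (norm y)\<^sup>2"
proof -
  have "inner x y = 0" using assms Re_cinner[of x y] by simp
  then show ?thesis
    by (simp add: power2_norm_eq_inner inner_add_left inner_add_right inner_commute)
qed

section \<open>Bounded operators\<close>

interpretation app: bounded_bilinear "app :: 'h::complex_inner bop \<Rightarrow> 'h \<Rightarrow> 'h"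
  by (standard; (transfer, simp add: blinfun.bilinear_simps)?)
    (intro exI[of _ 1] allI, transfer, simp add: norm_blinfun)

lemma app_mult [simp]: "app (S * T) x = app S (app T x)"
  by transfer simp

lemma app_one [simp]: "app 1 x = x"
  by transfer simp

lemma app_scaleC_right: "app T (c *\<^sub>C x) = c *\<^sub>C app T x"
  by transfer simp

lemma app_scaleC_left [simp]: "app (c *\<^sub>C T) x = c *\<^sub>C app T x"
  by transfer (simp add: bounded_linear_Blinfun_apply[OF bounded_linear_scaleC])

lemmas app_simps = app.add_left app.diff_left app.minus_left app.zero_left app.scaleR_left
  app.add_right app.diff_right app.minus_right app.zero_right app.scaleR_right
  app.sum_left app.sum_right app_scaleC_right

lemma bop_eqI: "(\<And>x. app S x = app T x) \<Longrightarrow> S = T"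
  by transfer (rule blinfun_eqI)

lemma norm_app_le: "norm (app T x) \<le> norm T * norm x"
  by transfer (rule norm_blinfun)

lemma norm_bop_le: "0 \<le> b \<Longrightarrow> (\<And>x. norm (app T x) \<le> b * norm x) \<Longrightarrow> norm T \<le> b"
  by transfer (rule norm_blinfun_bound)

lemma norm_bop_less_ex:
  fixes T :: "'h::complex_inner bop"
  assumes "0 \<le> b" "b < norm T"
  obtains x where "b * norm x < norm (app T x)"
  using assms norm_bop_le[of b T] by (meson leD leI)

lemma norm_one_bop_le: "norm (1 :: 'h::complex_inner bop) \<le> 1"
  by (rule norm_bop_le) auto

lemma norm_scaleC_bop_le: "norm (c *\<^sub>C T) \<le> cmod c * norm (T :: 'h::complex_inner bop)"
  by (rule norm_bop_le) (auto simp: norm_scaleC mult.assoc intro: mult_left_mono norm_app_le)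

lemma ex_bop:
  fixes f :: "'h::complex_inner \<Rightarrow> 'h"
  assumes "\<And>x y. f (x + y) = f x + f y" "\<And>c x. f (c *\<^sub>C x) = c *\<^sub>C f x"
    and "\<And>x. norm (f x) \<le> K * norm x"
  shows "\<exists>T. \<forall>x. app T x = f x"
proof -
  have bl: "bounded_linear f"
    by (rule bounded_linear_intro[where K = K])
      (use assms in \<open>auto simp: mult.commute simp flip: scaleC_of_real\<close>)
  have "app (Abs_bop (Blinfun f)) x = f x" for x
    using assms(2) by (simp add: app.rep_eq Abs_bop_inverse bounded_linear_Blinfun_apply[OF bl])
  then show ?thesis by blast
qed

instance complex_hilbert \<subseteq> banach ..

instance bop :: (complex_hilbert) banach
proof
  fix X :: "nat \<Rightarrow> 'a bop" assume X: "Cauchy X"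
  have "Cauchy (\<lambda>n. Rep_bop (X n))"
    using X unfolding Cauchy_def dist_norm norm_bop.rep_eq minus_bop.rep_eq .
  then obtain L where L: "(\<lambda>n. Rep_bop (X n)) \<longlonglongrightarrow> L"
    by (auto simp: Cauchy_convergent_iff convergent_def)
  have "blinfun_apply L (c *\<^sub>C x) = c *\<^sub>C blinfun_apply L x" for c x
  proof -
    have "(\<lambda>n. blinfun_apply (Rep_bop (X n)) (c *\<^sub>C x)) \<longlonglongrightarrow> blinfun_apply L (c *\<^sub>C x)"
      by (intro tendsto_intros L)
    moreover have "(\<lambda>n. c *\<^sub>C blinfun_apply (Rep_bop (X n)) x) \<longlonglongrightarrow> c *\<^sub>C blinfun_apply L x"
      by (intro scaleC.tendsto tendsto_intros L)
    moreover have "blinfun_apply (Rep_bop (X n)) (c *\<^sub>C x) = c *\<^sub>C blinfun_apply (Rep_bop (X n)) x" for n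
      using Rep_bop[of "X n"] by simp
    ultimately show ?thesis by (simp add: LIMSEQ_unique)
  qed
  then have "Rep_bop (Abs_bop L) = L" by (simp add: Abs_bop_inverse)
  then have "X \<longlonglongrightarrow> Abs_bop L"
    using L by (simp add: tendsto_iff dist_norm norm_bop.rep_eq minus_bop.rep_eq)
  then show "convergent X" by (auto simp: convergent_def)
qed

section \<open>Projection theorem and adjoints\<close>

text \<open>A minimising sequence is Cauchy by the parallelogram law: the midpoint of two
  near-minimisers lies in the convex set, so it cannot be closer to \<open>x\<close> than the
  infimum.\<close>

lemma ex_closest_point:
  fixes M :: "'h::{real_inner,complete_space} set"
  assumes "closed M" "convex M" "M \<noteq> {}"
  shows "\<exists>m\<in>M. \<forall>z\<in>M. dist x m \<le> dist x z"
proof -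
  define d where "d = infdist x M"
  have d: "0 \<le> d" "\<And>z. z \<in> M \<Longrightarrow> d \<le> dist x z"
    unfolding d_def using infdist_nonneg infdist_le by blast+
  have "\<exists>m\<in>M. (dist x m)\<^sup>2 < d\<^sup>2 + inverse (real (Suc n))" for n
  proof -
    have "d < sqrt (d\<^sup>2 + inverse (real (Suc n)))"
      by (rule real_less_rsqrt) auto
    moreover have "d = (INF a\<in>M. dist x a)"
      unfolding d_def infdist_def using assms by simp
    ultimately have "\<exists>m\<in>M. dist x m < sqrt (d\<^sup>2 + inverse (real (Suc n)))"
      using cINF_less_iff[OF assms(3) bdd_belowI2[of M 0 "dist x"]] by (metis zero_le_dist)
    then obtain m where "m \<in> M" "dist x m < sqrt (d\<^sup>2 + inverse (real (Suc n)))" by blast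
    then have "(dist x m)\<^sup>2 < (sqrt (d\<^sup>2 + inverse (real (Suc n))))\<^sup>2"
      by (intro power_strict_mono) auto
    then show ?thesis using \<open>m \<in> M\<close> by (auto simp: add_nonneg_nonneg)
  qed
  then obtain m where m: "\<And>n. m n \<in> M" "\<And>n. (dist x (m n))\<^sup>2 < d\<^sup>2 + inverse (real (Suc n))"
    by metis
  have close: "(dist (m i) (m j))\<^sup>2 \<le> 2 * inverse (real (Suc i)) + 2 * inverse (real (Suc j))" for i j
  proof -
    have "(1/2) *\<^sub>R m i + (1/2) *\<^sub>R m j \<in> M"
      using assms(2) m(1) by (intro convexD) auto
    then have "d\<^sup>2 \<le> (norm (x - ((1/2) *\<^sub>R m i + (1/2) *\<^sub>R m j)))\<^sup>2"
      using d by (metis dist_norm power_mono)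
    moreover have "(norm (m i - m j))\<^sup>2 = 2 * (norm (x - m i))\<^sup>2 + 2 * (norm (x - m j))\<^sup>2
       - 4 * (norm (x - ((1/2) *\<^sub>R m i + (1/2) *\<^sub>R m j)))\<^sup>2"
      unfolding power2_norm_eq_inner
      by (simp add: algebra_simps inner_commute)
    ultimately show ?thesis
      using m(2)[of i] m(2)[of j] unfolding dist_norm by linarith
  qed
  have "Cauchy m"
  proof (rule metric_CauchyI)
    fix e :: real assume "e > 0"
    then obtain N where N: "inverse (real (Suc N)) < e\<^sup>2 / 4"
      using reals_Archimedean[of "e\<^sup>2 / 4"] by auto
    have "dist (m i) (m j) < e" if "i \<ge> N" "j \<ge> N" for i j
    proof -
      have "inverse (real (Suc i)) \<le> inverse (real (Suc N))" "inverse (real (Suc j)) \<le> inverse (real (Suc N))"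
        using that by auto
      then have "(dist (m i) (m j))\<^sup>2 < e\<^sup>2"
        using close[of i j] N by linarith
      then show ?thesis using \<open>e > 0\<close> by (simp add: power_less_imp_less_base)
    qed
    then show "\<exists>N. \<forall>i\<ge>N. \<forall>j\<ge>N. dist (m i) (m j) < e" by blast
  qed
  then obtain l where l: "m \<longlonglongrightarrow> l" using Cauchy_convergent convergent_def by blast
  have "l \<in> M" using closed_sequentially[OF assms(1) m(1) l] by simp
  moreover have "(dist x l)\<^sup>2 \<le> d\<^sup>2"
  proof (rule LIMSEQ_le)
    show "(\<lambda>n. (dist x (m n))\<^sup>2) \<longlonglongrightarrow> (dist x l)\<^sup>2" by (intro tendsto_intros l)
    show "(\<lambda>n. d\<^sup>2 + inverse (real (Suc n))) \<longlonglongrightarrow> d\<^sup>2"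
      using tendsto_add[OF tendsto_const LIMSEQ_inverse_real_of_nat] by fastforce
    show "\<exists>N. \<forall>n\<ge>N. (dist x (m n))\<^sup>2 \<le> d\<^sup>2 + inverse (real (Suc n))"
      using m(2) less_imp_le by blast
  qed
  then have "dist x l \<le> d" using d(1) power2_le_imp_le by blast
  ultimately show ?thesis using d(2) order_trans by blast
qed

text \<open>The residual at the closest point satisfies a variational inequality on all of
  \<open>M\<close>; as \<open>M\<close> is a complex subspace, a suitable multiple of each vector
  turns it into orthogonality.\<close>

lemma orthogonal_vector:
  fixes M :: "'h::complex_hilbert set"
  assumes "closed M" "csubspace M" "x \<notin> M"
  obtains z where "z \<noteq> 0" "x - z \<in> M" "\<And>m. m \<in> M \<Longrightarrow> cinner z m = 0"
proof -
  have cv: "convex M"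
    using assms(2) unfolding csubspace_def convex_def by (metis scaleC_of_real)
  obtain m where m: "m \<in> M" "\<And>z. z \<in> M \<Longrightarrow> dist x m \<le> dist x z"
    using ex_closest_point[OF assms(1) cv, of x] assms(2) unfolding csubspace_def by blast
  have le: "inner (x - m) v \<le> 0" if "v \<in> M" for v
  proof -
    have "m + v \<in> M" using m that assms(2) unfolding csubspace_def by blast
    then show ?thesis
      using any_closest_point_dot[OF cv assms(1) m(1), of "m + v" x] m by auto
  qed
  have sc: "c *\<^sub>C v \<in> M" if "v \<in> M" for v c
    using that assms(2) unfolding csubspace_def by blast
  have "cinner (x - m) v = 0" if v: "v \<in> M" for v
  proof -
    define a where "a = cinner (x - m) v"
    \<comment> \<open>With this multiple the inner product is \<open>cnj a * a\<close>, so the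
      inequality bounds the squared modulus of \<open>a\<close> by 0.\<close>
    have "Re (cinner (x - m) (cnj a *\<^sub>C v)) \<le> 0"
      using le[OF sc[OF v]] by (simp add: Re_cinner)
    then have "(Re a)\<^sup>2 + (Im a)\<^sup>2 \<le> 0"
      by (simp add: cinner_scaleC_right a_def[symmetric] power2_eq_square)
    then have "(cmod a)\<^sup>2 \<le> 0"
      by (simp only: cmod_power2)
    then show ?thesis by (simp add: a_def)
  qed
  moreover have "x - m \<noteq> 0" "x - (x - m) \<in> M" using m assms by auto
  ultimately show thesis using that by blast
qed

lemma Riesz_representation:
  fixes f :: "'h::complex_hilbert \<Rightarrow> complex"
  assumes add: "\<And>x y. f (x + y) = f x + f y" and sc: "\<And>c x. f (c *\<^sub>C x) = c * f x"
    and bd: "\<And>x. cmod (f x) \<le> K * norm x"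
  shows "\<exists>y. \<forall>x. f x = cinner y x"
proof (cases "\<forall>x. f x = 0")
  case True
  then show ?thesis by (intro exI[of _ 0]) simp
next
  case False
  then obtain x where x: "f x \<noteq> 0" by blast
  have bl: "bounded_linear f"
    by (rule bounded_linear_intro[where K = K])
      (use assms in \<open>auto simp: mult.commute scaleR_conv_of_real simp flip: scaleC_of_real\<close>)
  let ?M = "{x. f x = 0}"
  have "closed ?M"
    by (intro closed_Collect_eq continuous_intros linear_continuous_on bl)
  moreover have "csubspace ?M"
    unfolding csubspace_def using add sc by (auto simp: linear_0[OF bounded_linear.linear[OF bl]])
  moreover have "x \<notin> ?M" using x by simp
  ultimately obtain z where z: "z \<noteq> 0" "\<And>m. m \<in> ?M \<Longrightarrow> cinner z m = 0"
    by (metis orthogonal_vector)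
  have zz: "cinner z z \<noteq> 0" using z by (simp add: cinner_self)
  then have fz: "f z \<noteq> 0" using z(2)[of z] by auto
  have "f x = cinner (cnj (f z / cinner z z) *\<^sub>C z) x" for x
  proof -
    \<comment> \<open>This combination lies in the kernel of \<open>f\<close>, hence is orthogonal
      to \<open>z\<close>; solving for \<open>f x\<close> gives the representing vector.\<close>
    have "f (f z *\<^sub>C x - f x *\<^sub>C z) = 0"
      by (simp add: linear_diff[OF bounded_linear.linear[OF bl]] sc)
    with z(2)[of "f z *\<^sub>C x - f x *\<^sub>C z"] have "f x * cinner z z = f z * cinner z x"
      by (simp add: cinner.diff_right cinner_scaleC_right)
    then have "f x = f z / cinner z z * cinner z x"
      using zz by (simp add: nonzero_eq_divide_eq)
    then show ?thesis
      by (simp only: cinner_scaleC_left complex_cnj_cnj)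
  qed
  then show ?thesis by blast
qed

definition adj :: "'h::complex_hilbert bop \<Rightarrow> 'h bop" where
  "adj T = (SOME T'. is_adjoint T T')"

lemma is_adjoint_adj: "is_adjoint T (adj T)"
proof -
  have "\<exists>z. \<forall>y. cinner x (app T y) = cinner z y" for x
  proof (rule Riesz_representation[where K = "norm x * norm T"])
    show "cmod (cinner x (app T y)) \<le> norm x * norm T * norm y" for y
      using order_trans[OF cinner_Cauchy_Schwarz mult_left_mono[OF norm_app_le]]
      by (simp add: mult.assoc)
  qed (simp_all add: app.add_right cinner_add_right app_scaleC_right cinner_scaleC_right)
  then have "\<forall>x. \<exists>z. \<forall>y. cinner x (app T y) = cinner z y" by blast
  from choice[OF this] obtain f where f: "\<And>x y. cinner (f x) y = cinner x (app T y)"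
    by auto
  have "\<exists>T'. \<forall>x. app T' x = f x"
  proof (rule ex_bop)
    show "f (x + y) = f x + f y" for x y
      by (rule cinner_ext_left) (simp add: f cinner_add_left)
    show "f (c *\<^sub>C x) = c *\<^sub>C f x" for c x
      by (rule cinner_ext_left) (simp add: f cinner_scaleC_left)
    show "norm (f x) \<le> norm T * norm x" for x
    proof (rule norm_le_of_cinner)
      fix y
      have "cmod (cinner y (f x)) = cmod (cinner x (app T y))"
        by (subst cinner_commute) (simp add: f)
      also have "\<dots> \<le> norm x * (norm T * norm y)"
        by (intro order_trans[OF cinner_Cauchy_Schwarz] mult_left_mono norm_app_le) simp
      finally show "cmod (cinner y (f x)) \<le> norm y * (norm T * norm x)"
        by (simp add: mult_ac)
    qed simp
  qed
  then obtain T' where "\<And>x. app T' x = f x" by blast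
  then have "is_adjoint T T'"
    by (simp add: is_adjoint_def f)
  then show ?thesis unfolding adj_def by (rule someI)
qed

lemma cinner_adj_left: "cinner (app (adj T) x) y = cinner x (app T y)"
  using is_adjoint_adj[of T] by (simp add: is_adjoint_def)

lemma cinner_adj_right: "cinner x (app (adj T) y) = cinner (app T x) y"
  using cinner_commute[of x "app (adj T) y"] cinner_commute[of "app T x" y]
  by (simp add: cinner_adj_left)

lemma adj_eqI:
  assumes "is_adjoint T T'"
  shows "adj T = T'"
  using assms by (intro bop_eqI cinner_ext_left) (simp add: is_adjoint_def cinner_adj_left)

lemma adj_adj [simp]: "adj (adj T) = T"
  by (rule adj_eqI) (simp add: is_adjoint_def cinner_adj_right)

lemma adj_mult: "adj (S * T) = adj T * adj S"
  by (rule adj_eqI) (simp add: is_adjoint_def cinner_adj_left)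

lemma adj_diff: "adj (S - T) = adj S - adj T"
  by (rule adj_eqI) (simp add: is_adjoint_def cinner_adj_left app_simps cinner.diff_left cinner.diff_right)

lemma norm_adj_le: "norm (adj T) \<le> norm T"
proof (rule norm_bop_le)
  fix x
  show "norm (app (adj T) x) \<le> norm T * norm x"
  proof (rule norm_le_of_cinner)
    fix y
    have "cmod (cinner y (app (adj T) x)) \<le> norm T * norm y * norm x"
      unfolding cinner_adj_right
      by (intro order_trans[OF cinner_Cauchy_Schwarz] mult_right_mono norm_app_le) simp
    then show "cmod (cinner y (app (adj T) x)) \<le> norm y * (norm T * norm x)"
      by (simp add: mult_ac)
  qed simp
qed simp

lemma norm_adj [simp]: "norm (adj T) = norm T"
  using norm_adj_le[of T] norm_adj_le[of "adj T"] by simp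

section \<open>Orthonormal families\<close>

text \<open>A family over an initial segment rather than a set: it gets extended by function update,
  truncated to shorter segments, and paired index by index with weights.\<close>

definition orthonormal :: "nat \<Rightarrow> (nat \<Rightarrow> 'h::complex_inner) \<Rightarrow> bool" where
  "orthonormal k x \<longleftrightarrow> (\<forall>i<k. \<forall>j<k. cinner (x i) (x j) = (if i = j then 1 else 0))"

lemma orthonormal_norm: "orthonormal k x \<Longrightarrow> i < k \<Longrightarrow> norm (x i) = 1"
proof -
  assume "orthonormal k x" "i < k"
  then have "cinner (x i) (x i) = 1" by (simp add: orthonormal_def)
  then have "(norm (x i))\<^sup>2 = 1"
    by (metis cinner_self of_real_eq_1_iff)
  then show "norm (x i) = 1" by (simp add: power2_eq_1_iff) (metis norm_ge_zero not_one_le_zero neg_0_le_iff_le)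
qed

lemma orthonormal_extend:
  assumes "orthonormal k f" "norm v = 1" "\<And>i. i < k \<Longrightarrow> cinner (f i) v = 0"
  shows "orthonormal (Suc k) (f(k := v))"
proof -
  have "cinner v (f i) = 0" if "i < k" for i
    using assms(3)[OF that] by (metis cinner_commute_zero)
  then show ?thesis
    using assms unfolding orthonormal_def by (auto simp: less_Suc_eq cinner_self)
qed

lemma cinner_orthonormal_sum:
  assumes "orthonormal k f" "j < k"
  shows "cinner (f j) (\<Sum>i<k. c i *\<^sub>C f i) = c j"
proof -
  have "cinner (f j) (\<Sum>i<k. c i *\<^sub>C f i) = (\<Sum>i<k. c i * cinner (f j) (f i))"
    by (simp add: cinner.sum_right cinner_scaleC_right)
  also have "\<dots> = (\<Sum>i<k. if i = j then c i else 0)"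
    using assms by (intro sum.cong) (auto simp: orthonormal_def)
  finally show ?thesis using assms by simp
qed

lemma norm_orthonormal_sum:
  assumes "orthonormal k f"
  shows "(norm (\<Sum>i<k. c i *\<^sub>C f i))\<^sup>2 = (\<Sum>i<k. (cmod (c i))\<^sup>2)"
proof -
  have "cinner (\<Sum>i<k. c i *\<^sub>C f i) (\<Sum>i<k. c i *\<^sub>C f i) = (\<Sum>j<k. cnj (c j) * c j)"
    unfolding cinner.sum_left cinner_scaleC_left
    by (intro sum.cong refl) (simp add: cinner_orthonormal_sum[OF assms])
  also have "\<dots> = complex_of_real (\<Sum>i<k. (cmod (c i))\<^sup>2)"
    by (simp only: of_real_sum complex_norm_square mult.commute)
  finally show ?thesis by (simp only: cinner_self of_real_eq_iff)
qed

definition rank_one :: "'h::complex_inner \<Rightarrow> 'h \<Rightarrow> 'h bop" where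
  "rank_one u v = (SOME T. \<forall>x. app T x = cinner v x *\<^sub>C u)"

lemma app_rank_one [simp]: "app (rank_one u v) x = cinner v x *\<^sub>C u"
proof -
  have "\<exists>T. \<forall>x. app T x = cinner v x *\<^sub>C u"
  proof (rule ex_bop)
    show "norm (cinner v x *\<^sub>C u) \<le> (norm v * norm u) * norm x" for x
      using mult_right_mono[OF cinner_Cauchy_Schwarz, of "norm u" v x]
      by (simp add: norm_scaleC mult_ac)
  qed (simp_all add: cinner_add_right cinner_scaleC_right scaleC_add_left scaleC_scaleC)
  then show ?thesis unfolding rank_one_def by (rule someI_ex[THEN spec])
qed

definition proj :: "nat \<Rightarrow> (nat \<Rightarrow> 'h::complex_inner) \<Rightarrow> 'h bop" where
  "proj k f = (\<Sum>i<k. rank_one (f i) (f i))"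

lemma app_proj: "app (proj k f) x = (\<Sum>i<k. cinner (f i) x *\<^sub>C f i)"
  by (simp add: proj_def app.sum_left)

lemma cinner_proj_compl:
  "orthonormal k f \<Longrightarrow> j < k \<Longrightarrow> cinner (f j) (app (1 - proj k f) x) = 0"
  using cinner_orthonormal_sum[of k f j "\<lambda>i. cinner (f i) x"]
  by (simp add: app_simps app_proj cinner.diff_right)

lemma norm_proj_Pythagoras:
  assumes "orthonormal k f"
  shows "(norm x)\<^sup>2 = (norm (app (1 - proj k f) x))\<^sup>2 + (\<Sum>i<k. (cmod (cinner (f i) x))\<^sup>2)"
proof -
  have "cinner (app (1 - proj k f) x) (app (proj k f) x) = 0"
    unfolding app_proj[of k f x] cinner.sum_right cinner_scaleC_right
    by (intro sum.neutral) (auto simp: cinner_commute_zero[of "app (1 - proj k f) x"] cinner_proj_compl[OF assms])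
  from norm_add_orthogonal[OF this] show ?thesis
    by (simp add: app_simps app_proj norm_orthonormal_sum[OF assms])
qed

lemma Bessel: "orthonormal k f \<Longrightarrow> (\<Sum>i<k. (cmod (cinner (f i) x))\<^sup>2) \<le> (norm x)\<^sup>2"
  using norm_proj_Pythagoras[of k f x] by simp

lemma norm_proj_compl_le: "orthonormal k f \<Longrightarrow> norm (1 - proj k f) \<le> 1"
proof (rule norm_bop_le)
  fix x assume f: "orthonormal k f"
  have "(norm (app (1 - proj k f) x))\<^sup>2 \<le> (norm x)\<^sup>2"
    using norm_proj_Pythagoras[OF f, of x] by (simp add: sum_nonneg)
  then show "norm (app (1 - proj k f) x) \<le> 1 * norm x"
    by (auto intro: power2_le_imp_le)
qed simp

text \<open>Vectors already fixed by the projection are skipped, so \<open>m\<close> stays below the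
  cardinality; otherwise the normalised residual is appended. That the span contains
  \<open>B\<close> is phrased as invariance under \<open>proj m f\<close>, the form in which finite
  rank operators are compressed later.\<close>

lemma Gram_Schmidt:
  fixes B :: "'h::complex_inner set"
  assumes "finite B"
  shows "\<exists>m f. m \<le> card B \<and> orthonormal m f \<and> (\<forall>b\<in>B. app (proj m f) b = b)"
  using assms
proof (induction B)
  case empty
  show ?case by (rule exI[of _ 0]) (simp add: orthonormal_def)
next
  case (insert b B)
  then obtain m f where mf: "m \<le> card B" "orthonormal m f" "\<And>b. b \<in> B \<Longrightarrow> app (proj m f) b = b"
    by blast
  define r where "r = app (1 - proj m f) b"
  show ?case
  proof (cases "r = 0")
    case True
    then have "app (proj m f) b = b" by (simp add: r_def app_simps)
    then show ?thesis using mf insert by (intro exI[of _ m] exI[of _ f]) auto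
  next
    case False
    define v where "v = inverse (norm r) *\<^sub>R r"
    define f' where "f' = f(m := v)"
    have ort: "cinner (f i) r = 0" if "i < m" for i
      using that mf(2) by (simp add: r_def cinner_proj_compl)
    then have on: "orthonormal (Suc m) f'"
      unfolding f'_def using False mf(2)
      by (intro orthonormal_extend) (auto simp: v_def cinner_scaleR_right)
    have step: "app (proj (Suc m) f') x = app (proj m f) x + cinner v x *\<^sub>C v" for x
      by (simp add: app_proj f'_def)
    have "cinner r (f i) = 0" if "i < m" for i
      using ort[OF that] by (metis cinner_commute_zero)
    then have ort': "cinner v (app (proj m f) x) = 0" for x
      by (auto simp: v_def app_proj cinner.sum_right cinner_scaleC_right cinner_scaleR_left
          intro!: sum.neutral)
    have "cinner v x = 0" if "x \<in> B" for x
      using ort'[of x] mf(3)[OF that] by simp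
    moreover have "cinner v b *\<^sub>C v = r"
    proof -
      have "b = app (proj m f) b + r" by (simp add: r_def app_simps)
      then have "cinner v b = cinner v r" using ort'[of b] by (metis add_0 cinner_add_right)
      also have "\<dots> = complex_of_real (norm r)"
        by (simp add: v_def cinner_scaleR_left cinner_self power2_eq_square scaleR_conv_of_real False)
      finally show ?thesis using False by (simp add: v_def scaleC_of_real)
    qed
    ultimately have "\<forall>x\<in>insert b B. app (proj (Suc m) f') x = x"
      using mf(3) by (auto simp: step r_def app_simps)
    then show ?thesis
      using on mf insert by (intro exI[of _ "Suc m"] exI[of _ f']) auto
  qed
qed

section \<open>Singular numbers\<close>

lemma cmod_cinner_commute: "cmod (cinner x y) = cmod (cinner y (x :: 'a::complex_inner))"
  by (subst cinner_commute) simp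

lemma adj_proj [simp]: "adj (proj k f) = proj k f"
proof (rule adj_eqI)
  have "cnj (cinner a b) = cinner b a" for a b :: 'a
    by (subst (2) cinner_commute) simp
  then show "is_adjoint (proj k f) (proj k f)"
    by (simp add: is_adjoint_def app_proj cinner.sum_left cinner.sum_right cinner_scaleC_left
      cinner_scaleC_right mult.commute)
qed

lemma cinner_proj_proj_compl:
  "orthonormal k f \<Longrightarrow> cinner (app (proj k f) x) (app (1 - proj k f) y) = 0"
  unfolding app_proj[of k f x] cinner.sum_left cinner_scaleC_left
  by (simp add: cinner_proj_compl)

lemma rank_leI:
  assumes "\<And>x. app T x = (\<Sum>i<n. c x i *\<^sub>C f i)"
  shows "rank_le n T"
proof -
  \<comment> \<open>\<open>rank_le\<close> speaks of a set of vectors, while the values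
    \<open>f i\<close> may coincide; the coefficients are collected over the fibres of
    \<open>f\<close>.\<close>
  have "app T x = (\<Sum>b\<in>f ` {..<n}. (\<Sum>i | i < n \<and> f i = b. c x i) *\<^sub>C b)" for x
  proof -
    have "app T x = (\<Sum>b\<in>f ` {..<n}. \<Sum>i | i \<in> {..<n} \<and> f i = b. c x i *\<^sub>C f i)"
      unfolding assms by (rule sum.image_gen) simp
    also have "\<dots> = (\<Sum>b\<in>f ` {..<n}. (\<Sum>i | i < n \<and> f i = b. c x i) *\<^sub>C b)"
      by (intro sum.cong refl) (simp add: scaleC.sum_left)
    finally show ?thesis .
  qed
  moreover have "card (f ` {..<n}) \<le> n"
    by (metis card_image_le card_lessThan finite_lessThan)
  ultimately show ?thesis
    unfolding rank_le_def by (intro exI[of _ "f ` {..<n}"]) auto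
qed

lemma rank_le_mono: "rank_le m T \<Longrightarrow> m \<le> n \<Longrightarrow> rank_le n T"
  unfolding rank_le_def by (meson le_trans)

lemma rank_leE:
  assumes "rank_le n T"
  obtains m f where "m \<le> n" "orthonormal m f" "proj m f * T = T"
proof -
  obtain B where B: "finite B" "card B \<le> n" "\<And>x. \<exists>c. app T x = (\<Sum>b\<in>B. c b *\<^sub>C b)"
    using assms unfolding rank_le_def by blast
  obtain m f where mf: "m \<le> card B" "orthonormal m f" "\<forall>b\<in>B. app (proj m f) b = b"
    using Gram_Schmidt[OF B(1)] by blast
  have "app (proj m f) (app T x) = app T x" for x
  proof -
    obtain c where "app T x = (\<Sum>b\<in>B. c b *\<^sub>C b)" using B(3) by blast
    then show ?thesis using mf(3) by (simp add: app_simps)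
  qed
  then have "proj m f * T = T" by (intro bop_eqI) simp
  then show thesis
    by (rule that[OF le_trans[OF mf(1) B(2)] mf(2)])
qed

lemma rank_le_proj_mult: "rank_le k (A * proj k f * T)"
  by (rule rank_leI[where f = "\<lambda>i. app A (f i)" and c = "\<lambda>x i. cinner (f i) (app T x)"])
    (simp add: app_simps app_proj)

lemma rank_le_mult_left:
  assumes "rank_le n T"
  shows "rank_le n (A * T)"
proof -
  obtain m f where mf: "m \<le> n" "orthonormal m f" "proj m f * T = T"
    using rank_leE[OF assms] .
  have "rank_le m (A * proj m f * T)" by (rule rank_le_proj_mult)
  then show ?thesis using mf by (simp add: mult.assoc rank_le_mono)
qed

lemma rank_le_adj:
  fixes T :: "'h::complex_hilbert bop"
  assumes "rank_le n T"
  shows "rank_le n (adj T)"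
proof -
  obtain m f where mf: "m \<le> n" "orthonormal m f" "proj m f * T = T"
    using rank_leE[OF assms] .
  have "adj T = adj T * proj m f * 1"
    using mf(3) by (metis adj_mult adj_proj mult.right_neutral)
  then show ?thesis
    using rank_le_mono[OF rank_le_proj_mult mf(1)] by metis
qed

text \<open>Taking adjoints moves the projection from the range to the domain: \<open>T\<close>
  kills the complement of at most \<open>n\<close> vectors. The commutator estimate is applied on
  such a complement.\<close>

lemma rank_le_coE:
  fixes T :: "'h::complex_hilbert bop"
  assumes "rank_le n T"
  obtains m f where "m \<le> n" "orthonormal m f" "T * proj m f = T"
proof -
  obtain m f where mf: "m \<le> n" "orthonormal m f" "proj m f * adj T = adj T"
    using rank_leE[OF rank_le_adj[OF assms]] .
  then have "T * proj m f = T"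
    by (metis adj_adj adj_mult adj_proj)
  then show thesis using that mf by blast
qed

lemma rank_le_add:
  assumes "rank_le m S" "rank_le n T"
  shows "rank_le (m + n) (S + T)"
proof -
  obtain B where B: "finite B" "card B \<le> m" "\<And>x. \<exists>c. app S x = (\<Sum>b\<in>B. c b *\<^sub>C b)"
    using assms(1) unfolding rank_le_def by blast
  obtain C where C: "finite C" "card C \<le> n" "\<And>x. \<exists>c. app T x = (\<Sum>b\<in>C. c b *\<^sub>C b)"
    using assms(2) unfolding rank_le_def by blast
  have "\<exists>c. app (S + T) x = (\<Sum>b\<in>B \<union> C. c b *\<^sub>C b)" for x
  proof -
    obtain c d where cd: "app S x = (\<Sum>b\<in>B. c b *\<^sub>C b)" "app T x = (\<Sum>b\<in>C. d b *\<^sub>C b)"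
      using B(3) C(3) by blast
    have "app S x = (\<Sum>b\<in>B \<union> C. (if b \<in> B then c b else 0) *\<^sub>C b)"
      unfolding cd by (rule sum.mono_neutral_cong_left) (use B C in auto)
    moreover have "app T x = (\<Sum>b\<in>B \<union> C. (if b \<in> C then d b else 0) *\<^sub>C b)"
      unfolding cd by (rule sum.mono_neutral_cong_left) (use B C in auto)
    ultimately show ?thesis
      by (intro exI[of _ "\<lambda>b. (if b \<in> B then c b else 0) + (if b \<in> C then d b else 0)"])
        (simp add: app_simps scaleC_add_left sum.distrib)
  qed
  moreover have "card (B \<union> C) \<le> m + n"
    using B(2) C(2) card_Un_le[of B C] by linarith
  ultimately show ?thesis
    unfolding rank_le_def using B C by (intro exI[of _ "B \<union> C"]) auto
qed

lemma rank_le_diff: "rank_le m S \<Longrightarrow> rank_le n T \<Longrightarrow> rank_le (m + n) (S - T)"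
proof -
  assume "rank_le m S" "rank_le n T"
  moreover have "(- 1) * T = - T" by (rule bop_eqI) (simp add: app_simps)
  ultimately show ?thesis
    using rank_le_add[of m S n "- T"] rank_le_mult_left[of n T "- 1"] by simp
qed

lemma rank_le_zero: "rank_le n 0"
  by (rule rank_leI[where c = "\<lambda>_ _. 0" and f = "\<lambda>_. 0"]) (simp add: app_simps)

lemma singular_number_bdd: "bdd_below {norm (T - S) | S. rank_le n S}"
  by (rule bdd_belowI[of _ 0]) auto

lemma singular_number_le: "rank_le n S \<Longrightarrow> singular_number n T \<le> norm (T - S)"
  unfolding singular_number_def by (rule cInf_lower[OF _ singular_number_bdd]) auto

lemma singular_number_geI: "(\<And>S. rank_le n S \<Longrightarrow> a \<le> norm (T - S)) \<Longrightarrow> a \<le> singular_number n T"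
  unfolding singular_number_def using rank_le_zero by (intro cInf_greatest) auto

lemma singular_number_approx:
  assumes "e > 0"
  obtains S where "rank_le n S" "norm (T - S) < singular_number n T + e"
  using singular_number_geI[of n "singular_number n T + e" T] assms by (meson leI less_add_same_cancel1 not_le)

lemma singular_number_nonneg [simp]: "0 \<le> singular_number n T"
  by (rule singular_number_geI) simp

lemma singular_number_le_norm: "singular_number n T \<le> norm T"
  using singular_number_le[OF rank_le_zero] by (metis diff_zero)

lemma singular_number_0: "singular_number 0 T = norm T"
proof (rule antisym)
  show "norm T \<le> singular_number 0 T"
  proof (rule singular_number_geI)
    fix S :: "'a bop" assume "rank_le 0 S"
    then have "S = 0" unfolding rank_le_def by (intro bop_eqI) (auto simp: app_simps)
    then show "norm T \<le> norm (T - S)" by simp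
  qed
qed (rule singular_number_le_norm)

lemma singular_number_antimono: "m \<le> n \<Longrightarrow> singular_number n T \<le> singular_number m T"
  by (rule singular_number_geI) (meson rank_le_mono singular_number_le)

lemma singular_number_mult_left: "singular_number n (A * T) \<le> norm A * singular_number n T"
proof (cases "norm A = 0")
  case True
  then show ?thesis using singular_number_le_norm[of n "A * T"] by simp
next
  case False
  then have A: "0 < norm A" by simp
  have "singular_number n (A * T) / norm A \<le> singular_number n T"
  proof (rule singular_number_geI)
    fix S :: "'a bop" assume "rank_le n S"
    then have "singular_number n (A * T) \<le> norm (A * T - A * S)"
      by (intro singular_number_le rank_le_mult_left)
    also have "\<dots> \<le> norm A * norm (T - S)"
      by (metis norm_mult_ineq right_diff_distrib)
    finally show "singular_number n (A * T) / norm A \<le> norm (T - S)"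
      using A by (simp add: divide_le_eq mult.commute)
  qed
  then show ?thesis using A by (simp add: divide_le_eq mult.commute)
qed

lemma singular_number_adj_le:
  "singular_number n (adj T) \<le> singular_number n (T :: 'h::complex_hilbert bop)"
proof (rule singular_number_geI)
  fix S :: "'h bop" assume "rank_le n S"
  then have "singular_number n (adj T) \<le> norm (adj T - adj S)"
    by (intro singular_number_le rank_le_adj)
  then show "singular_number n (adj T) \<le> norm (T - S)"
    by (simp flip: adj_diff)
qed

lemma singular_number_adj [simp]:
  "singular_number n (adj T) = singular_number n (T :: 'h::complex_hilbert bop)"
  using singular_number_adj_le[of n T] singular_number_adj_le[of n "adj T"] by simp

lemma singular_number_mult_right:
  "singular_number n (T * A) \<le> norm A * singular_number n (T :: 'h::complex_hilbert bop)"
  by (metis adj_mult norm_adj singular_number_adj singular_number_mult_left)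

lemma singular_number_perturb: "singular_number n S \<le> singular_number n T + norm (S - T)"
proof -
  have "singular_number n S - norm (S - T) \<le> singular_number n T"
  proof (rule singular_number_geI)
    fix R :: "'a bop" assume "rank_le n R"
    then have "singular_number n S \<le> norm (S - R)" by (rule singular_number_le)
    also have "\<dots> \<le> norm (S - T) + norm (T - R)"
      using norm_triangle_ineq[of "S - T" "T - R"] by simp
    finally show "singular_number n S - norm (S - T) \<le> norm (T - R)" by simp
  qed
  then show ?thesis by simp
qed

lemma tendsto_singular_number:
  assumes "X \<longlonglongrightarrow> T"
  shows "(\<lambda>m. singular_number n (X m)) \<longlonglongrightarrow> singular_number n T"
proof (rule LIM_zero_cancel, rule tendsto_0_le)
  show "(\<lambda>m. X m - T) \<longlonglongrightarrow> 0" using assms by (simp add: LIM_zero)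
  have "norm (singular_number n (X m) - singular_number n T) \<le> norm (X m - T) * 1" for m
    using singular_number_perturb[of n "X m" T] singular_number_perturb[of n T "X m"]
    by (simp add: abs_le_iff norm_minus_commute algebra_simps)
  then show "\<forall>\<^sub>F m in sequentially. norm (singular_number n (X m) - singular_number n T) \<le> norm (X m - T) * 1"
    by simp
qed

section \<open>A norm equivalent to the Schatten norm\<close>

text \<open>Expanding the range in \<open>m\<close> orthonormal vectors leaves \<open>m\<close> sums
  over \<open>i\<close>; Cauchy-Schwarz, with Bessel once for \<open>x\<close> and once for
  \<open>y\<close>, bounds each by the operator norm. So the bound depends on the rank and not on
  the length \<open>k\<close> of the two systems.\<close>

lemma sum_cinner_rank_le:
  fixes T :: "'h::complex_hilbert bop"
  assumes "rank_le n T" "orthonormal k x" "orthonormal k y"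
  shows "(\<Sum>i<k. cmod (cinner (y i) (app T (x i)))) \<le> real n * norm T"
proof -
  obtain m f where mf: "m \<le> n" "orthonormal m f" "proj m f * T = T"
    using rank_leE[OF assms(1)] .
  have T: "app T v = (\<Sum>l<m. cinner (f l) (app T v) *\<^sub>C f l)" for v
    by (metis app_mult app_proj mf(3))
  have "cmod (cinner (y i) (app T (x i))) \<le> (\<Sum>l<m. cmod (cinner (app (adj T) (f l)) (x i)) * cmod (cinner (y i) (f l)))" for i
    by (subst T) (simp add: cinner.sum_right cinner_scaleC_right cinner_adj_left sum_norm_le norm_mult)
  then have "(\<Sum>i<k. cmod (cinner (y i) (app T (x i))))
      \<le> (\<Sum>i<k. \<Sum>l<m. cmod (cinner (app (adj T) (f l)) (x i)) * cmod (cinner (y i) (f l)))"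
    by (rule sum_mono)
  also have "\<dots> = (\<Sum>l<m. \<Sum>i<k. cmod (cinner (app (adj T) (f l)) (x i)) * cmod (cinner (y i) (f l)))"
    by (rule sum.swap)
  also have "\<dots> \<le> (\<Sum>l<m. norm T)"
  proof (rule sum_mono)
    fix l assume l: "l \<in> {..<m}"
    have fl: "norm (f l) = 1" using l mf(2) by (simp add: orthonormal_norm)
    have "(\<Sum>i<k. cmod (cinner (app (adj T) (f l)) (x i)) * cmod (cinner (y i) (f l)))\<^sup>2
       \<le> (\<Sum>i<k. (cmod (cinner (app (adj T) (f l)) (x i)))\<^sup>2) * (\<Sum>i<k. (cmod (cinner (y i) (f l)))\<^sup>2)"
      by (rule Cauchy_Schwarz_ineq_sum)
    also have "\<dots> \<le> (norm (app (adj T) (f l)))\<^sup>2 * (norm (f l))\<^sup>2"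
      by (subst cmod_cinner_commute) (intro mult_mono Bessel assms; simp add: sum_nonneg)
    also have "\<dots> \<le> (norm T)\<^sup>2 * 1"
      using norm_app_le[of "adj T" "f l"] fl by (intro mult_mono power_mono) auto
    finally show "(\<Sum>i<k. cmod (cinner (app (adj T) (f l)) (x i)) * cmod (cinner (y i) (f l))) \<le> norm T"
      by (auto intro: power2_le_imp_le)
  qed
  also have "\<dots> \<le> real n * norm T"
    using mf(1) by (simp add: mult_right_mono)
  finally show ?thesis .
qed

text \<open>Dyadic telescoping: approximants of rank \<open>2\<^sup>j\<close> and \<open>2\<^sup>j\<^sup>+\<^sup>1\<close> differ by an operator of rank
  at most \<open>3 \<cdot> 2\<^sup>j\<close> and of norm at most the sum of the two singular numbers.\<close>

lemma sum_cinner_le_singular_numbers: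
  fixes T :: "'h::complex_hilbert bop"
  assumes x: "orthonormal k x" and y: "orthonormal k y"
  shows "(\<Sum>i<k. cmod (cinner (y i) (app T (x i)))) \<le> 9 * (\<Sum>n<k. singular_number n T)"
proof (cases "k = 0")
  case False
  define t where "t = (\<lambda>A. \<Sum>i<k. cmod (cinner (y i) (app A (x i))))"
  have t_add: "t A \<le> t (A - B) + t B" for A B
  proof -
    have "cmod (cinner (y i) (app A (x i)))
        \<le> cmod (cinner (y i) (app (A - B) (x i))) + cmod (cinner (y i) (app B (x i)))" for i
      using norm_triangle_ineq[of "cinner (y i) (app (A - B) (x i))" "cinner (y i) (app B (x i))"]
      by (simp add: app_simps cinner.diff_right)
    then show ?thesis
      unfolding t_def sum.distrib[symmetric] by (rule sum_mono)
  qed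
  have t_norm: "t A \<le> real k * norm A" for A
  proof -
    have "t A \<le> (\<Sum>i<k. norm A)"
      unfolding t_def
    proof (rule sum_mono)
      fix i assume "i \<in> {..<k}"
      then have "norm (x i) = 1" "norm (y i) = 1" using x y by (simp_all add: orthonormal_norm)
      then show "cmod (cinner (y i) (app A (x i))) \<le> norm A"
        using cinner_Cauchy_Schwarz[of "y i" "app A (x i)"] norm_app_le[of A "x i"] by simp
    qed
    then show ?thesis by simp
  qed
  \<comment> \<open>The infimum defining a singular number need not be attained; \<open>d\<close> is
    the slack that makes the approximants \<open>R n\<close> exist, and it is removed at the
    end.\<close>
  have main: "t T \<le> 9 * (\<Sum>n<k. singular_number n T + d)" if "d > 0" for d
  proof -
    define s where "s = (\<lambda>n. singular_number n T + d)"
    have s: "s n \<le> s m" if "m \<le> n" for m n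
      using that by (simp add: s_def singular_number_antimono)
    have s0: "0 \<le> s n" for n using \<open>d > 0\<close> by (simp add: s_def add_nonneg_nonneg less_imp_le)
    have "\<exists>R. rank_le n R \<and> norm (T - R) \<le> s n" for n
      using singular_number_approx[OF \<open>d > 0\<close>, of n T] less_imp_le unfolding s_def by metis
    then obtain R where R: "\<And>n. rank_le n (R n)" "\<And>n. norm (T - R n) \<le> s n"
      by metis
    have norm_diff: "norm (R m - R n) \<le> s m + s n" for m n
    proof -
      have "norm (R m - R n) = norm ((T - R n) - (T - R m))" by simp
      also have "\<dots> \<le> norm (T - R n) + norm (T - R m)" by (rule norm_triangle_ineq4)
      finally show ?thesis using R(2)[of n] R(2)[of m] by simp
    qed
    \<comment> \<open>The subtracted term pays for the \<open>s (2^j)\<close> half of the next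
      difference. The other half costs 3 and renewing the subtracted term at the next power costs 6,
      whence the factor 9.\<close>
    have dyadic: "t (R (2^j)) \<le> 9 * (\<Sum>n<2^j. s n) - 3 * 2^j * s (2^j)" for j
    proof (induction j)
      case 0
      have "norm (R 1) \<le> norm T + s 1"
        using R(2)[of 1] norm_triangle_ineq2[of "R 1" T] by (simp add: norm_minus_commute)
      moreover have "norm T \<le> s 0" using \<open>d > 0\<close> by (simp add: s_def singular_number_0)
      moreover have "t (R 1) \<le> norm (R 1)"
        using sum_cinner_rank_le[OF R(1)[of 1] x y] by (simp add: t_def)
      ultimately show ?case using s[of 0 1] s0[of 0] by simp
    next
      case (Suc j)
      have "rank_le (2 ^ Suc j + 2 ^ j) (R (2 ^ Suc j) - R (2 ^ j))"
        by (intro rank_le_diff R)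
      from sum_cinner_rank_le[OF this x y]
      have "t (R (2 ^ Suc j) - R (2 ^ j)) \<le> 3 * 2 ^ j * norm (R (2 ^ Suc j) - R (2 ^ j))"
        by (simp add: t_def)
      also have "\<dots> \<le> 3 * 2 ^ j * (s (2 ^ Suc j) + s (2 ^ j))"
        by (intro mult_left_mono norm_diff) simp
      finally have 1: "t (R (2 ^ Suc j) - R (2 ^ j)) \<le> 3 * 2 ^ j * (s (2 ^ Suc j) + s (2 ^ j))" .
      have "(\<Sum>n<2 ^ Suc j. s n) = (\<Sum>n<2^j. s n) + (\<Sum>n\<in>{2^j..<2 ^ Suc j}. s n)"
        by (rule sum.atLeastLessThan_concat[of 0 "2^j" "2 ^ Suc j" s, unfolded atLeast0LessThan, symmetric]) auto
      moreover have "2^j * s (2 ^ Suc j) \<le> (\<Sum>n\<in>{2^j..<2 ^ Suc j}. s n)"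
      proof -
        have "(\<Sum>n\<in>{2^j..<(2::nat) ^ Suc j}. s (2 ^ Suc j)) \<le> (\<Sum>n\<in>{2^j..<2 ^ Suc j}. s n)"
          by (intro sum_mono s) auto
        then show ?thesis by simp
      qed
      ultimately have 2: "(\<Sum>n<2^j. s n) + 2^j * s (2 ^ Suc j) \<le> (\<Sum>n<2 ^ Suc j. s n)" by simp
      have "t (R (2 ^ Suc j)) \<le> t (R (2 ^ Suc j) - R (2 ^ j)) + t (R (2 ^ j))"
        by (rule t_add)
      also have "\<dots> \<le> 3 * (2 ^ j * s (2 ^ Suc j)) + 9 * (\<Sum>n<2^j. s n)"
        using 1 Suc by (simp add: algebra_simps)
      also have "\<dots> \<le> 9 * (\<Sum>n<2 ^ Suc j. s n) - 6 * (2 ^ j * s (2 ^ Suc j))"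
        using 2 by linarith
      finally show ?case by simp
    qed
    obtain j where j: "2^j \<le> k" "k < 2 ^ Suc j"
      using ex_power_ivl1[of 2 k] False by auto
    have "t T \<le> t (T - R (2^j)) + t (R (2^j))" by (rule t_add)
    also have "\<dots> \<le> real k * norm (T - R (2^j)) + (9 * (\<Sum>n<2^j. s n) - 3 * 2^j * s (2^j))"
      by (intro add_mono t_norm dyadic)
    \<comment> \<open>Since \<open>k\<close> is below \<open>2 * 2^j\<close>, the error beyond the
      last approximant is absorbed by the subtracted term as well.\<close>
    also have "real k * norm (T - R (2^j)) \<le> (2 * 2^j) * s (2^j)"
    proof (rule mult_mono[OF _ R(2)])
      have "real k \<le> real (2 ^ Suc j)" using j(2) by (intro of_nat_mono) simp
      then show "real k \<le> 2 * 2^j" by simp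
    qed auto
    also have "(2 * 2^j) * s (2^j) + (9 * (\<Sum>n<2^j. s n) - 3 * 2^j * s (2^j)) \<le> 9 * (\<Sum>n<2^j. s n)"
      using s0[of "2^j"] by simp
    also have "\<dots> \<le> 9 * (\<Sum>n<k. s n)"
      using j(1) s0 by (intro mult_left_mono sum_mono2) auto
    finally show ?thesis by (simp add: s_def)
  qed
  have "t T \<le> 9 * (\<Sum>n<k. singular_number n T)"
  proof (rule field_le_epsilon)
    fix e :: real assume "e > 0"
    then have "t T \<le> 9 * (\<Sum>n<k. singular_number n T + e / (9 * real k))"
      using main[of "e / (9 * real k)"] False by simp
    also have "\<dots> = 9 * (\<Sum>n<k. singular_number n T) + e"
      using False by (simp add: sum.distrib distrib_left)
    finally show "t T \<le> 9 * (\<Sum>n<k. singular_number n T) + e" .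
  qed
  then show ?thesis by (simp add: t_def)
qed simp

text \<open>Abel summation: a decreasing nonnegative weight is a positive combination of indicators
  of initial segments, so comparing partial sums is enough.\<close>

lemma sum_mult_antimono_le:
  fixes w t u :: "nat \<Rightarrow> real"
  assumes w: "antimono w" "\<And>i. 0 \<le> w i" and le: "\<And>j. j \<le> k \<Longrightarrow> (\<Sum>i<j. t i) \<le> (\<Sum>i<j. u i)"
  shows "(\<Sum>i<k. w i * t i) \<le> (\<Sum>i<k. w i * u i)"
proof -
  \<comment> \<open>The induction carries this stronger inequality, which keeps the last weight
    times the difference of the partial sums. For \<open>j = 0\<close> both sides are 0.\<close>
  have "w (j - 1) * (\<Sum>i<j. u i - t i) \<le> (\<Sum>i<j. w i * (u i - t i))" if "j \<le> k" for j
    using that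
  proof (induction j)
    case (Suc j)
    have "w j * (\<Sum>i<j. u i - t i) \<le> w (j - 1) * (\<Sum>i<j. u i - t i)"
      using le[of j] Suc.prems antimonoD[OF w(1), of "j - 1" j]
      by (intro mult_right_mono) (auto simp: sum_subtractf)
    with Suc show ?case by (simp add: distrib_left)
  qed simp
  from this[of k] have "0 \<le> (\<Sum>i<k. w i * (u i - t i))"
    using mult_nonneg_nonneg[OF w(2)[of "k - 1"], of "\<Sum>i<k. u i - t i"] le[of k]
    by (simp add: sum_subtractf)
  then show ?thesis by (simp add: right_diff_distrib sum_subtractf)
qed

text \<open>A greedy substitute for singular vectors that also covers noncompact \<open>T\<close>.
  Before the k-th choice, the vectors \<open>x i\<close> and \<open>adj T\<close> of
  \<open>T (x i)\<close> are projected out: the former keep the system orthonormal, the latter keep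
  the images orthogonal. These are at most \<open>2 * k\<close> vectors, hence the index
  \<open>2 * i\<close>; the half provides the strict inequality with which a near-maximiser is
  found.\<close>

lemma ex_singular_vectors:
  fixes T :: "'h::complex_hilbert bop"
  assumes "\<And>i. i < k \<Longrightarrow> 0 < singular_number (2 * i) T"
  shows "\<exists>x. orthonormal k x \<and> (\<forall>i<k. singular_number (2 * i) T / 2 \<le> norm (app T (x i)))
     \<and> (\<forall>i<k. \<forall>j<k. i \<noteq> j \<longrightarrow> cinner (app T (x i)) (app T (x j)) = 0)"
  using assms
proof (induction k)
  case 0
  show ?case by (simp add: orthonormal_def)
next
  case (Suc k)
  have "0 < singular_number (2 * i) T" if "i < k" for i
    using Suc.prems that by simp
  from Suc.IH[OF this]
  obtain x where x: "orthonormal k x" "\<forall>i<k. singular_number (2 * i) T / 2 \<le> norm (app T (x i))"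
     "\<forall>i<k. \<forall>j<k. i \<noteq> j \<longrightarrow> cinner (app T (x i)) (app T (x j)) = 0"
    by blast
  define W where "W = x ` {..<k} \<union> (\<lambda>i. app (adj T) (app T (x i))) ` {..<k}"
  have "card (x ` {..<k}) \<le> k" "card ((\<lambda>i. app (adj T) (app T (x i))) ` {..<k}) \<le> k"
    by (metis card_image_le card_lessThan finite_lessThan)+
  then have W: "finite W" "card W \<le> 2 * k"
    using card_Un_le[of "x ` {..<k}" "(\<lambda>i. app (adj T) (app T (x i))) ` {..<k}"]
    by (simp_all add: W_def)
  obtain m f where mf: "m \<le> card W" "orthonormal m f" "\<forall>b\<in>W. app (proj m f) b = b"
    using Gram_Schmidt[OF W(1)] by blast
  let ?Q = "1 - proj m f"
  have pos: "0 < singular_number (2 * k) T" using Suc.prems by simp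
  have "rank_le (2 * k) (T * proj m f * 1)"
    using rank_le_mono[OF rank_le_proj_mult] mf(1) W(2) by (meson le_trans)
  then have "singular_number (2 * k) T \<le> norm (T - T * proj m f * 1)"
    by (rule singular_number_le)
  also have "T - T * proj m f * 1 = T * ?Q" by (simp add: algebra_simps)
  finally have "singular_number (2 * k) T / 2 < norm (T * ?Q)" using pos by simp
  then obtain v where v: "singular_number (2 * k) T / 2 * norm v < norm (app (T * ?Q) v)"
    using norm_bop_less_ex[of "singular_number (2 * k) T / 2"] pos by (metis half_gt_zero less_imp_le)
  define z where "z = app ?Q v"
  have "norm z \<le> norm v"
    using norm_app_le[of ?Q v] mult_right_mono[OF norm_proj_compl_le[OF mf(2)], of "norm v"]
    by (simp add: z_def)
  then have "singular_number (2 * k) T / 2 * norm z \<le> singular_number (2 * k) T / 2 * norm v"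
    by (intro mult_left_mono) auto
  then have z: "singular_number (2 * k) T / 2 * norm z < norm (app T z)"
    using v by (simp add: z_def)
  then have "z \<noteq> 0" by (auto simp: app_simps)
  have ortW: "cinner b z = 0" if "b \<in> W" for b
    using cinner_proj_proj_compl[OF mf(2), of b v] mf(3) that by (simp add: z_def)
  define e where "e = inverse (norm z) *\<^sub>R z"
  have "norm e = 1" using \<open>z \<noteq> 0\<close> by (simp add: e_def)
  have orte: "cinner b e = 0" if "b \<in> W" for b
    using ortW[OF that] by (simp add: e_def cinner_scaleR_right)
  have on: "orthonormal (Suc k) (x(k := e))"
    using x(1) \<open>norm e = 1\<close> by (rule orthonormal_extend) (auto intro: orte simp: W_def)
  have ge: "singular_number (2 * k) T / 2 \<le> norm (app T e)"
    using z \<open>z \<noteq> 0\<close> by (simp add: e_def app_simps field_simps)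
  have o1: "cinner (app T (x i)) (app T e) = 0" if "i < k" for i
    using orte[of "app (adj T) (app T (x i))"] that by (simp add: W_def cinner_adj_left)
  have o2: "cinner (app T e) (app T (x i)) = 0" if "i < k" for i
    using o1[OF that] by (metis cinner_commute_zero)
  show ?case
  proof (intro exI conjI)
    show "orthonormal (Suc k) (x(k := e))" by (rule on)
  qed (use ge x o1 o2 in \<open>auto simp: less_Suc_eq\<close>)
qed

text \<open>The dual unit ball is described by its pairing instead of a conjugate exponent, so
  \<open>r = 1\<close> is not a special case. Monotonicity of \<open>w\<close> is what allows Abel
  summation.\<close>

definition dual_weight :: "real \<Rightarrow> nat \<Rightarrow> (nat \<Rightarrow> real) \<Rightarrow> bool" where
  "dual_weight r k w \<longleftrightarrow> antimono w \<and> (\<forall>i. 0 \<le> w i) \<and>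
     (\<forall>u. (\<forall>i. 0 \<le> u i) \<longrightarrow> (\<Sum>i<k. u i powr r) \<le> 1 \<longrightarrow> (\<Sum>i<k. w i * u i) \<le> 1)"

text \<open>The least \<open>c\<close> with this property is a norm equivalent to \<^const>\<open>schatten_norm\<close>. Unlike the
  latter, it satisfies the triangle inequality for obvious reasons.\<close>

definition schatten_bound :: "real \<Rightarrow> real \<Rightarrow> 'h::complex_hilbert bop \<Rightarrow> bool" where
  "schatten_bound r c T \<longleftrightarrow> (\<forall>k w x y. dual_weight r k w \<longrightarrow> orthonormal k x \<longrightarrow> orthonormal k y \<longrightarrow>
     (\<Sum>i<k. w i * cmod (cinner (y i) (app T (x i)))) \<le> c)"

lemma schatten_bound_add:
  assumes "schatten_bound r c S" "schatten_bound r d T"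
  shows "schatten_bound r (c + d) (S + T)"
  unfolding schatten_bound_def
proof (intro allI impI)
  fix k w and x y :: "nat \<Rightarrow> 'a"
  assume w: "dual_weight r k w" "orthonormal k x" "orthonormal k y"
  have "(\<Sum>i<k. w i * cmod (cinner (y i) (app (S + T) (x i))))
      \<le> (\<Sum>i<k. w i * cmod (cinner (y i) (app S (x i))) + w i * cmod (cinner (y i) (app T (x i))))"
    using w(1) unfolding distrib_left[symmetric] app.add_left cinner_add_right
    by (intro sum_mono mult_left_mono norm_triangle_ineq) (simp add: dual_weight_def)
  also have "\<dots> \<le> c + d"
    unfolding sum.distrib using assms w unfolding schatten_bound_def by (intro add_mono) auto
  finally show "(\<Sum>i<k. w i * cmod (cinner (y i) (app (S + T) (x i)))) \<le> c + d" .
qed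

lemma schatten_bound_scaleR:
  assumes "schatten_bound r c T" "0 \<le> t"
  shows "schatten_bound r (t * c) (t *\<^sub>R T)"
  unfolding schatten_bound_def
proof (intro allI impI)
  fix k w and x y :: "nat \<Rightarrow> 'a"
  assume w: "dual_weight r k w" "orthonormal k x" "orthonormal k y"
  have "(\<Sum>i<k. w i * cmod (cinner (y i) (app (t *\<^sub>R T) (x i)))) = t * (\<Sum>i<k. w i * cmod (cinner (y i) (app T (x i))))"
    using assms(2) by (simp add: sum_distrib_left app_simps cinner_scaleR_right mult_ac)
  also have "\<dots> \<le> t * c"
    using assms w unfolding schatten_bound_def by (intro mult_left_mono) auto
  finally show "(\<Sum>i<k. w i * cmod (cinner (y i) (app (t *\<^sub>R T) (x i)))) \<le> t * c" .
qed

section \<open>Comparison of the dual norm with the Schatten norm\<close>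

lemma schatten_norm_nonneg [simp]: "0 \<le> schatten_norm r T"
  by (simp add: schatten_norm_def)

lemma schatten_norm_powr:
  assumes "T \<in> schatten r" "r > 0"
  shows "schatten_norm r T powr r = (\<Sum>n. singular_number n T powr r)"
proof -
  have "0 \<le> (\<Sum>n. singular_number n T powr r)"
    using assms by (intro suminf_nonneg) (auto simp: schatten_def)
  then show ?thesis
    using assms by (simp add: schatten_norm_def powr_powr)
qed

lemma sum_singular_number_le:
  assumes "T \<in> schatten r" "r > 0"
  shows "(\<Sum>n<k. singular_number n T powr r) \<le> schatten_norm r T powr r"
  unfolding schatten_norm_powr[OF assms]
  using assms by (intro sum_le_suminf) (auto simp: schatten_def)

lemma schattenI:
  assumes "r > 0" "0 \<le> c" "\<And>k. (\<Sum>n<k. singular_number n T powr r) \<le> c powr r"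
  shows "T \<in> schatten r" "schatten_norm r T \<le> c"
proof -
  have sm: "summable (\<lambda>n. singular_number n T powr r)"
    by (rule summableI_nonneg_bounded[where x = "c powr r"]) (use assms in auto)
  then show "T \<in> schatten r" by (simp add: schatten_def)
  have "(\<Sum>n. singular_number n T powr r) \<le> c powr r"
    by (rule suminf_le_const[OF sm assms(3)])
  then have "schatten_norm r T \<le> (c powr r) powr (1 / r)"
    unfolding schatten_norm_def using assms sm by (intro powr_mono2 suminf_nonneg) auto
  then show "schatten_norm r T \<le> c"
    using assms by (simp add: powr_powr)
qed

lemma singular_number_le_schatten_norm:
  assumes "T \<in> schatten r" "r > 0"
  shows "singular_number n T \<le> schatten_norm r T"
proof -
  have "singular_number n T powr r \<le> (\<Sum>n<Suc n. singular_number n T powr r)"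
    by (rule member_le_sum[of n "{..<Suc n}" "\<lambda>n. singular_number n T powr r"]) auto
  also have "\<dots> \<le> schatten_norm r T powr r"
    by (rule sum_singular_number_le[OF assms])
  finally show ?thesis
    using assms(2) by (meson leI powr_less_mono2 schatten_norm_nonneg not_le)
qed

lemma norm_le_schatten_norm: "T \<in> schatten r \<Longrightarrow> r > 0 \<Longrightarrow> norm T \<le> schatten_norm r T"
  using singular_number_le_schatten_norm[of T r 0] by (simp add: singular_number_0)

text \<open>The dyadic estimate holds on every initial segment of \<open>x\<close> and
  \<open>y\<close>, so Abel summation inserts the decreasing weights. The singular numbers divided
  by their norm are then an admissible test sequence for \<open>dual_weight\<close>.\<close>

lemma schatten_bound_schatten_norm:
  fixes T :: "'h::complex_hilbert bop"
  assumes T: "T \<in> schatten r" and r: "r > 0"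
  shows "schatten_bound r (9 * schatten_norm r T) T"
  unfolding schatten_bound_def
proof (intro allI impI)
  fix k w and x y :: "nat \<Rightarrow> 'h"
  assume w: "dual_weight r k w" and x: "orthonormal k x" and y: "orthonormal k y"
  let ?N = "schatten_norm r T"
  have "(\<Sum>i<k. w i * cmod (cinner (y i) (app T (x i)))) \<le> (\<Sum>i<k. w i * (9 * singular_number i T))"
  proof (rule sum_mult_antimono_le)
    fix j assume "j \<le> k"
    then have "orthonormal j x" "orthonormal j y" using x y by (auto simp: orthonormal_def)
    then show "(\<Sum>i<j. cmod (cinner (y i) (app T (x i)))) \<le> (\<Sum>i<j. 9 * singular_number i T)"
      unfolding sum_distrib_left[symmetric] by (rule sum_cinner_le_singular_numbers)
  qed (use w in \<open>auto simp: dual_weight_def\<close>)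
  also have "\<dots> = 9 * (\<Sum>i<k. w i * singular_number i T)"
    by (simp add: sum_distrib_left mult_ac)
  also have "(\<Sum>i<k. w i * singular_number i T) \<le> ?N"
  proof (cases "?N = 0")
    case True
    then have "singular_number i T = 0" for i
      using singular_number_le_schatten_norm[OF T r, of i] by (simp add: order_antisym)
    then show ?thesis by simp
  next
    case False
    then have N: "?N > 0" by (simp add: less_le)
    have "(\<Sum>i<k. (singular_number i T / ?N) powr r) = (\<Sum>i<k. singular_number i T powr r) / ?N powr r"
      using N by (simp add: powr_divide sum_divide_distrib)
    also have "\<dots> \<le> 1"
      using sum_singular_number_le[OF T r, of k] N by simp
    finally have "(\<Sum>i<k. (singular_number i T / ?N) powr r) \<le> 1" .
    moreover have "\<forall>i. 0 \<le> singular_number i T / ?N" using N by simp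
    ultimately have "(\<Sum>i<k. w i * (singular_number i T / ?N)) \<le> 1"
      using w unfolding dual_weight_def by (elim conjE allE[where x = "\<lambda>i. singular_number i T / ?N"]) blast
    moreover have "(\<Sum>i<k. w i * (singular_number i T / ?N)) = (\<Sum>i<k. w i * singular_number i T) / ?N"
      by (simp add: sum_divide_distrib)
    ultimately show ?thesis using N by simp
  qed
  finally show "(\<Sum>i<k. w i * cmod (cinner (y i) (app T (x i)))) \<le> 9 * ?N" by simp
qed

text \<open>\<open>b powr (r - 1)\<close> is the weight for which Hoelder's inequality against
  \<open>b\<close> becomes an equality; Young's inequality is applied termwise. For
  \<open>r = 1\<close> the weight is the indicator of the nonzero entries, because
  \<open>0 powr 0 = 0\<close>.\<close>

lemma dual_weight_powr:
  fixes b :: "nat \<Rightarrow> real"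
  assumes r: "r \<ge> 1" and b: "antimono b" "\<And>i. 0 \<le> b i" and sum: "(\<Sum>i<k. b i powr r) \<le> 1"
  shows "dual_weight r k (\<lambda>i. b i powr (r - 1))"
proof -
  have Young: "b i powr (r - 1) * u \<le> (r - 1) / r * b i powr r + 1 / r * u powr r" if "0 \<le> u" for u i
  proof (cases "b i = 0 \<or> u = 0")
    case False
    with b(2)[of i] that have pos: "b i > 0" "u > 0" by auto
    have "(b i powr r) powr ((r - 1) / r) * (u powr r) powr (1 / r)
        \<le> (r - 1) / r * b i powr r + 1 / r * u powr r"
      using r pos by (intro Youngs_inequality_0) (auto simp: diff_divide_distrib)
    then show ?thesis using r pos by (simp add: powr_powr)
  qed (use r in auto)
  have "(\<Sum>i<k. b i powr (r - 1) * u i) \<le> 1"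
    if u: "\<forall>i. 0 \<le> u i" "(\<Sum>i<k. u i powr r) \<le> 1" for u
  proof -
    have "(\<Sum>i<k. b i powr (r - 1) * u i) \<le> (\<Sum>i<k. (r - 1) / r * b i powr r + 1 / r * u i powr r)"
      using u by (intro sum_mono Young) auto
    also have "\<dots> = (r - 1) / r * (\<Sum>i<k. b i powr r) + 1 / r * (\<Sum>i<k. u i powr r)"
      by (simp only: sum.distrib sum_distrib_left)
    also have "\<dots> \<le> (r - 1) / r * 1 + 1 / r * 1"
      using r u sum by (intro add_mono mult_left_mono) auto
    also have "\<dots> = 1" using r by (simp add: field_simps)
    finally show ?thesis .
  qed
  moreover have "antimono (\<lambda>i. b i powr (r - 1))"
    using r b by (auto simp: antimono_def intro!: powr_mono2)
  ultimately show ?thesis by (simp add: dual_weight_def)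
qed

text \<open>The bound is tested on the greedy vectors, with their normalised images as
  \<open>y\<close> and the extremal weight. One factor 2 undoes the halves in
  \<open>ex_singular_vectors\<close>, the other passes from even indices to all indices.\<close>

lemma schatten_bound_imp_schatten:
  fixes T :: "'h::complex_hilbert bop"
  assumes r: "r \<ge> 1" and c: "schatten_bound r c T" "0 \<le> c"
  shows "T \<in> schatten r" "schatten_norm r T \<le> 4 * c"
proof -
  let ?s = "\<lambda>n. singular_number n T"
  have pos: "(\<Sum>i<k. (?s (2 * i) / 2) powr r) \<le> c powr r" if k: "k > 0" "\<And>i. i < k \<Longrightarrow> 0 < ?s (2 * i)" for k
  proof -
    obtain x where x: "orthonormal k x" "\<And>i. i < k \<Longrightarrow> ?s (2 * i) / 2 \<le> norm (app T (x i))"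
      "\<And>i j. i < k \<Longrightarrow> j < k \<Longrightarrow> i \<noteq> j \<Longrightarrow> cinner (app T (x i)) (app T (x j)) = 0"
      using ex_singular_vectors[of k T] k by blast
    have Tpos: "0 < norm (app T (x i))" if "i < k" for i
      using x(2)[OF that] k(2)[OF that] by linarith
    define y where "y = (\<lambda>i. inverse (norm (app T (x i))) *\<^sub>R app T (x i))"
    have ny: "norm (y i) = 1" if "i < k" for i
      using Tpos[OF that] by (simp add: y_def)
    have y: "orthonormal k y"
      unfolding orthonormal_def
    proof (intro allI impI)
      fix i j assume "i < k" "j < k"
      then show "cinner (y i) (y j) = (if i = j then 1 else 0)"
        using ny[of i] x(3)[of i j]
        by (cases "i = j") (auto simp: cinner_self, simp add: y_def cinner_scaleR_left cinner_scaleR_right)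
    qed
    have yT: "cmod (cinner (y i) (app T (x i))) = norm (app T (x i))" if "i < k" for i
      using Tpos[OF that]
      by (simp add: y_def cinner_scaleR_left cinner_self power2_eq_square norm_mult)
    define A where "A = (\<Sum>i<k. (?s (2 * i) / 2) powr r)"
    have A: "A > 0"
      unfolding A_def using k(1) by (intro sum_pos) (auto dest: k(2) intro: less_imp_neq[THEN not_sym])
    \<comment> \<open>Normalised so that the r-th powers sum to 1, as
      \<open>dual_weight_powr\<close> requires.\<close>
    define b where "b = (\<lambda>i. (?s (2 * i) / 2) / A powr (1 / r))"
    have b0: "0 \<le> b i" for i using A by (simp add: b_def)
    have br: "b i powr r = (?s (2 * i) / 2) powr r / A" for i
    proof -
      have "b i powr r = (?s (2 * i) / 2) powr r / (A powr (1 / r)) powr r"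
        unfolding b_def by (rule powr_divide)
      then show ?thesis using A r by (simp add: powr_powr)
    qed
    have sum_b: "(\<Sum>i<k. b i powr r) = 1"
      unfolding br sum_divide_distrib[symmetric] using A by (simp add: A_def)
    have "antimono b"
      unfolding antimono_def b_def
      by (intro allI impI divide_right_mono singular_number_antimono) auto
    then have w: "dual_weight r k (\<lambda>i. b i powr (r - 1))"
      using r b0 sum_b by (intro dual_weight_powr) auto
    have "A powr (1 / r) = (\<Sum>i<k. A powr (1 / r) * b i powr r)"
      unfolding sum_distrib_left[symmetric] sum_b by simp
    also have "\<dots> = (\<Sum>i<k. b i powr (r - 1) * (?s (2 * i) / 2))"
    proof (intro sum.cong refl)
      fix i assume "i \<in> {..<k}"
      then have "b i > 0" using k A by (simp add: b_def)
      then have "b i powr r = b i powr (r - 1) * b i"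
        by (metis add.commute add_diff_cancel_left' diff_add_cancel less_eq_real_def powr_add powr_one)
      then show "A powr (1 / r) * b i powr r = b i powr (r - 1) * (?s (2 * i) / 2)"
        using A by (simp add: b_def)
    qed
    also have "\<dots> \<le> (\<Sum>i<k. b i powr (r - 1) * cmod (cinner (y i) (app T (x i))))"
      by (intro sum_mono mult_left_mono) (auto simp: yT dest: x(2))
    also have "\<dots> \<le> c"
      using c w x y unfolding schatten_bound_def by blast
    finally have "(A powr (1 / r)) powr r \<le> c powr r"
      using r by (intro powr_mono2) auto
    then show ?thesis using r A by (simp add: A_def powr_powr)
  qed
  \<comment> \<open>Greedy vectors exist only while the singular numbers are positive; a vanishing
    one adds nothing to the sum.\<close>
  have even_sum: "(\<Sum>i<k. (?s (2 * i) / 2) powr r) \<le> c powr r" for k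
  proof (induction k)
    case (Suc k)
    show ?case
    proof (cases "0 < ?s (2 * k)")
      case True
      have "0 < ?s (2 * i)" if "i < Suc k" for i
        using less_le_trans[OF True singular_number_antimono] that by simp
      then show ?thesis by (intro pos) auto
    next
      case False
      then have "?s (2 * k) = 0" by (simp add: order_antisym)
      then show ?thesis using Suc by simp
    qed
  qed simp
  have two: "(\<Sum>n<2 * k. ?s n powr r) \<le> 2 * (\<Sum>i<k. ?s (2 * i) powr r)" for k
  proof (induction k)
    case (Suc k)
    have "?s (Suc (2 * k)) powr r \<le> ?s (2 * k) powr r"
      using r by (intro powr_mono2 singular_number_antimono) auto
    then show ?case using Suc by simp
  qed simp
  have "(\<Sum>n<k. ?s n powr r) \<le> (4 * c) powr r" for k
  proof -
    have "(\<Sum>n<k. ?s n powr r) \<le> (\<Sum>n<2 * k. ?s n powr r)"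
      by (rule sum_mono2) auto
    also have "\<dots> \<le> 2 * (\<Sum>i<k. ?s (2 * i) powr r)" by (rule two)
    also have "(\<Sum>i<k. ?s (2 * i) powr r) = 2 powr r * (\<Sum>i<k. (?s (2 * i) / 2) powr r)"
      by (simp add: powr_divide sum_distrib_left)
    also have "2 * (2 powr r * (\<Sum>i<k. (?s (2 * i) / 2) powr r)) \<le> 2 powr r * (2 powr r * c powr r)"
    proof (intro mult_mono even_sum)
      show "(2::real) \<le> 2 powr r" using powr_mono[of 1 r 2] r by simp
    qed (auto intro!: mult_nonneg_nonneg sum_nonneg)
    also have "\<dots> = (4 * c) powr r"
      using c by (simp add: powr_mult[symmetric])
    finally show ?thesis .
  qed
  then show "T \<in> schatten r" "schatten_norm r T \<le> 4 * c"
    using schattenI[of r "4 * c" T] r c by auto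
qed

section \<open>Quasi-norm and ideal properties of the Schatten classes\<close>

lemma singular_number_zero [simp]: "singular_number n (0 :: 'h::complex_inner bop) = 0"
  using singular_number_le_norm[of n "0 :: 'h bop"] by (simp add: order_antisym)

lemma schatten_zero [simp]: "0 \<in> schatten r" "schatten_norm r 0 = 0"
  by (simp_all add: schatten_def schatten_norm_def)

text \<open>The constant is 9 times 4, from passing to the dual norm and back. A quasi-triangle
  inequality is enough for arguments about convergence.\<close>

lemma schatten_add:
  fixes S T :: "'h::complex_hilbert bop"
  assumes r: "r \<ge> 1" and S: "S \<in> schatten r" and T: "T \<in> schatten r"
  shows "S + T \<in> schatten r"
    and "schatten_norm r (S + T) \<le> 36 * (schatten_norm r S + schatten_norm r T)"
proof -
  have "schatten_bound r (9 * schatten_norm r S + 9 * schatten_norm r T) (S + T)"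
    using r by (intro schatten_bound_add schatten_bound_schatten_norm S T) auto
  from schatten_bound_imp_schatten[OF r this]
  show "S + T \<in> schatten r" "schatten_norm r (S + T) \<le> 36 * (schatten_norm r S + schatten_norm r T)"
    by (simp_all add: algebra_simps)
qed

lemma schattenI_le:
  assumes T: "T \<in> schatten r" and r: "r > 0" and c: "0 \<le> c" "\<And>n. singular_number n S \<le> c * singular_number n T"
  shows "S \<in> schatten r" "schatten_norm r S \<le> c * schatten_norm r T"
proof -
  have "(\<Sum>n<k. singular_number n S powr r) \<le> (c * schatten_norm r T) powr r" for k
  proof -
    have "(\<Sum>n<k. singular_number n S powr r) \<le> (\<Sum>n<k. (c * singular_number n T) powr r)"
      using r by (intro sum_mono powr_mono2 c) auto
    also have "\<dots> = c powr r * (\<Sum>n<k. singular_number n T powr r)"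
      using c by (simp add: powr_mult sum_distrib_left)
    also have "\<dots> \<le> c powr r * schatten_norm r T powr r"
      by (intro mult_left_mono sum_singular_number_le T r) auto
    finally show ?thesis using c by (simp add: powr_mult)
  qed
  then show "S \<in> schatten r" "schatten_norm r S \<le> c * schatten_norm r T"
    using schattenI[of r "c * schatten_norm r T" S] r c by auto
qed

lemma schatten_mult_left:
  assumes "T \<in> schatten r" "r > 0"
  shows "A * T \<in> schatten r" "schatten_norm r (A * T) \<le> norm A * schatten_norm r T"
  using schattenI_le[OF assms norm_ge_zero singular_number_mult_left] .

lemma schatten_mult_right:
  fixes T :: "'h::complex_hilbert bop"
  assumes "T \<in> schatten r" "r > 0"
  shows "T * A \<in> schatten r" "schatten_norm r (T * A) \<le> norm A * schatten_norm r T"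
  using schattenI_le[OF assms norm_ge_zero singular_number_mult_right] .

lemma schatten_minus:
  assumes "T \<in> schatten r" "r > 0"
  shows "- T \<in> schatten r" "schatten_norm r (- T) \<le> schatten_norm r T"
proof -
  have "singular_number n (- T) \<le> 1 * singular_number n T" for n
  proof -
    have "- T = (- 1) * T" by (rule bop_eqI) (simp add: app_simps)
    then have "singular_number n (- T) \<le> norm (- 1 :: 'a bop) * singular_number n T"
      using singular_number_mult_left by metis
    also have "\<dots> \<le> 1 * singular_number n T"
      by (intro mult_right_mono) (auto simp: norm_one_bop_le)
    finally show ?thesis .
  qed
  from schattenI_le[OF assms _ this] show "- T \<in> schatten r" "schatten_norm r (- T) \<le> schatten_norm r T"
    by auto
qed

lemma schatten_diff:
  fixes S T :: "'h::complex_hilbert bop"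
  assumes r: "r \<ge> 1" and S: "S \<in> schatten r" and T: "T \<in> schatten r"
  shows "S - T \<in> schatten r"
  using schatten_add(1)[OF r S schatten_minus(1)[OF T]] r by simp

lemma schatten_norm_triangle:
  fixes R S T :: "'h::complex_hilbert bop"
  assumes r: "r \<ge> 1" and "R \<in> schatten r" "S \<in> schatten r" "T \<in> schatten r"
  shows "schatten_norm r (R - T) \<le> 36 * (schatten_norm r (R - S) + schatten_norm r (S - T))"
  using schatten_add(2)[OF r schatten_diff[OF r assms(2,3)] schatten_diff[OF r assms(3,4)]] by simp

lemma schatten_scaleR:
  assumes "T \<in> schatten r" "r > 0"
  shows "t *\<^sub>R T \<in> schatten r"
proof -
  have "t *\<^sub>R T = (t *\<^sub>R 1) * T" by (rule bop_eqI) (simp add: app_simps)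
  then show ?thesis using schatten_mult_left(1)[OF assms] by metis
qed

section \<open>The Schatten topology\<close>

text \<open>Open balls of the dual norm. The norm itself, an infimum, is never formed: a point
  belongs to the ball if some bound below \<open>e\<close> is admissible.\<close>

definition dual_ball :: "real \<Rightarrow> 'h::complex_hilbert bop \<Rightarrow> real \<Rightarrow> 'h bop set" where
  "dual_ball r T e = {S \<in> schatten r. \<exists>c. 0 \<le> c \<and> c < e \<and> schatten_bound r c (S - T)}"

lemma schatten_bound_zero: "schatten_bound r 0 0"
  by (simp add: schatten_bound_def app_simps)

lemma center_in_dual_ball: "T \<in> schatten r \<Longrightarrow> e > 0 \<Longrightarrow> T \<in> dual_ball r T e"
  using schatten_bound_zero[of r] by (auto simp: dual_ball_def)

lemma schatten_norm_dual_ball: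
  assumes r: "r \<ge> 1" and S: "S \<in> dual_ball r T e"
  shows "schatten_norm r (S - T) < 4 * e"
proof -
  obtain c where c: "0 \<le> c" "c < e" "schatten_bound r c (S - T)"
    using S by (auto simp: dual_ball_def)
  show ?thesis
    using schatten_bound_imp_schatten(2)[OF r c(3,1)] c(2) by simp
qed

text \<open>Exact additivity of \<open>schatten_bound\<close> makes these balls open; the
  quasi-triangle inequality would not give this for balls of \<open>schatten_norm\<close>. The
  radius is divided by 9 because the topology is measured by \<open>schatten_norm\<close> and the
  ball by the dual norm.\<close>

lemma openin_dual_ball:
  assumes r: "r \<ge> 1"
  shows "openin (schatten_topology r) (dual_ball r T e)"
  unfolding openin_schatten_topology
proof (intro conjI ballI)
  fix S assume S: "S \<in> dual_ball r T e"
  then obtain c where c: "S \<in> schatten r" "0 \<le> c" "c < e" "schatten_bound r c (S - T)"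
    by (auto simp: dual_ball_def)
  show "\<exists>d>0. \<forall>S'\<in>schatten r. schatten_norm r (S' - S) < d \<longrightarrow> S' \<in> dual_ball r T e"
  proof (intro exI conjI ballI impI)
    show "(e - c) / 9 > 0" using c by simp
    fix S' assume S': "S' \<in> schatten r" "schatten_norm r (S' - S) < (e - c) / 9"
    have "schatten_bound r (9 * schatten_norm r (S' - S)) (S' - S)"
      using r by (intro schatten_bound_schatten_norm schatten_diff S' c) auto
    from schatten_bound_add[OF this c(4)]
    have "schatten_bound r (9 * schatten_norm r (S' - S) + c) (S' - T)" by simp
    moreover have "9 * schatten_norm r (S' - S) + c < e" using S'(2) by simp
    moreover have "0 \<le> 9 * schatten_norm r (S' - S) + c" using c by simp
    ultimately show "S' \<in> dual_ball r T e"
      unfolding dual_ball_def using S'(1) by blast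
  qed
qed (auto simp: dual_ball_def)

lemma convex_dual_ball_zero:
  assumes r: "r \<ge> 1"
  shows "convex (dual_ball r (0 :: 'h::complex_hilbert bop) e)"
proof (rule convexI)
  fix S T :: "'h bop" and u v :: real
  assume S: "S \<in> dual_ball r 0 e" and T: "T \<in> dual_ball r 0 e" and uv: "0 \<le> u" "0 \<le> v" "u + v = 1"
  obtain c where c: "S \<in> schatten r" "0 \<le> c" "c < e" "schatten_bound r c S"
    using S by (auto simp: dual_ball_def)
  obtain d where d: "T \<in> schatten r" "0 \<le> d" "d < e" "schatten_bound r d T"
    using T by (auto simp: dual_ball_def)
  have "schatten_bound r (u * c + v * d) (u *\<^sub>R S + v *\<^sub>R T)"
    by (intro schatten_bound_add schatten_bound_scaleR c d uv)
  moreover have "u * c + v * d < e"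
    by (rule convex_bound_lt[OF c(3) d(3) uv])
  moreover have "0 \<le> u * c + v * d" using uv c d by simp
  moreover have "u *\<^sub>R S + v *\<^sub>R T \<in> schatten r"
    using r by (intro schatten_add schatten_scaleR c d) auto
  ultimately show "u *\<^sub>R S + v *\<^sub>R T \<in> dual_ball r 0 e"
    unfolding dual_ball_def by auto
qed

text \<open>Reduces limits in the Schatten topology to limits of real numbers. The forward direction
  tests with dual balls, since those are known to be open.\<close>

lemma limitin_schatten:
  fixes f :: "'z \<Rightarrow> 'h::complex_hilbert bop"
  assumes r: "r \<ge> 1"
  shows "limitin (schatten_topology r) f l F \<longleftrightarrow>
    l \<in> schatten r \<and> (\<forall>\<^sub>F z in F. f z \<in> schatten r) \<and> ((\<lambda>z. schatten_norm r (f z - l)) \<longlongrightarrow> 0) F"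
proof (intro iffI conjI)
  assume L: "limitin (schatten_topology r) f l F"
  show l: "l \<in> schatten r" using limitin_topspace[OF L] by simp
  have ev: "\<forall>\<^sub>F z in F. f z \<in> U" if "openin (schatten_topology r) U" "l \<in> U" for U
    using L that by (simp add: limitin_def)
  show "\<forall>\<^sub>F z in F. f z \<in> schatten r"
    using ev[OF openin_topspace] l by simp
  show "((\<lambda>z. schatten_norm r (f z - l)) \<longlongrightarrow> 0) F"
  proof (rule tendstoI)
    fix e :: real assume "e > 0"
    then have "\<forall>\<^sub>F z in F. f z \<in> dual_ball r l (e / 4)"
      by (intro ev openin_dual_ball center_in_dual_ball l r) simp
    then show "\<forall>\<^sub>F z in F. dist (schatten_norm r (f z - l)) 0 < e"
      by eventually_elim (use schatten_norm_dual_ball[OF r] in fastforce)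
  qed
next
  assume *: "l \<in> schatten r \<and> (\<forall>\<^sub>F z in F. f z \<in> schatten r) \<and> ((\<lambda>z. schatten_norm r (f z - l)) \<longlongrightarrow> 0) F"
  have "\<forall>\<^sub>F z in F. f z \<in> U" if U: "openin (schatten_topology r) U" "l \<in> U" for U
  proof -
    obtain e where e: "e > 0" "\<And>S. S \<in> schatten r \<Longrightarrow> schatten_norm r (S - l) < e \<Longrightarrow> S \<in> U"
      using U unfolding openin_schatten_topology by blast
    have "\<forall>\<^sub>F z in F. dist (schatten_norm r (f z - l)) 0 < e" using * e(1) tendstoD by blast
    moreover have "\<forall>\<^sub>F z in F. f z \<in> schatten r" using * by blast
    ultimately show ?thesis by eventually_elim (simp add: e(2))
  qed
  then show "limitin (schatten_topology r) f l F" using * by (simp add: limitin_def)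
qed

text \<open>Tailored to sums and bilinear maps: \<open>u\<close> and \<open>v\<close> are the
  contributions of varying one argument at a time.\<close>

lemma limitin_schattenI:
  fixes f :: "'z \<Rightarrow> 'h::complex_hilbert bop"
  assumes r: "r \<ge> 1" and l: "l \<in> schatten r"
    and eq: "\<And>z. f z - l = u z + v z"
    and u: "\<forall>\<^sub>F z in F. u z \<in> schatten r \<and> schatten_norm r (u z) \<le> a z" "(a \<longlongrightarrow> 0) F"
    and v: "\<forall>\<^sub>F z in F. v z \<in> schatten r \<and> schatten_norm r (v z) \<le> b z" "(b \<longlongrightarrow> 0) F"
  shows "limitin (schatten_topology r) f l F"
  unfolding limitin_schatten[OF r]
proof (intro conjI l)
  have f: "f z = l + (u z + v z)" for z using eq[of z] by (simp add: algebra_simps)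
  show "\<forall>\<^sub>F z in F. f z \<in> schatten r"
    using u(1) v(1) by eventually_elim (simp add: f schatten_add(1) l r)
  show "((\<lambda>z. schatten_norm r (f z - l)) \<longlongrightarrow> 0) F"
  proof (rule Lim_null_comparison)
    show "\<forall>\<^sub>F z in F. norm (schatten_norm r (f z - l)) \<le> 36 * (a z + b z)"
      using u(1) v(1)
    proof eventually_elim
      case (elim z)
      then show ?case using schatten_add(2)[OF r, of "u z" "v z"] by (simp add: eq)
    qed
    show "((\<lambda>z. 36 * (a z + b z)) \<longlongrightarrow> 0) F"
      using tendsto_mult_right_zero[OF tendsto_add_zero[OF u(2) v(2)]] .
  qed
qed

lemma continuous_map_schatten_mem:
  "continuous_map Z (schatten_topology r) f \<Longrightarrow> z \<in> topspace Z \<Longrightarrow> f z \<in> schatten r"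
  using continuous_map_image_subset_topspace[of Z "schatten_topology r" f] by auto

lemma eventually_atin_topspace: "\<forall>\<^sub>F z' in atin Z z. z' \<in> topspace Z"
  unfolding eventually_atin by auto

lemma continuous_map_euclidean_tendsto:
  "continuous_map Z euclidean f \<Longrightarrow> z \<in> topspace Z \<Longrightarrow> (f \<longlongrightarrow> f z) (atin Z z)"
  by (simp add: continuous_map_atin)

lemma continuous_map_schatten_tendsto:
  fixes f :: "'z \<Rightarrow> 'h::complex_hilbert bop"
  assumes "r \<ge> 1" "continuous_map Z (schatten_topology r) f" "z \<in> topspace Z"
  shows "((\<lambda>z'. schatten_norm r (f z' - f z)) \<longlongrightarrow> 0) (atin Z z)"
  using assms(2,3) limitin_schatten[OF assms(1), of f "f z" "atin Z z"] by (simp add: continuous_map_atin)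

lemma continuous_map_schatten_add:
  fixes f :: "'z \<Rightarrow> 'h::complex_hilbert bop"
  assumes r: "r \<ge> 1" and f: "continuous_map Z (schatten_topology r) f"
    and g: "continuous_map Z (schatten_topology r) g"
  shows "continuous_map Z (schatten_topology r) (\<lambda>z. f z + g z)"
  unfolding continuous_map_atin
proof
  fix z assume z: "z \<in> topspace Z"
  note mem = continuous_map_schatten_mem[OF f] continuous_map_schatten_mem[OF g]
  show "limitin (schatten_topology r) (\<lambda>z. f z + g z) (f z + g z) (atin Z z)"
  proof (rule limitin_schattenI[OF r])
    show "f z' + g z' - (f z + g z) = (f z' - f z) + (g z' - g z)" for z' by simp
    show "\<forall>\<^sub>F z' in atin Z z. f z' - f z \<in> schatten r \<and> schatten_norm r (f z' - f z) \<le> schatten_norm r (f z' - f z)"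
      "\<forall>\<^sub>F z' in atin Z z. g z' - g z \<in> schatten r \<and> schatten_norm r (g z' - g z) \<le> schatten_norm r (g z' - g z)"
      using eventually_atin_topspace by (eventually_elim, use z in \<open>simp add: schatten_diff r mem\<close>)+
  qed (intro schatten_add mem r z continuous_map_schatten_tendsto f g)+
qed

text \<open>The parameter \<open>m\<close> stands for multiplication in either order, so that left
  and right multiplication share one proof.\<close>

lemma continuous_map_schatten_bilinear:
  fixes f g :: "'z \<Rightarrow> 'h::complex_hilbert bop"
    and m :: "'h bop \<Rightarrow> 'h bop \<Rightarrow> 'h bop"
  assumes r: "r \<ge> 1" and f: "continuous_map Z euclidean f"
    and g: "continuous_map Z (schatten_topology r) g"
    and m: "\<And>A A' T. m (A - A') T = m A T - m A' T" "\<And>A T T'. m A (T - T') = m A T - m A T'"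
    and le: "\<And>A T. T \<in> schatten r \<Longrightarrow> m A T \<in> schatten r"
      "\<And>A T. T \<in> schatten r \<Longrightarrow> schatten_norm r (m A T) \<le> norm A * schatten_norm r T"
  shows "continuous_map Z (schatten_topology r) (\<lambda>z. m (f z) (g z))"
  unfolding continuous_map_atin
proof
  fix z assume z: "z \<in> topspace Z"
  note mem = continuous_map_schatten_mem[OF g]
  note lim = continuous_map_euclidean_tendsto[OF f z] continuous_map_schatten_tendsto[OF r g z]
  show "limitin (schatten_topology r) (\<lambda>z. m (f z) (g z)) (m (f z) (g z)) (atin Z z)"
  proof (rule limitin_schattenI[OF r])
    show "m (f z') (g z') - m (f z) (g z) = m (f z') (g z' - g z) + m (f z' - f z) (g z)" for z'
      by (simp add: m)
    show "\<forall>\<^sub>F z' in atin Z z. m (f z') (g z' - g z) \<in> schatten r \<and>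
        schatten_norm r (m (f z') (g z' - g z)) \<le> norm (f z') * schatten_norm r (g z' - g z)"
      using eventually_atin_topspace by eventually_elim (intro conjI le schatten_diff r mem z)
    have "((\<lambda>z'. norm (f z') * schatten_norm r (g z' - g z)) \<longlongrightarrow> norm (f z) * 0) (atin Z z)"
      by (intro tendsto_intros lim)
    then show "((\<lambda>z'. norm (f z') * schatten_norm r (g z' - g z)) \<longlongrightarrow> 0) (atin Z z)" by simp
    have "((\<lambda>z'. norm (f z' - f z) * schatten_norm r (g z)) \<longlongrightarrow> norm (f z - f z) * schatten_norm r (g z)) (atin Z z)"
      by (intro tendsto_intros lim)
    then show "((\<lambda>z'. norm (f z' - f z) * schatten_norm r (g z)) \<longlongrightarrow> 0) (atin Z z)" by simp
  qed (use z in \<open>simp_all add: le mem\<close>)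
qed

lemma continuous_map_schatten_mult_left:
  fixes f :: "'z \<Rightarrow> 'h::complex_hilbert bop"
  assumes "r \<ge> 1" "continuous_map Z euclidean f" "continuous_map Z (schatten_topology r) g"
  shows "continuous_map Z (schatten_topology r) (\<lambda>z. f z * g z)"
  using assms(1) schatten_mult_left[of _ r]
  by (intro continuous_map_schatten_bilinear[where m = "(*)"] assms) (auto simp: algebra_simps)

lemma continuous_map_schatten_mult_right:
  fixes f :: "'z \<Rightarrow> 'h::complex_hilbert bop"
  assumes "r \<ge> 1" "continuous_map Z euclidean f" "continuous_map Z (schatten_topology r) g"
  shows "continuous_map Z (schatten_topology r) (\<lambda>z. g z * f z)"
  using assms(1) schatten_mult_right[of _ r]
  by (intro continuous_map_schatten_bilinear[where m = "\<lambda>A T. T * A"] assms) (auto simp: algebra_simps)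

lemma continuous_map_schatten_euclidean:
  fixes f :: "'z \<Rightarrow> 'h::complex_hilbert bop"
  assumes r: "r \<ge> 1" and f: "continuous_map Z (schatten_topology r) f"
  shows "continuous_map Z euclidean f"
  unfolding continuous_map_atin limitin_canonical_iff
proof
  fix z assume z: "z \<in> topspace Z"
  show "(f \<longlongrightarrow> f z) (atin Z z)"
  proof (rule LIM_zero_cancel, rule Lim_null_comparison)
    show "\<forall>\<^sub>F z' in atin Z z. norm (f z' - f z) \<le> schatten_norm r (f z' - f z)"
      using eventually_atin_topspace
      by eventually_elim (use r z in \<open>auto intro!: norm_le_schatten_norm schatten_diff continuous_map_schatten_mem[OF f]\<close>)
  qed (rule continuous_map_schatten_tendsto[OF r f z])
qed

text \<open>A sequence is extracted that lies in ever smaller Cauchy sets of the filter. It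
  converges in operator norm, and the Schatten estimate for the limit is recovered from finite
  partial sums.\<close>

lemma schatten_complete:
  fixes F :: "'h::complex_hilbert bop filter"
  assumes r: "r \<ge> 1" and F: "F \<noteq> bot" "\<forall>\<^sub>F x in F. x \<in> schatten r"
    and Cauchy: "\<And>U. openin (schatten_topology r) U \<Longrightarrow> 0 \<in> U \<Longrightarrow> \<forall>\<^sub>F (x, y) in F \<times>\<^sub>F F. x - y \<in> U"
  shows "\<exists>l. limitin (schatten_topology r) (\<lambda>x. x) l F"
proof -
  have r0: "r > 0" using r by simp
  let ?e = "\<lambda>n. inverse (real (Suc n))"
  have "\<exists>Q. eventually Q F \<and> (\<forall>x y. Q x \<longrightarrow> Q y \<longrightarrow> schatten_norm r (x - y) < ?e n)" for n
  proof -
    let ?U = "dual_ball r (0 :: 'h bop) (?e n / 4)"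
    have "\<forall>\<^sub>F (x, y) in F \<times>\<^sub>F F. x - y \<in> ?U"
      by (intro Cauchy openin_dual_ball r center_in_dual_ball) auto
    then obtain Q where Q: "eventually Q F" "\<And>x y. Q x \<Longrightarrow> Q y \<Longrightarrow> x - y \<in> ?U"
      unfolding eventually_prod_same by auto
    have "schatten_norm r (x - y) < ?e n" if "Q x" "Q y" for x y
      using schatten_norm_dual_ball[OF r Q(2)[OF that]] by simp
    with Q(1) show ?thesis by blast
  qed
  then obtain Q where Q: "\<And>n. eventually (Q n) F"
      "\<And>n x y. Q n x \<Longrightarrow> Q n y \<Longrightarrow> schatten_norm r (x - y) < ?e n"
    by metis
  have "\<exists>x. x \<in> schatten r \<and> (\<forall>j\<in>{..n}. Q j x)" for n
  proof (rule eventually_happens'[OF F(1)])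
    show "\<forall>\<^sub>F x in F. x \<in> schatten r \<and> (\<forall>j\<in>{..n}. Q j x)"
      by (intro eventually_conj F eventually_ball_finite ballI Q) auto
  qed
  then obtain X where X: "\<And>n. X n \<in> schatten r" "\<And>n j. j \<le> n \<Longrightarrow> Q j (X n)"
    by (metis atMost_iff)
  have XX: "schatten_norm r (X m - X n) < ?e j" if "j \<le> m" "j \<le> n" for j m n
    using that by (intro Q(2) X)
  have "Cauchy X"
  proof (rule CauchyI)
    fix e :: real assume "e > 0"
    then obtain j where j: "?e j < e" using reals_Archimedean by blast
    have "norm (X m - X n) < e" if "m \<ge> j" "n \<ge> j" for m n
      using norm_le_schatten_norm[OF schatten_diff[OF r X(1) X(1)] r0, of m n] XX[OF that] j by simp
    then show "\<exists>j. \<forall>m\<ge>j. \<forall>n\<ge>j. norm (X m - X n) < e" by blast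
  qed
  then obtain l where l: "X \<longlonglongrightarrow> l" by (auto simp: Cauchy_convergent_iff convergent_def)
  have lim: "X n - l \<in> schatten r" "schatten_norm r (X n - l) \<le> ?e n" for n
  proof -
    \<comment> \<open>For fixed \<open>k\<close> the partial sum is continuous for the operator
      norm, so the bound on \<open>X n - X m\<close> survives the limit in \<open>m\<close>; only
      afterwards is \<open>k\<close> let loose.\<close>
    have "(\<Sum>i<k. singular_number i (X n - l) powr r) \<le> ?e n powr r" for k
    proof (rule LIMSEQ_le_const2)
      show "(\<lambda>m. \<Sum>i<k. singular_number i (X n - X m) powr r) \<longlonglongrightarrow> (\<Sum>i<k. singular_number i (X n - l) powr r)"
        by (intro tendsto_sum tendsto_powr' tendsto_singular_number tendsto_diff tendsto_const l)
          (use r in auto)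
      have "(\<Sum>i<k. singular_number i (X n - X m) powr r) \<le> ?e n powr r" if "m \<ge> n" for m
      proof -
        have "(\<Sum>i<k. singular_number i (X n - X m) powr r) \<le> schatten_norm r (X n - X m) powr r"
          by (intro sum_singular_number_le schatten_diff r X r0)
        also have "\<dots> \<le> ?e n powr r"
          using XX[of n n m] that r by (intro powr_mono2) auto
        finally show ?thesis .
      qed
      then show "\<exists>N. \<forall>m\<ge>N. (\<Sum>i<k. singular_number i (X n - X m) powr r) \<le> ?e n powr r" by blast
    qed
    then show "X n - l \<in> schatten r" "schatten_norm r (X n - l) \<le> ?e n"
      using schattenI[OF r0, of "?e n" "X n - l"] by auto
  qed
  have ls: "l \<in> schatten r"
    using schatten_diff[OF r X(1)[of 0] lim(1)[of 0]] by simp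
  have "((\<lambda>x. schatten_norm r (x - l)) \<longlongrightarrow> 0) F"
  proof (rule tendstoI)
    fix e :: real assume e: "e > 0"
    \<comment> \<open>72 is twice the quasi-triangle constant 36.\<close>
    obtain n where n: "?e n < e / 72" using reals_Archimedean[of "e / 72"] e by auto
    show "\<forall>\<^sub>F x in F. dist (schatten_norm r (x - l)) 0 < e"
      using F(2) Q(1)[of n]
    proof eventually_elim
      case (elim x)
      have "schatten_norm r (x - l) \<le> 36 * (schatten_norm r (x - X n) + schatten_norm r (X n - l))"
        by (intro schatten_norm_triangle r elim X ls)
      also have "\<dots> < e" using Q(2)[OF elim(2) X(2)[of n n]] lim(2)[of n] n by simp
      finally show ?case by simp
    qed
  qed
  then show ?thesis using ls F(2) unfolding limitin_schatten[OF r] by blast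
qed

lemma continuous_map_scaleC_one:
  "continuous_map euclidean euclidean (\<lambda>c. c *\<^sub>C (1 :: 'h::complex_hilbert bop))"
proof -
  have "\<exists>d>0. \<forall>c'. dist c' c < d \<longrightarrow> dist (c' *\<^sub>C (1 :: 'h bop)) (c *\<^sub>C 1) < e" if "e > 0" for c :: complex and e
  proof (intro exI[of _ e] conjI allI impI that)
    fix c' assume "dist c' c < e"
    have "norm ((c' - c) *\<^sub>C (1 :: 'h bop)) \<le> cmod (c' - c) * norm (1 :: 'h bop)"
      by (rule norm_scaleC_bop_le)
    also have "\<dots> \<le> cmod (c' - c) * 1" by (intro mult_left_mono norm_one_bop_le) auto
    also have "\<dots> < e" using \<open>dist c' c < e\<close> by (simp add: dist_norm)
    finally show "dist (c' *\<^sub>C (1 :: 'h bop)) (c *\<^sub>C 1) < e" by (simp add: dist_norm scaleC_diff_left)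
  qed
  then show ?thesis by (simp add: continuous_on_iff)
qed

lemma locally_convex_algebra_schatten:
  assumes r: "r \<ge> 1"
  shows "locally_convex_algebra (schatten_topology r :: 'h::complex_hilbert bop topology)"
  unfolding locally_convex_algebra_def
proof (intro conjI allI impI)
  let ?X = "schatten_topology r :: 'h bop topology"
  show "0 \<in> topspace ?X" by simp
  show "continuous_map (prod_topology ?X ?X) ?X (\<lambda>(x, y). x + y)"
    unfolding case_prod_unfold
    by (intro continuous_map_schatten_add r continuous_map_fst continuous_map_snd)
  show "continuous_map (prod_topology ?X ?X) ?X (\<lambda>(x, y). x * y)"
    unfolding case_prod_unfold
    by (intro continuous_map_schatten_mult_left continuous_map_schatten_euclidean[OF r] r continuous_map_fst continuous_map_snd)
  \<comment> \<open>Scalar multiplication becomes left multiplication by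
    \<open>c *\<^sub>C 1\<close>, whose joint continuity is already known.\<close>
  have "continuous_map (prod_topology euclidean ?X) ?X (\<lambda>z. (fst z *\<^sub>C 1) * snd z)"
    by (intro continuous_map_schatten_mult_left r continuous_map_snd
        continuous_map_compose[OF continuous_map_fst continuous_map_scaleC_one, unfolded o_def])
  moreover have "(\<lambda>z. (fst z *\<^sub>C 1) * snd z) = (\<lambda>(c, x :: 'h bop). c *\<^sub>C x)"
    by (auto simp: mult_scaleC_left)
  ultimately show "continuous_map (prod_topology euclidean ?X) ?X (\<lambda>(c, x). c *\<^sub>C x)" by simp
  fix U assume U: "openin ?X U \<and> 0 \<in> U"
  then obtain e where e: "e > 0" "\<And>S. S \<in> schatten r \<Longrightarrow> schatten_norm r (S - 0) < e \<Longrightarrow> S \<in> U"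
    unfolding openin_schatten_topology by blast
  have "dual_ball r 0 (e / 4) \<subseteq> U"
  proof
    fix S :: "'h bop" assume S: "S \<in> dual_ball r 0 (e / 4)"
    then have "S \<in> schatten r" by (simp add: dual_ball_def)
    then show "S \<in> U" using schatten_norm_dual_ball[OF r S] by (intro e) auto
  qed
  then show "\<exists>V. openin ?X V \<and> 0 \<in> V \<and> convex V \<and> V \<subseteq> U"
    using e r by (intro exI[of _ "dual_ball r 0 (e / 4)"])
      (auto simp: openin_dual_ball convex_dual_ball_zero intro: center_in_dual_ball)
next
  let ?X = "schatten_topology r :: 'h bop topology"
  fix F :: "'h bop filter"
  assume F: "F \<noteq> bot \<and> (\<forall>\<^sub>F x in F. x \<in> topspace ?X) \<and>
    (\<forall>U. openin ?X U \<and> 0 \<in> U \<longrightarrow> (\<forall>\<^sub>F (x, y) in F \<times>\<^sub>F F. x - y \<in> U))"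
  show "\<exists>l. limitin ?X (\<lambda>x. x) l F"
    by (rule schatten_complete[OF r]) (use F in auto)
qed

text \<open>Each singular number is bounded by the p-norm, so the excess power \<open>r - p\<close>
  can be traded for a constant. This puts \<open>a G G\<close>, which lies in the ideal for
  \<open>p\<close>, into the ideal for \<open>2 p\<close>.\<close>

lemma schatten_mono:
  assumes T: "T \<in> schatten p" and p: "0 < p" "p \<le> r"
  shows "T \<in> schatten r" "schatten_norm r T \<le> schatten_norm p T"
proof -
  let ?N = "schatten_norm p T"
  have r: "r > 0" using p by simp
  have "(\<Sum>n<k. singular_number n T powr r) \<le> ?N powr r" for k
  proof -
    have "(\<Sum>n<k. singular_number n T powr r) \<le> (\<Sum>n<k. ?N powr (r - p) * singular_number n T powr p)"
    proof (intro sum_mono)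
      fix n
      have "singular_number n T powr r = singular_number n T powr (r - p) * singular_number n T powr p"
        by (simp flip: powr_add)
      also have "\<dots> \<le> ?N powr (r - p) * singular_number n T powr p"
        using p by (intro mult_right_mono powr_mono2 singular_number_le_schatten_norm T) auto
      finally show "singular_number n T powr r \<le> ?N powr (r - p) * singular_number n T powr p" .
    qed
    also have "\<dots> \<le> ?N powr (r - p) * ?N powr p"
      unfolding sum_distrib_left[symmetric] by (intro mult_left_mono sum_singular_number_le T p) auto
    also have "\<dots> = ?N powr r" by (simp flip: powr_add)
    finally show ?thesis .
  qed
  then show "T \<in> schatten r" "schatten_norm r T \<le> ?N"
    using schattenI[OF r, of ?N T] by auto
qed

lemma continuous_map_schatten_mono:
  fixes f :: "'z \<Rightarrow> 'h::complex_hilbert bop"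
  assumes p: "1 \<le> p" "p \<le> r" and f: "continuous_map Z (schatten_topology p) f"
  shows "continuous_map Z (schatten_topology r) f"
  unfolding continuous_map_atin
proof
  fix z assume z: "z \<in> topspace Z"
  have r: "1 \<le> r" "0 < p" using p by auto
  note mem = continuous_map_schatten_mem[OF f]
  show "limitin (schatten_topology r) f (f z) (atin Z z)"
    unfolding limitin_schatten[OF r(1)]
  proof (intro conjI schatten_mono(1)[OF _ r(2) p(2)] mem z)
    show "\<forall>\<^sub>F z' in atin Z z. f z' \<in> schatten r"
      using eventually_atin_topspace by eventually_elim (rule schatten_mono(1)[OF mem r(2) p(2)])
    show "((\<lambda>z'. schatten_norm r (f z' - f z)) \<longlongrightarrow> 0) (atin Z z)"
    proof (rule Lim_null_comparison)
      show "\<forall>\<^sub>F z' in atin Z z. norm (schatten_norm r (f z' - f z)) \<le> schatten_norm p (f z' - f z)"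
        using eventually_atin_topspace
        by eventually_elim (simp add: schatten_mono(2)[OF schatten_diff[OF p(1) mem mem[OF z]] r(2) p(2)])
    qed (rule continuous_map_schatten_tendsto[OF p(1) f z])
  qed
qed

section \<open>The Cayley transform of the real line\<close>

definition cayley :: "real \<Rightarrow> complex" where
  "cayley x = (complex_of_real x - \<i>) / (complex_of_real x + \<i>)"

text \<open>On the unit circle without 1 the quotient is real, so \<open>Re\<close> only adjusts the
  type. At 1, which corresponds to infinity, division by zero gives the value 0.\<close>

definition inv_cayley :: "complex \<Rightarrow> real" where
  "inv_cayley z = Re (\<i> * (1 + z) / (1 - z))"

lemma of_real_add_nonreal: "Im z \<noteq> 0 \<Longrightarrow> complex_of_real x + z \<noteq> 0" "Im z \<noteq> 0 \<Longrightarrow> complex_of_real x - z \<noteq> 0"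
  by (auto simp: complex_eq_iff)

lemma of_real_add_ii [simp]: "complex_of_real x + \<i> \<noteq> 0" "\<i> + complex_of_real x \<noteq> 0"
  using of_real_add_nonreal(1)[of "\<i>" x] by (simp_all add: add.commute)

lemma one_minus_cayley: "1 - cayley x = 2 * \<i> / (complex_of_real x + \<i>)"
  by (simp add: cayley_def field_simps)

lemma norm_cayley [simp]: "cmod (cayley x) = 1"
proof -
  have "cmod (complex_of_real x - \<i>) = cmod (complex_of_real x + \<i>)"
    by (simp add: cmod_def)
  then show ?thesis by (simp add: cayley_def norm_divide)
qed

lemma cayley_cnj_cayley [simp]: "cayley x * cnj (cayley x) = 1" "cnj (cayley x) * cayley x = 1"
  by (simp_all add: mult.commute flip: complex_norm_square)

lemma cayley_neq_one: "cayley x \<noteq> 1"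
  using one_minus_cayley[of x] by auto

lemma inv_cayley_cayley [simp]: "inv_cayley (cayley x) = x"
proof -
  have "1 + cayley x = 2 * complex_of_real x / (complex_of_real x + \<i>)"
    by (simp add: cayley_def field_simps)
  then have "\<i> * (1 + cayley x) / (1 - cayley x) = complex_of_real x"
    unfolding one_minus_cayley by simp
  then show ?thesis by (simp add: inv_cayley_def)
qed

lemma cayley_inv_cayley:
  assumes z: "cmod z = 1" "z \<noteq> 1"
  shows "cayley (inv_cayley z) = z"
proof -
  define w where "w = \<i> * (1 + z) / (1 - z)"
  have zc: "z * cnj z = 1" using z by (simp flip: complex_norm_square)
  have nz: "1 - z \<noteq> 0" "1 - cnj z \<noteq> 0" using z by (auto simp: complex_eq_iff)
  have "cnj w = w"
    using nz zc by (simp add: w_def divide_eq_eq eq_divide_eq algebra_simps)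
  then have "complex_of_real (inv_cayley z) = w"
    unfolding inv_cayley_def w_def[symmetric]
    by (metis Reals_cnj_iff complex_is_Real_iff of_real_Re)
  then have "cayley (inv_cayley z) = (w - \<i>) / (w + \<i>)" by (simp add: cayley_def)
  also have "w - \<i> = 2 * \<i> * z / (1 - z)" using nz by (simp add: w_def field_simps)
  also have "w + \<i> = 2 * \<i> / (1 - z)" using nz by (simp add: w_def field_simps)
  finally show ?thesis using nz by simp
qed

text \<open>Continuity is left out on purpose: Fejer sums only sample a function at the nodes, and
  their limits are tested against arbitrary bounded factors.\<close>

definition bounded_fun :: "(real \<Rightarrow> complex) \<Rightarrow> bool" where
  "bounded_fun f \<longleftrightarrow> (\<exists>B. \<forall>x. cmod (f x) \<le> B)"

lemma bounded_funE:
  assumes "bounded_fun f"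
  obtains B where "B > 0" "\<And>x. cmod (f x) \<le> B"
proof -
  obtain B where "\<And>x. cmod (f x) \<le> B" using assms by (auto simp: bounded_fun_def)
  then have "cmod (f x) \<le> \<bar>B\<bar> + 1" for x by (smt (verit) )
  then show thesis using that[of "\<bar>B\<bar> + 1"] by simp
qed

lemma bounded_funI: "(\<And>x. cmod (f x) \<le> B) \<Longrightarrow> bounded_fun f"
  by (auto simp: bounded_fun_def)

lemma bounded_fun_add: "bounded_fun f \<Longrightarrow> bounded_fun g \<Longrightarrow> bounded_fun (\<lambda>x. f x + g x)"
  by (elim bounded_funE, rule bounded_funI) (rule norm_triangle_le, rule add_mono)

lemma bounded_fun_mult: "bounded_fun f \<Longrightarrow> bounded_fun g \<Longrightarrow> bounded_fun (\<lambda>x. f x * g x)"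
  by (elim bounded_funE, rule bounded_funI) (simp only: norm_mult, rule mult_mono, auto)

lemma bounded_continuous_bounded_fun: "bounded_continuous f \<Longrightarrow> bounded_fun f"
  by (auto simp: bounded_continuous_def bounded_fun_def bounded_iff)

lemma bounded_continuousI:
  "(\<And>x. isCont f x) \<Longrightarrow> (\<And>x. cmod (f x) \<le> B) \<Longrightarrow> bounded_continuous f"
  unfolding bounded_continuous_def bounded_iff by (auto simp: continuous_at_imp_continuous_on)

lemma bounded_continuous_const: "bounded_continuous (\<lambda>x. c)"
  by (rule bounded_continuousI[where B = "cmod c"]) auto

lemma bounded_continuous_isCont: "bounded_continuous f \<Longrightarrow> isCont f x"
  unfolding bounded_continuous_def using continuous_on_eq_continuous_at[of UNIV f] by simp

lemma bounded_continuous_add: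
  assumes f: "bounded_continuous f" and g: "bounded_continuous g"
  shows "bounded_continuous (\<lambda>x. f x + g x)"
proof -
  obtain B where B: "\<And>x. cmod (f x + g x) \<le> B"
    using bounded_fun_add[OF f[THEN bounded_continuous_bounded_fun] g[THEN bounded_continuous_bounded_fun]]
    unfolding bounded_fun_def by blast
  show ?thesis
    by (rule bounded_continuousI[OF _ B]) (intro continuous_intros bounded_continuous_isCont f g)
qed

lemma bounded_continuous_mult:
  assumes f: "bounded_continuous f" and g: "bounded_continuous g"
  shows "bounded_continuous (\<lambda>x. f x * g x)"
proof -
  obtain B where B: "\<And>x. cmod (f x * g x) \<le> B"
    using bounded_fun_mult[OF f[THEN bounded_continuous_bounded_fun] g[THEN bounded_continuous_bounded_fun]]
    unfolding bounded_fun_def by blast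
  show ?thesis
    by (rule bounded_continuousI[OF _ B]) (intro continuous_intros bounded_continuous_isCont f g)
qed

lemma bounded_continuous_cnj:
  assumes f: "bounded_continuous f"
  shows "bounded_continuous (\<lambda>x. cnj (f x))"
proof -
  obtain B where B: "\<And>x. cmod (f x) \<le> B"
    using f[THEN bounded_continuous_bounded_fun] unfolding bounded_fun_def by blast
  show ?thesis
  proof (rule bounded_continuousI)
    show "isCont (\<lambda>x. cnj (f x)) x" for x
      by (intro isCont_cnj bounded_continuous_isCont f)
    show "cmod (cnj (f x)) \<le> B" for x using B by simp
  qed
qed

lemma isCont_cayley: "isCont cayley x"
proof -
  have "isCont (\<lambda>x. (complex_of_real x - \<i>) / (complex_of_real x + \<i>)) x"
    by (intro continuous_intros) auto
  then show ?thesis by (simp add: cayley_def[abs_def])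
qed

lemma bounded_continuous_one_minus_cayley: "bounded_continuous (\<lambda>x. 1 - cayley x)"
proof (rule bounded_continuousI)
  show "isCont (\<lambda>x. 1 - cayley x) x" for x by (intro continuous_intros isCont_cayley)
  show "cmod (1 - cayley x) \<le> 1 + 1" for x by (rule order_trans[OF norm_triangle_ineq4]) simp
qed

text \<open>\<open>f\<close> may oscillate at infinity, but its product with
  \<open>1 - cayley\<close> extends continuously to the circle by 0 at the point 1. The class
  \<open>E\<close> is kept abstract because the lemma serves twice: for functions with a Fejer
  limit, and for functions on which two calculi agree.\<close>

lemma cayley_Stone_Weierstrass:
  fixes E :: "(real \<Rightarrow> complex) set"
  assumes const: "\<And>c. (\<lambda>x. c) \<in> E"
    and E_add: "\<And>f g. f \<in> E \<Longrightarrow> g \<in> E \<Longrightarrow> (\<lambda>x. f x + g x) \<in> E"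
    and mult: "\<And>f g. f \<in> E \<Longrightarrow> g \<in> E \<Longrightarrow> (\<lambda>x. f x * g x) \<in> E"
    and gen: "cayley \<in> E" "(\<lambda>x. cnj (cayley x)) \<in> E"
    and lim: "\<And>f. bounded_continuous f \<Longrightarrow> (\<And>e. e > 0 \<Longrightarrow> \<exists>g\<in>E. \<forall>x. cmod (f x - g x) \<le> e) \<Longrightarrow> f \<in> E"
    and f: "bounded_continuous f"
  shows "(\<lambda>x. f x * (1 - cayley x)) \<in> E"
proof (rule lim[OF bounded_continuous_mult[OF f bounded_continuous_one_minus_cayley]])
  fix e :: real assume e: "e > 0"
  define F where "F = (\<lambda>z. if z = 1 then 0 else f (inv_cayley z) * (1 - z))"
  obtain B where B: "\<And>x. cmod (f x) \<le> B"
    using bounded_funE[OF bounded_continuous_bounded_fun[OF f]] by blast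
  have "isCont F z" for z
  proof (cases "z = 1")
    case True
    have "F \<midarrow>1\<rightarrow> 0"
    proof (rule Lim_null_comparison)
      show "\<forall>\<^sub>F z in at 1. norm (F z) \<le> B * cmod (1 - z)"
        unfolding F_def by (intro always_eventually) (auto simp: norm_mult intro: mult_right_mono B)
      have "(\<lambda>z. B * cmod (1 - z)) \<midarrow>1\<rightarrow> B * cmod (1 - 1)" by (intro tendsto_intros)
      then show "(\<lambda>z. B * cmod (1 - z)) \<midarrow>1\<rightarrow> 0" by simp
    qed
    then show ?thesis using True by (simp add: isCont_def F_def)
  next
    case False
    have "isCont inv_cayley z"
      unfolding inv_cayley_def using False by (intro continuous_Re continuous_intros) auto
    then have "isCont (\<lambda>z. f (inv_cayley z) * (1 - z)) z"
      by (intro continuous_intros isCont_o2[of z inv_cayley f] bounded_continuous_isCont f)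
    moreover have "\<forall>\<^sub>F w in nhds z. F w = f (inv_cayley w) * (1 - w)"
      using t1_space_nhds[OF False] by eventually_elim (simp add: F_def)
    ultimately show ?thesis by (simp add: isCont_cong)
  qed
  then have "continuous_on (sphere 0 1) F" by (simp add: continuous_at_imp_continuous_on)
  then obtain p where p: "polynomial_function p" "\<And>z. z \<in> sphere 0 1 \<Longrightarrow> cmod (F z - p z) < e"
    using Stone_Weierstrass_polynomial_function[of "sphere 0 1" F e] e by auto
  have real: "(\<lambda>x. complex_of_real (q (cayley x))) \<in> E" if "real_polynomial_function q" for q
    using that
  proof induction
    case (linear q)
    interpret bounded_linear q by fact
    \<comment> \<open>A real linear function of \<open>z\<close> has the form
      \<open>a * z + b * cnj z\<close>; the coefficients solve the equations at 1 and \<i>.\<close>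
    define a b where "a = (complex_of_real (q 1) - \<i> * complex_of_real (q \<i>)) / 2"
      and "b = (complex_of_real (q 1) + \<i> * complex_of_real (q \<i>)) / 2"
    have "complex_of_real (q z) = a * z + b * cnj z" for z
    proof -
      have "z = Re z *\<^sub>R 1 + Im z *\<^sub>R \<i>" by (simp add: complex_eq_iff)
      then have "q z = Re z * q 1 + Im z * q \<i>" by (metis add scaleR real_scaleR_def)
      then show ?thesis by (simp add: a_def b_def complex_eq_iff field_simps)
    qed
    moreover have "(\<lambda>x. a * cayley x + b * cnj (cayley x)) \<in> E"
      by (intro E_add mult const gen)
    ultimately show ?case by simp
  qed (simp_all add: const E_add mult)
  have "real_polynomial_function (Re \<circ> p)" "real_polynomial_function (Im \<circ> p)"
    using p(1) bounded_linear_Re bounded_linear_Im unfolding polynomial_function_def by blast+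
  then have "(\<lambda>x. complex_of_real (Re (p (cayley x))) + \<i> * complex_of_real (Im (p (cayley x)))) \<in> E"
    using real[of "Re \<circ> p"] real[of "Im \<circ> p"] by (intro E_add mult const) auto
  then have "(\<lambda>x. p (cayley x)) \<in> E" by (simp flip: complex_eq)
  moreover have "cmod (f x * (1 - cayley x) - p (cayley x)) \<le> e" for x
    using p(2)[of "cayley x"] by (simp add: F_def cayley_neq_one less_imp_le)
  ultimately show "\<exists>g\<in>E. \<forall>x. cmod (f x * (1 - cayley x) - g x) \<le> e"
    by (intro bexI[where x = "\<lambda>x. p (cayley x)"] allI)
qed

section \<open>Functional calculus of a unitary operator\<close>

definition node :: "nat \<Rightarrow> nat \<Rightarrow> complex" where
  "node n j = cis (pi / real (Suc n)) * cis (2 * pi * real j / real (Suc n))"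

lemma norm_node [simp]: "cmod (node n j) = 1"
  by (simp add: node_def norm_mult)

lemma node_power: "node n j ^ Suc n = - 1"
proof -
  have "node n j ^ Suc n = cis pi * cis (2 * pi * real j)"
    unfolding node_def power_mult_distrib by (simp only: Complex.DeMoivre) simp
  also have "cis (2 * pi * real j) = 1" by (rule cis_multiple_2pi) simp
  finally show ?thesis by simp
qed

text \<open>The nodes are the solutions of \<open>z\<^sup>N = -1\<close>, so none of them is the point \<open>1\<close> at infinity.\<close>

lemma cayley_node: "cayley (inv_cayley (node n j)) = node n j"
proof (rule cayley_inv_cayley)
  show "node n j \<noteq> 1" using node_power[of n j] by (metis one_neq_neg_one power_one)
qed simp

text \<open>Discrete orthogonality of characters. Both exponents are at most \<open>n\<close>, so
  their difference stays below the number \<open>Suc n\<close> of nodes and the ratio of the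
  geometric sum is a nontrivial root of unity. The rotation in \<open>node\<close> only contributes
  a common factor.\<close>

lemma sum_node_power:
  assumes "k \<le> n" "l \<le> n"
  shows "(\<Sum>j<Suc n. cnj (node n j) ^ k * node n j ^ l) = (if k = l then of_nat (Suc n) else 0)"
proof -
  have cn: "cnj (node n j) * node n j = 1" for j
    by (simp add: mult.commute flip: complex_norm_square)
  have zero: "(\<Sum>j<Suc n. node n j ^ m) = 0" if m: "0 < m" "m \<le> n" for m
  proof -
    define \<zeta> where "\<zeta> = cis (2 * pi * real m / real (Suc n))"
    have "node n j ^ m = cis (pi / real (Suc n)) ^ m * \<zeta> ^ j" for j
      unfolding node_def \<zeta>_def power_mult_distrib Complex.DeMoivre by (simp add: field_simps)
    then have "(\<Sum>j<Suc n. node n j ^ m) = cis (pi / real (Suc n)) ^ m * (\<Sum>j<Suc n. \<zeta> ^ j)"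
      by (simp only: sum_distrib_left)
    moreover have "\<zeta> \<noteq> 1"
    proof
      assume "\<zeta> = 1"
      then have "cis (2 * pi * real m / real (Suc n)) = cis (2 * pi * real 0 / real (Suc n))"
        by (simp add: \<zeta>_def)
      then have "m = 0"
        using Complex.bij_betw_roots_unity[of "Suc n"] m unfolding bij_betw_def
        by (intro inj_onD[of "\<lambda>k. cis (2 * pi * real k / real (Suc n))" "{..<Suc n}"]) auto
      with m show False by simp
    qed
    moreover have "\<zeta> ^ Suc n = 1"
    proof -
      have "\<zeta> ^ Suc n = cis (2 * pi * real m)" by (simp only: \<zeta>_def Complex.DeMoivre) simp
      then show ?thesis by (simp only: cis_multiple_2pi[OF Ints_of_nat])
    qed
    ultimately show ?thesis by (simp add: geometric_sum del: sum.lessThan_Suc power_Suc of_nat_Suc)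
  qed
  consider "k = l" | "k < l" | "l < k" by linarith
  then show ?thesis
  proof cases
    case 1
    then show ?thesis by (simp add: cn flip: power_mult_distrib)
  next
    case 2
    have "cnj (node n j) ^ k * node n j ^ l = node n j ^ (l - k)" for j
    proof -
      have "node n j ^ l = node n j ^ k * node n j ^ (l - k)" using 2 by (simp flip: power_add)
      then show ?thesis by (simp add: cn flip: power_mult_distrib mult.assoc)
    qed
    then show ?thesis using zero[of "l - k"] 2 assms by simp
  next
    case 3
    have "cnj (node n j) ^ k * node n j ^ l = cnj (node n j ^ (k - l))" for j
    proof -
      have "cnj (node n j) ^ k = cnj (node n j) ^ (k - l) * cnj (node n j) ^ l" using 3 by (simp flip: power_add)
      then show ?thesis by (simp add: cn mult.assoc flip: power_mult_distrib)
    qed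
    then have "(\<Sum>j<Suc n. cnj (node n j) ^ k * node n j ^ l) = cnj (\<Sum>j<Suc n. node n j ^ (k - l))"
      by simp
    also have "\<dots> = 0" using 3 assms by (subst zero) auto
    finally show ?thesis using 3 by simp
  qed
qed

text \<open>\<open>dense\<close> excludes the eigenvalue 1, as is automatic for a Cayley transform.
  It allows strong limits to be determined on vectors \<open>app (1 - U) w\<close>.\<close>

locale unitary_op =
  fixes U :: "'h::complex_hilbert bop"
  assumes adj_U_U [simp]: "adj U * U = 1" and U_adj_U [simp]: "U * adj U = 1"
    and dense: "closure (range (app (1 - U))) = UNIV"
begin

text \<open>At a spectral point \<open>w\<close> of \<open>U\<close> this is the sum of the powers
  of \<open>node n j * cnj w\<close>, a Dirichlet kernel. Its squared modulus is, up to
  normalisation, the Fejer kernel centred at the node.\<close>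

definition node_op :: "nat \<Rightarrow> nat \<Rightarrow> 'h bop" where
  "node_op n j = (\<Sum>k<Suc n. node n j ^ k *\<^sub>C adj U ^ k)"

text \<open>Discretised Fejer sums. The weights \<open>(node_op n j)\<^sup>* node_op n j\<close> are positive and add up to
  a multiple of the identity, whence the bound by the supremum of \<open>f\<close>.\<close>

definition fejer :: "nat \<Rightarrow> (real \<Rightarrow> complex) \<Rightarrow> 'h bop" where
  "fejer n f = (\<Sum>j<Suc n. (f (inv_cayley (node n j)) / (of_nat (Suc n))\<^sup>2) *\<^sub>C (adj (node_op n j) * node_op n j))"

lemma cinner_adj_power: "cinner (app (adj U ^ k) y) (app (adj U ^ k) x) = cinner y x"
proof (induction k)
  case (Suc k)
  have "app U (app (adj U) v) = v" for v
    by (metis U_adj_U app_mult app_one)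
  then have "cinner (app (adj U) v) (app (adj U) w) = cinner v w" for v w
    by (simp add: cinner_adj_right)
  with Suc show ?case by simp
qed simp

lemma norm_adj_power: "norm (app (adj U ^ k) x) = norm x"
proof -
  have "complex_of_real ((norm (app (adj U ^ k) x))\<^sup>2) = complex_of_real ((norm x)\<^sup>2)"
    using cinner_adj_power[of k x x] by (simp only: cinner_self)
  then show ?thesis by (simp only: of_real_eq_iff power2_eq_iff_nonneg norm_ge_zero)
qed

lemma norm_U: "norm (app U x) = norm x"
proof -
  have "app (adj U) (app U x) = x" by (metis adj_U_U app_mult app_one)
  then show ?thesis using norm_adj_power[of 1 "app U x"] by simp
qed

text \<open>Expanding both factors and summing over the nodes first leaves the diagonal
  \<open>k = l\<close>, where \<open>adj U ^ k\<close> preserves the inner product.\<close>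

lemma sum_node_op:
  "(\<Sum>j<Suc n. cinner (app (node_op n j) y) (app (node_op n j) x)) = (of_nat (Suc n))\<^sup>2 * cinner y x"
proof -
  let ?c = "\<lambda>k l. cinner (app (adj U ^ k) y) (app (adj U ^ l) x)"
  have "(\<Sum>j<Suc n. cinner (app (node_op n j) y) (app (node_op n j) x))
      = (\<Sum>j<Suc n. \<Sum>l<Suc n. \<Sum>k<Suc n. (cnj (node n j) ^ k * node n j ^ l) * ?c k l)"
    unfolding node_op_def app.sum_left cinner.sum_left cinner.sum_right
    by (intro sum.cong refl) (simp add: cinner_scaleC_left cinner_scaleC_right)
  also have "\<dots> = (\<Sum>l<Suc n. \<Sum>k<Suc n. (\<Sum>j<Suc n. cnj (node n j) ^ k * node n j ^ l) * ?c k l)"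
    unfolding sum_distrib_right
    by (subst sum.swap, rule sum.cong[OF refl], subst sum.swap, rule refl)
  also have "\<dots> = (\<Sum>l<Suc n. \<Sum>k<Suc n. if k = l then of_nat (Suc n) * ?c k l else 0)"
  proof (intro sum.cong refl)
    fix k l assume "k \<in> {..<Suc n}" "l \<in> {..<Suc n}"
    then show "(\<Sum>j<Suc n. cnj (node n j) ^ k * node n j ^ l) * ?c k l
       = (if k = l then of_nat (Suc n) * ?c k l else 0)"
      using sum_node_power[of k n l] by (simp only: lessThan_iff less_Suc_eq_le) simp
  qed
  also have "\<dots> = (\<Sum>k<Suc n. of_nat (Suc n) * cinner y x)"
    by (intro sum.cong refl) (simp add: cinner_adj_power del: sum.lessThan_Suc of_nat_Suc)
  finally show ?thesis by (simp add: power2_eq_square)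
qed

lemma sum_norm_node_op: "(\<Sum>j<Suc n. (norm (app (node_op n j) x))\<^sup>2) = (real (Suc n) * norm x)\<^sup>2"
proof -
  have "complex_of_real (\<Sum>j<Suc n. (norm (app (node_op n j) x))\<^sup>2) = complex_of_real ((real (Suc n) * norm x)\<^sup>2)"
    using sum_node_op[of n x x] by (simp only: cinner_self of_real_sum of_real_mult of_real_power of_real_of_nat_eq power_mult_distrib)
  then show ?thesis by (simp only: of_real_eq_iff)
qed

text \<open>Cauchy-Schwarz over the nodes, with the exact sum of squares for the left factor. Taking
  \<open>node_op\<close> for \<open>E\<close> and \<open>d = 1\<close> gives contractivity of the
  Fejer sums; taking the shift defect gives their asymptotic compatibility with
  \<open>U\<close>.\<close>

lemma norm_weighted_sum_le:
  assumes c: "\<And>j. cmod (c j) \<le> B" and d: "0 \<le> d"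
    and E: "\<And>x. (\<Sum>j<Suc n. (norm (app (E j) x))\<^sup>2) \<le> (real (Suc n) * d * norm x)\<^sup>2"
  shows "norm (\<Sum>j<Suc n. (c j / (of_nat (Suc n))\<^sup>2) *\<^sub>C (adj (node_op n j) * E j)) \<le> B * d"
proof (rule norm_bop_le)
  have B: "0 \<le> B" using c norm_ge_zero order_trans by blast
  then show "0 \<le> B * d" using d by simp
  fix x
  let ?T = "\<Sum>j<Suc n. (c j / (of_nat (Suc n))\<^sup>2) *\<^sub>C (adj (node_op n j) * E j)"
  show "norm (app ?T x) \<le> B * d * norm x"
  proof (rule norm_le_of_cinner)
    show "0 \<le> B * d * norm x" using B d by simp
    fix y
    let ?S = "\<Sum>j<Suc n. norm (app (node_op n j) y) * norm (app (E j) x)"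
    have "?S\<^sup>2 \<le> (\<Sum>j<Suc n. (norm (app (node_op n j) y))\<^sup>2) * (\<Sum>j<Suc n. (norm (app (E j) x))\<^sup>2)"
      by (rule Cauchy_Schwarz_ineq_sum)
    also have "\<dots> \<le> (real (Suc n) * norm y)\<^sup>2 * (real (Suc n) * d * norm x)\<^sup>2"
      unfolding sum_norm_node_op by (intro mult_left_mono E) simp
    also have "\<dots> = ((real (Suc n))\<^sup>2 * (norm y * d * norm x))\<^sup>2"
      by (simp add: power2_eq_square mult_ac)
    finally have S: "?S \<le> (real (Suc n))\<^sup>2 * (norm y * d * norm x)"
      by (rule power2_le_imp_le) (use d in simp)
    have "cinner y (app ?T x) = (\<Sum>j<Suc n. c j / (of_nat (Suc n))\<^sup>2 * cinner (app (node_op n j) y) (app (E j) x))"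
      unfolding app.sum_left cinner.sum_right
      by (intro sum.cong refl) (simp add: cinner_scaleC_right cinner_adj_right)
    then have "cmod (cinner y (app ?T x)) \<le> (\<Sum>j<Suc n. cmod (c j / (of_nat (Suc n))\<^sup>2 * cinner (app (node_op n j) y) (app (E j) x)))"
      by (simp only: norm_sum)
    also have "\<dots> \<le> (\<Sum>j<Suc n. B / (real (Suc n))\<^sup>2 * (norm (app (node_op n j) y) * norm (app (E j) x)))"
    proof (rule sum_mono)
      fix j
      have "cmod (c j / (of_nat (Suc n))\<^sup>2) \<le> B / (real (Suc n))\<^sup>2"
        unfolding norm_divide norm_power norm_of_nat by (intro divide_right_mono c) simp
      then show "cmod (c j / (of_nat (Suc n))\<^sup>2 * cinner (app (node_op n j) y) (app (E j) x))
        \<le> B / (real (Suc n))\<^sup>2 * (norm (app (node_op n j) y) * norm (app (E j) x))"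
        unfolding norm_mult using B by (intro mult_mono cinner_Cauchy_Schwarz) auto
    qed
    also have "\<dots> = B / (real (Suc n))\<^sup>2 * ?S"
      by (simp only: sum_distrib_left)
    also have "\<dots> \<le> B / (real (Suc n))\<^sup>2 * ((real (Suc n))\<^sup>2 * (norm y * d * norm x))"
      using B by (intro mult_left_mono S) simp
    also have "\<dots> = norm y * (B * d * norm x)"
      by (simp del: of_nat_Suc)
    finally show "cmod (cinner y (app ?T x)) \<le> norm y * (B * d * norm x)" .
  qed
qed

lemma norm_fejer_le:
  assumes "\<And>x. cmod (f x) \<le> B"
  shows "norm (fejer n f) \<le> B"
  using norm_weighted_sum_le[where c = "\<lambda>j. f (inv_cayley (node n j))" and B = B and d = 1 and n = n and E = "node_op n"] assms
  unfolding fejer_def by (simp add: sum_norm_node_op del: sum.lessThan_Suc of_nat_Suc)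

lemma fejer_add: "fejer n (\<lambda>x. f x + g x) = fejer n f + fejer n g"
  by (simp add: fejer_def add_divide_distrib scaleC_add_left sum.distrib del: sum.lessThan_Suc of_nat_Suc)

lemma fejer_scale: "fejer n (\<lambda>x. c * f x) = c *\<^sub>C fejer n f"
  by (simp add: fejer_def scaleC_sum_right scaleC_scaleC del: sum.lessThan_Suc of_nat_Suc)

lemma fejer_diff: "fejer n (\<lambda>x. f x - g x) = fejer n f - fejer n g"
  using fejer_add[of n f "\<lambda>x. (- 1) * g x"] fejer_scale[of n "- 1" g] by simp

lemma fejer_one: "fejer n (\<lambda>x. 1) = 1"
proof (rule bop_eqI, rule cinner_ext_right)
  fix x y
  have "cinner y (app (fejer n (\<lambda>x. 1)) x)
     = (\<Sum>j<Suc n. cinner (app (node_op n j) y) (app (node_op n j) x)) / (of_nat (Suc n))\<^sup>2"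
    unfolding fejer_def app.sum_left cinner.sum_right sum_divide_distrib
    by (intro sum.cong refl) (simp add: cinner_scaleC_right cinner_adj_right)
  then show "cinner y (app (fejer n (\<lambda>x. 1)) x) = cinner y (app 1 x)"
    unfolding sum_node_op by (simp del: of_nat_Suc)
qed

lemma fejer_adjoint: "cinner (app (fejer n (\<lambda>x. cnj (f x))) y) x = cinner y (app (fejer n f) x)"
  unfolding fejer_def app.sum_left cinner.sum_right cinner.sum_left
  by (intro sum.cong refl)
    (simp add: cinner_scaleC_right cinner_scaleC_left cinner_adj_right cinner_adj_left)

text \<open>Multiplication by \<open>U\<close> lowers the power of \<open>adj U\<close>,
  multiplication by the node raises that of the node; the two sums cancel up to end terms. The last
  one changes sign since \<open>node n j ^ Suc n = - 1\<close>.\<close>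

lemma node_op_shift:
  "node_op n j * U - node n j *\<^sub>C node_op n j = U + adj U ^ n"
proof -
  have "node_op n j * U = (\<Sum>k<Suc n. node n j ^ k *\<^sub>C (adj U ^ k * U))"
    by (simp add: node_op_def sum_distrib_right mult_scaleC_left del: sum.lessThan_Suc)
  also have "\<dots> = U + (\<Sum>k<n. node n j ^ Suc k *\<^sub>C (adj U ^ Suc k * U))"
    by (simp add: sum.lessThan_Suc_shift del: sum.lessThan_Suc power_Suc)
  also have "\<dots> = U + (\<Sum>k<n. node n j ^ Suc k *\<^sub>C adj U ^ k)"
    by (simp only: power_Suc2 mult.assoc adj_U_U mult_1_right)
  finally have 1: "node_op n j * U = U + (\<Sum>k<n. node n j ^ Suc k *\<^sub>C adj U ^ k)" .
  have "node n j *\<^sub>C node_op n j = (\<Sum>k<Suc n. node n j ^ Suc k *\<^sub>C adj U ^ k)"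
    by (simp add: node_op_def scaleC_sum_right scaleC_scaleC del: sum.lessThan_Suc)
  also have "\<dots> = (\<Sum>k<n. node n j ^ Suc k *\<^sub>C adj U ^ k) - adj U ^ n"
    using node_power[of n j] by (simp del: power_Suc)
  finally show ?thesis using 1 by simp
qed

text \<open>This needs no continuity of \<open>f\<close>, neither on the line nor at infinity. It is the reason why the
  Fejer sums reach functions that do not extend continuously to the circle.\<close>

lemma norm_fejer_shift_le:
  assumes f: "\<And>x. cmod (f x) \<le> B"
  shows "norm (fejer n (\<lambda>x. f x * cayley x) - fejer n f * U) \<le> B * (2 / sqrt (real (Suc n)))"
proof -
  let ?E = "\<lambda>j. node_op n j * U - node n j *\<^sub>C node_op n j"
  have eq: "fejer n (\<lambda>x. f x * cayley x) - fejer n f * U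
     = - (\<Sum>j<Suc n. (f (inv_cayley (node n j)) / (of_nat (Suc n))\<^sup>2) *\<^sub>C (adj (node_op n j) * ?E j))"
    unfolding fejer_def sum_distrib_right sum_subtractf[symmetric] sum_negf[symmetric]
    by (intro sum.cong refl)
      (simp add: cayley_node right_diff_distrib mult_scaleC_left mult_scaleC_right mult.assoc
        scaleC_diff_right scaleC_scaleC del: of_nat_Suc)
  show ?thesis
    unfolding eq norm_minus_cancel
  proof (rule norm_weighted_sum_le)
    fix x
    have "norm (app (?E j) x) \<le> 2 * norm x" for j
      unfolding node_op_shift app.add_left
      using norm_triangle_ineq[of "app U x" "app (adj U ^ n) x"] by (simp add: norm_U norm_adj_power)
    \<comment> \<open>Each defect is at most \<open>2 * norm x\<close> whatever the node, so the sum
      of squares grows like the number N of nodes while the normalisation allows N squared. This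
      leaves a factor of order 1 / sqrt N.\<close>
    then have "(\<Sum>j<Suc n. (norm (app (?E j) x))\<^sup>2) \<le> (\<Sum>j<Suc n. (2 * norm x)\<^sup>2)"
      by (intro sum_mono power_mono) auto
    also have "\<dots> = real (Suc n) * (2 * norm x)\<^sup>2" by simp
    also have "\<dots> = (real (Suc n) * (2 / sqrt (real (Suc n))) * norm x)\<^sup>2"
      by (simp add: power_mult_distrib power_divide power2_eq_square del: of_nat_Suc)
    finally show "(\<Sum>j<Suc n. (norm (app (?E j) x))\<^sup>2) \<le> (real (Suc n) * (2 / sqrt (real (Suc n))) * norm x)\<^sup>2" .
  qed (use f in auto)
qed

text \<open>Convergence of \<open>fejer n f\<close> alone would not pass to products. Testing
  against every bounded \<open>g\<close> is an asymptotic multiplicativity that does, and the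
  constant \<open>g = 1\<close> recovers plain convergence.\<close>

definition fejer_limit :: "(real \<Rightarrow> complex) \<Rightarrow> 'h bop \<Rightarrow> bool" where
  "fejer_limit f A \<longleftrightarrow> bounded_fun f \<and>
     (\<forall>g. bounded_fun g \<longrightarrow> (\<lambda>n. fejer n (\<lambda>x. g x * f x) - fejer n g * A) \<longlonglongrightarrow> 0)"

lemma fejer_limitD: "fejer_limit f A \<Longrightarrow> bounded_fun g \<Longrightarrow> (\<lambda>n. fejer n (\<lambda>x. g x * f x) - fejer n g * A) \<longlonglongrightarrow> 0"
  by (simp add: fejer_limit_def)

lemma fejer_limit_tendsto: "fejer_limit f A \<Longrightarrow> (\<lambda>n. fejer n f) \<longlonglongrightarrow> A"
  using fejer_limitD[of f A "\<lambda>x. 1"] by (simp add: bounded_funI[of _ 1] fejer_one LIM_zero_cancel)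

lemma fejer_limit_const: "fejer_limit (\<lambda>x. c) (c *\<^sub>C 1)"
proof -
  have "fejer n (\<lambda>x. g x * c) - fejer n g * (c *\<^sub>C 1) = 0" for n g
    using fejer_scale[of n c g] by (simp add: mult_scaleC_right mult.commute)
  then show ?thesis by (simp add: fejer_limit_def bounded_funI[of _ "cmod c"])
qed

lemma fejer_limit_add:
  assumes "fejer_limit f A" "fejer_limit g B"
  shows "fejer_limit (\<lambda>x. f x + g x) (A + B)"
  unfolding fejer_limit_def
proof (intro conjI allI impI)
  show "bounded_fun (\<lambda>x. f x + g x)" using assms by (simp add: fejer_limit_def bounded_fun_add)
  fix h assume h: "bounded_fun h"
  from tendsto_add[OF fejer_limitD[OF assms(1) h] fejer_limitD[OF assms(2) h]]
  show "(\<lambda>n. fejer n (\<lambda>x. h x * (f x + g x)) - fejer n h * (A + B)) \<longlonglongrightarrow> 0"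
    by (simp add: distrib_left fejer_add algebra_simps)
qed

lemma fejer_limit_mult:
  assumes f: "fejer_limit f A" and g: "fejer_limit g B"
  shows "fejer_limit (\<lambda>x. f x * g x) (A * B)"
  unfolding fejer_limit_def
proof (intro conjI allI impI)
  show "bounded_fun (\<lambda>x. f x * g x)" using assms by (simp add: fejer_limit_def bounded_fun_mult)
  fix h assume h: "bounded_fun h"
  then have hf: "bounded_fun (\<lambda>x. h x * f x)" using f by (simp add: fejer_limit_def bounded_fun_mult)
  have "(\<lambda>n. (fejer n (\<lambda>x. h x * f x * g x) - fejer n (\<lambda>x. h x * f x) * B)
     + (fejer n (\<lambda>x. h x * f x) - fejer n h * A) * B) \<longlonglongrightarrow> 0 + 0 * B"
    by (intro tendsto_intros fejer_limitD[OF g hf] fejer_limitD[OF f h])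
  then show "(\<lambda>n. fejer n (\<lambda>x. h x * (f x * g x)) - fejer n h * (A * B)) \<longlonglongrightarrow> 0"
    by (simp add: algebra_simps)
qed

lemma fejer_limit_cayley: "fejer_limit cayley U"
  unfolding fejer_limit_def
proof (intro conjI allI impI)
  show "bounded_fun cayley" by (rule bounded_funI[of _ 1]) simp
  fix g assume g: "bounded_fun g"
  obtain B where B: "B > 0" "\<And>x. cmod (g x) \<le> B" using bounded_funE[OF g] by blast
  show "(\<lambda>n. fejer n (\<lambda>x. g x * cayley x) - fejer n g * U) \<longlonglongrightarrow> 0"
  proof (rule Lim_null_comparison)
    show "\<forall>\<^sub>F n in sequentially. norm (fejer n (\<lambda>x. g x * cayley x) - fejer n g * U) \<le> B * (2 / sqrt (real (Suc n)))"
      by (intro always_eventually allI norm_fejer_shift_le B(2))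
    have "(\<lambda>n. B * (2 * sqrt (inverse (real (Suc n))))) \<longlonglongrightarrow> B * (2 * sqrt 0)"
      by (intro tendsto_intros LIMSEQ_inverse_real_of_nat)
    then show "(\<lambda>n. B * (2 / sqrt (real (Suc n)))) \<longlonglongrightarrow> 0"
      by (simp add: real_sqrt_inverse divide_inverse)
  qed
qed

text \<open>The statement for \<open>cayley\<close> is applied to \<open>g\<close> times
  \<open>cnj (cayley x)\<close>, and the result is multiplied by \<open>adj U\<close> from the
  right.\<close>

lemma fejer_limit_cnj_cayley: "fejer_limit (\<lambda>x. cnj (cayley x)) (adj U)"
  unfolding fejer_limit_def
proof (intro conjI allI impI)
  show "bounded_fun (\<lambda>x. cnj (cayley x))" by (rule bounded_funI[of _ 1]) simp
  fix g assume g: "bounded_fun g"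
  have "bounded_fun (\<lambda>x. g x * cnj (cayley x))"
    by (intro bounded_fun_mult g bounded_funI[of _ 1]) simp
  note lim = tendsto_minus[OF tendsto_mult_right[OF fejer_limitD[OF fejer_limit_cayley this], of "adj U"]]
  have "g x * cnj (cayley x) * cayley x = g x" for x by (simp add: mult.assoc)
  with lim show "(\<lambda>n. fejer n (\<lambda>x. g x * cnj (cayley x)) - fejer n g * adj U) \<longlonglongrightarrow> 0"
    by (simp add: left_diff_distrib mult.assoc[of _ U])
qed

text \<open>Fejer sums are contractive for the supremum, so the limits of the approximating
  functions form a Cauchy sequence; a three-term estimate then identifies its limit.\<close>

lemma fejer_limit_uniform_limit:
  assumes f: "bounded_fun f" and approx: "\<And>e. e > 0 \<Longrightarrow> \<exists>g A. fejer_limit g A \<and> (\<forall>x. cmod (f x - g x) \<le> e)"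
  shows "\<exists>A. fejer_limit f A"
proof -
  let ?e = "\<lambda>m. inverse (real (Suc m))"
  have "\<exists>g A. fejer_limit g A \<and> (\<forall>x. cmod (f x - g x) \<le> ?e m)" for m by (intro approx) simp
  then obtain g A where gA: "\<And>m. fejer_limit (g m) (A m)" "\<And>m x. cmod (f x - g m x) \<le> ?e m"
    by metis
  have diff: "norm (A m - A k) \<le> ?e m + ?e k" for m k
  proof (rule LIMSEQ_le_const2)
    show "(\<lambda>n. norm (fejer n (g m) - fejer n (g k))) \<longlonglongrightarrow> norm (A m - A k)"
      by (intro tendsto_intros fejer_limit_tendsto gA)
    have "norm (fejer n (\<lambda>x. g m x - g k x)) \<le> ?e m + ?e k" for n
    proof (rule norm_fejer_le)
      fix x
      have "cmod (g m x - g k x) = cmod ((f x - g k x) - (f x - g m x))" by simp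
      also have "\<dots> \<le> cmod (f x - g k x) + cmod (f x - g m x)" by (rule norm_triangle_ineq4)
      also have "\<dots> \<le> ?e m + ?e k" using gA(2)[of x k] gA(2)[of x m] by simp
      finally show "cmod (g m x - g k x) \<le> ?e m + ?e k" .
    qed
    then show "\<exists>N. \<forall>n\<ge>N. norm (fejer n (g m) - fejer n (g k)) \<le> ?e m + ?e k"
      by (simp add: fejer_diff)
  qed
  have "Cauchy A"
  proof (rule CauchyI)
    fix e :: real assume "e > 0"
    then obtain N where N: "?e N < e / 2" using reals_Archimedean[of "e / 2"] by auto
    have "norm (A m - A k) < e" if "m \<ge> N" "k \<ge> N" for m k
    proof -
      have "?e m \<le> ?e N" "?e k \<le> ?e N" using that by auto
      then show ?thesis using diff[of m k] N by linarith
    qed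
    then show "\<exists>N. \<forall>m\<ge>N. \<forall>k\<ge>N. norm (A m - A k) < e" by blast
  qed
  then obtain L where L: "A \<longlonglongrightarrow> L" by (auto simp: Cauchy_convergent_iff convergent_def)
  have "(\<lambda>n. fejer n (\<lambda>x. h x * f x) - fejer n h * L) \<longlonglongrightarrow> 0" if h: "bounded_fun h" for h
  proof -
    obtain B where B: "B > 0" "\<And>x. cmod (h x) \<le> B" using bounded_funE[OF h] by blast
    show ?thesis
    proof (rule LIMSEQ_I)
      fix e :: real assume e: "e > 0"
      then have e3: "e / (3 * B) > 0" using B by simp
      obtain N where N: "?e N < e / (3 * B)" using reals_Archimedean[OF e3] by auto
      obtain N' where N': "\<And>m. m \<ge> N' \<Longrightarrow> norm (A m - L) < e / (3 * B)"
        using LIMSEQ_D[OF L e3] by blast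
      define m where "m = max N N'"
      have m: "?e m < e / (3 * B)" "norm (A m - L) < e / (3 * B)"
        by (rule le_less_trans[OF _ N], simp add: m_def) (rule N', simp add: m_def)
      have "e / 3 > 0" using e by simp
      obtain K where K: "\<And>n. n \<ge> K \<Longrightarrow> norm (fejer n (\<lambda>x. h x * g m x) - fejer n h * A m - 0) < e / 3"
        using LIMSEQ_D[OF fejer_limitD[OF gA(1)[of m] h] \<open>e / 3 > 0\<close>] by blast
      have "norm (fejer n (\<lambda>x. h x * f x) - fejer n h * L - 0) < e" if "n \<ge> K" for n
      proof -
        have "norm (fejer n (\<lambda>x. h x * (f x - g m x))) \<le> B * ?e m"
          using B gA(2)[of _ m] by (intro norm_fejer_le) (auto simp: norm_mult intro!: mult_mono)
        also have "\<dots> < e / 3" using m(1) B by (simp add: field_simps)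
        finally have 1: "norm (fejer n (\<lambda>x. h x * (f x - g m x))) < e / 3" .
        have "norm (fejer n h * (A m - L)) \<le> norm (fejer n h) * norm (A m - L)" by (rule norm_mult_ineq)
        also have "\<dots> \<le> B * norm (A m - L)" by (intro mult_right_mono norm_fejer_le B) simp
        also have "\<dots> < e / 3" using m(2) B by (simp add: field_simps)
        finally have 2: "norm (fejer n h * (A m - L)) < e / 3" .
        have "fejer n (\<lambda>x. h x * f x) - fejer n h * L
          = fejer n (\<lambda>x. h x * (f x - g m x)) + (fejer n (\<lambda>x. h x * g m x) - fejer n h * A m) + fejer n h * (A m - L)"
          by (simp add: right_diff_distrib fejer_diff)
        then show ?thesis
          using 1 2 K[OF that]
            norm_triangle_ineq[of "fejer n (\<lambda>x. h x * (f x - g m x)) + (fejer n (\<lambda>x. h x * g m x) - fejer n h * A m)" "fejer n h * (A m - L)"]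
            norm_triangle_ineq[of "fejer n (\<lambda>x. h x * (f x - g m x))" "fejer n (\<lambda>x. h x * g m x) - fejer n h * A m"]
          by (simp only: diff_zero)
      qed
      then show "\<exists>K. \<forall>n\<ge>K. norm (fejer n (\<lambda>x. h x * f x) - fejer n h * L - 0) < e" by blast
    qed
  qed
  then show ?thesis using f by (auto simp: fejer_limit_def)
qed

lemma ex_fejer_limit:
  assumes "bounded_continuous f"
  shows "\<exists>A. fejer_limit (\<lambda>x. f x * (1 - cayley x)) A"
proof -
  have "(\<lambda>x. f x * (1 - cayley x)) \<in> {f. \<exists>A. fejer_limit f A}"
  proof (rule cayley_Stone_Weierstrass[OF _ _ _ _ _ _ assms])
    fix f :: "real \<Rightarrow> complex"
    assume "bounded_continuous f" "\<And>e. e > 0 \<Longrightarrow> \<exists>g\<in>{f. \<exists>A. fejer_limit f A}. \<forall>x. cmod (f x - g x) \<le> e"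
    then show "f \<in> {f. \<exists>A. fejer_limit f A}"
      using fejer_limit_uniform_limit[OF bounded_continuous_bounded_fun, of f] by blast
  qed (auto intro: fejer_limit_const fejer_limit_add fejer_limit_mult fejer_limit_cayley fejer_limit_cnj_cayley)
  then show ?thesis by simp
qed

section \<open>Strong limits of the Fejer sums\<close>

lemma tendsto_app: "X \<longlonglongrightarrow> (A :: 'h bop) \<Longrightarrow> (\<lambda>n. app (X n) v) \<longlonglongrightarrow> app A v"
  by (intro app.tendsto tendsto_const)

text \<open>The factor \<open>1 - cayley\<close> is moved from the function to the operator: it has
  a Fejer limit itself, with \<open>f\<close> in the role of the bounded test function.\<close>

lemma tendsto_fejer_range:
  assumes "bounded_continuous f" "fejer_limit (\<lambda>x. f x * (1 - cayley x)) A"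
  shows "(\<lambda>n. app (fejer n f) (app (1 - U) w)) \<longlonglongrightarrow> app A w"
proof -
  have "fejer_limit (\<lambda>x. 1 + (- 1) * cayley x) (1 *\<^sub>C 1 + ((- 1) *\<^sub>C 1) * U)"
    by (intro fejer_limit_add fejer_limit_mult fejer_limit_const fejer_limit_cayley)
  moreover have "1 *\<^sub>C 1 + ((- 1) *\<^sub>C 1) * U = 1 - U"
    by (rule bop_eqI) (simp add: app_simps)
  ultimately have "fejer_limit (\<lambda>x. 1 - cayley x) (1 - U)" by simp
  from fejer_limitD[OF this bounded_continuous_bounded_fun[OF assms(1)]]
  have "(\<lambda>n. fejer n (\<lambda>x. f x * (1 - cayley x)) - fejer n f * (1 - U)) \<longlonglongrightarrow> 0" .
  from tendsto_diff[OF fejer_limit_tendsto[OF assms(2)] this]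
  have "(\<lambda>n. fejer n f * (1 - U)) \<longlonglongrightarrow> A" by simp
  from tendsto_app[OF this, of w] show ?thesis by simp
qed

lemma dense_induct:
  assumes "\<And>w. P (app (1 - U) w)" "closed {x. P x}"
  shows "P x"
proof -
  have "closure (range (app (1 - U))) \<subseteq> {x. P x}"
    by (rule closure_minimal) (use assms in auto)
  then show ?thesis by (auto simp: dense)
qed

text \<open>Norm convergence may fail for \<open>f\<close> itself. Convergence on the dense range of
  \<open>1 - U\<close> and the uniform bound by \<open>B\<close> make the sums Cauchy on every
  vector.\<close>

lemma ex_fejer_strong_limit:
  assumes f: "bounded_continuous f"
  shows "\<exists>T. \<forall>x. (\<lambda>n. app (fejer n f) x) \<longlonglongrightarrow> app T x"
proof -
  obtain B where B: "B > 0" "\<And>x. cmod (f x) \<le> B"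
    using bounded_funE[OF bounded_continuous_bounded_fun[OF f]] by blast
  have bd: "norm (app (fejer n f) x) \<le> B * norm x" for n x
    by (rule order_trans[OF norm_app_le mult_right_mono[OF norm_fejer_le[OF B(2)] norm_ge_zero]])
  obtain A where A: "fejer_limit (\<lambda>x. f x * (1 - cayley x)) A" using ex_fejer_limit[OF f] by blast
  have "Cauchy (\<lambda>n. app (fejer n f) x)" for x
  proof (rule CauchyI)
    fix e :: real assume e: "e > 0"
    then have "e / (3 * B) > 0" using B by simp
    then obtain v where v: "v \<in> range (app (1 - U))" "dist v x < e / (3 * B)"
      using dense closure_approachable[of x "range (app (1 - U))"] by blast
    then obtain w where w: "norm (x - app (1 - U) w) < e / (3 * B)"
      by (auto simp: dist_norm norm_minus_commute)
    let ?v = "app (1 - U) w"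
    have "Cauchy (\<lambda>n. app (fejer n f) ?v)"
      using tendsto_fejer_range[OF f A] convergent_Cauchy convergent_def by blast
    then obtain M where M: "\<And>m n. m \<ge> M \<Longrightarrow> n \<ge> M \<Longrightarrow> norm (app (fejer m f) ?v - app (fejer n f) ?v) < e / 3"
      using CauchyD[of _ "e / 3"] e by (metis zero_less_divide_iff zero_less_numeral)
    have small: "norm (app (fejer n f) (x - ?v)) < e / 3" for n
    proof -
      have "norm (app (fejer n f) (x - ?v)) \<le> B * norm (x - ?v)" by (rule bd)
      also have "\<dots> < e / 3" using w B by (simp add: field_simps)
      finally show ?thesis .
    qed
    have "norm (app (fejer m f) x - app (fejer n f) x) < e" if "m \<ge> M" "n \<ge> M" for m n
    proof -
      have "app (fejer m f) x - app (fejer n f) x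
        = app (fejer m f) (x - ?v) + (app (fejer m f) ?v - app (fejer n f) ?v) - app (fejer n f) (x - ?v)"
        by (simp only: app.diff_right) simp
      also have "norm \<dots> \<le> norm (app (fejer m f) (x - ?v)) + norm (app (fejer m f) ?v - app (fejer n f) ?v)
         + norm (app (fejer n f) (x - ?v))"
        by (intro order_trans[OF norm_triangle_ineq4] add_right_mono norm_triangle_ineq)
      finally show ?thesis using M[OF that] small[of m] small[of n] by linarith
    qed
    then show "\<exists>M. \<forall>m\<ge>M. \<forall>n\<ge>M. norm (app (fejer m f) x - app (fejer n f) x) < e" by blast
  qed
  then have "\<forall>x. \<exists>y. (\<lambda>n. app (fejer n f) x) \<longlonglongrightarrow> y"
    by (simp add: Cauchy_convergent_iff convergent_def)
  from choice[OF this] obtain L where L: "\<And>x. (\<lambda>n. app (fejer n f) x) \<longlonglongrightarrow> L x" by blast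
  have "\<exists>T. \<forall>x. app T x = L x"
  proof (rule ex_bop)
    show "L (x + y) = L x + L y" for x y
      using LIMSEQ_unique[OF L[of "x + y"]] tendsto_add[OF L[of x] L[of y]] by (simp add: app_simps)
    show "L (c *\<^sub>C x) = c *\<^sub>C L x" for c x
      using LIMSEQ_unique[OF L[of "c *\<^sub>C x"]] scaleC.tendsto[OF tendsto_const L[of x], of c] by (simp add: app_simps)
    show "norm (L x) \<le> B * norm x" for x
      by (rule LIMSEQ_le_const2[OF tendsto_norm[OF L]]) (use bd in blast)
  qed
  then show ?thesis using L by metis
qed

definition calculus :: "(real \<Rightarrow> complex) \<Rightarrow> 'h bop" where
  "calculus f = (SOME T. \<forall>x. (\<lambda>n. app (fejer n f) x) \<longlonglongrightarrow> app T x)"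

lemma tendsto_calculus: "bounded_continuous f \<Longrightarrow> (\<lambda>n. app (fejer n f) x) \<longlonglongrightarrow> app (calculus f) x"
  using someI_ex[OF ex_fejer_strong_limit, of f] unfolding calculus_def by blast

lemma calculus_eqI:
  "bounded_continuous f \<Longrightarrow> (\<And>x. (\<lambda>n. app (fejer n f) x) \<longlonglongrightarrow> app T x) \<Longrightarrow> calculus f = T"
  by (intro bop_eqI LIMSEQ_unique[OF tendsto_calculus])

lemma calculus_range:
  assumes "bounded_continuous f" "fejer_limit (\<lambda>x. f x * (1 - cayley x)) A"
  shows "app (calculus f) (app (1 - U) w) = app A w"
  using LIMSEQ_unique[OF tendsto_calculus[OF assms(1)] tendsto_fejer_range[OF assms]] .

lemma calculus_fejer_limit: "bounded_continuous f \<Longrightarrow> fejer_limit f A \<Longrightarrow> calculus f = A"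
  by (intro calculus_eqI tendsto_app fejer_limit_tendsto)

text \<open>On the range of \<open>1 - U\<close> the factor \<open>f\<close> is replaced by the norm
  limit \<open>A\<close> of its product with \<open>1 - cayley\<close>. Only \<open>g\<close> then
  converges merely strongly, and it acts on the fixed vector \<open>app A w\<close>.\<close>

lemma calculus_mult:
  assumes f: "bounded_continuous f" and g: "bounded_continuous g"
    and gf: "bounded_continuous (\<lambda>x. g x * f x)"
  shows "calculus (\<lambda>x. g x * f x) = calculus g * calculus f"
proof (rule bop_eqI)
  fix x
  obtain A where A: "fejer_limit (\<lambda>x. f x * (1 - cayley x)) A" using ex_fejer_limit[OF f] by blast
  obtain C where C: "fejer_limit (\<lambda>x. g x * f x * (1 - cayley x)) C" using ex_fejer_limit[OF gf] by blast
  have "app (calculus (\<lambda>x. g x * f x)) (app (1 - U) w) = app (calculus g * calculus f) (app (1 - U) w)" for w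
  proof -
    have "(\<lambda>n. fejer n (\<lambda>x. g x * (f x * (1 - cayley x))) - fejer n g * A) \<longlonglongrightarrow> 0"
      by (rule fejer_limitD[OF A bounded_continuous_bounded_fun[OF g]])
    from tendsto_diff[OF fejer_limit_tendsto[OF C] this]
    have "(\<lambda>n. fejer n g * A) \<longlonglongrightarrow> C" by (simp add: mult.assoc)
    from LIMSEQ_unique[OF tendsto_app[OF this, of w]] tendsto_calculus[OF g, of "app A w"]
    have "app C w = app (calculus g) (app A w)" by simp
    then show ?thesis
      using calculus_range[OF gf C] calculus_range[OF f A] by simp
  qed
  then show "app (calculus (\<lambda>x. g x * f x)) x = app (calculus g * calculus f) x"
    by (rule dense_induct)
      (intro closed_Collect_eq linear_continuous_on app.bounded_linear_right)
qed

end

section \<open>Functional calculus of a selfadjoint operator\<close>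

lemma bounded_continuous_resolvent:
  assumes "Im z \<noteq> 0"
  shows "bounded_continuous (\<lambda>x. 1 / (complex_of_real x - z))"
proof (rule bounded_continuousI)
  show "isCont (\<lambda>x. 1 / (complex_of_real x - z)) x" for x
    using of_real_add_nonreal(2)[OF assms] by (intro continuous_intros) auto
  show "cmod (1 / (complex_of_real x - z)) \<le> 1 / \<bar>Im z\<bar>" for x
  proof -
    have "\<bar>Im z\<bar> \<le> cmod (complex_of_real x - z)"
      using abs_Im_le_cmod[of "complex_of_real x - z"] by simp
    then show ?thesis using assms by (simp add: norm_divide frac_le)
  qed
qed

locale selfadjoint_op =
  fixes S :: "'h::complex_hilbert set" and D :: "'h \<Rightarrow> 'h"
  assumes selfadjoint: "selfadjoint S D"
begin

lemma S_zero: "0 \<in> S" and S_add: "x \<in> S \<Longrightarrow> y \<in> S \<Longrightarrow> x + y \<in> S"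
  and S_scaleC: "x \<in> S \<Longrightarrow> c *\<^sub>C x \<in> S" and S_dense: "closure S = UNIV"
  and D_add: "x \<in> S \<Longrightarrow> y \<in> S \<Longrightarrow> D (x + y) = D x + D y"
  and D_scaleC: "x \<in> S \<Longrightarrow> D (c *\<^sub>C x) = c *\<^sub>C D x"
  and symmetric: "x \<in> S \<Longrightarrow> y \<in> S \<Longrightarrow> cinner (D x) y = cinner x (D y)"
  using selfadjoint unfolding selfadjoint_def densely_defined_def csubspace_def clinear_on_def by auto

lemma S_diff: "x \<in> S \<Longrightarrow> y \<in> S \<Longrightarrow> x - y \<in> S"
  using S_add[of x "(- 1) *\<^sub>C y"] S_scaleC[of y "- 1"] by simp

lemma D_diff: "x \<in> S \<Longrightarrow> y \<in> S \<Longrightarrow> D (x - y) = D x - D y"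
  using D_add[of x "(- 1) *\<^sub>C y"] D_scaleC[of y "- 1"] S_scaleC[of y "- 1"] by simp

lemma dense_ext:
  assumes "continuous_on UNIV f" "continuous_on UNIV g" "\<And>x. x \<in> S \<Longrightarrow> f x = g x"
  shows "f y = (g y :: 'b::t2_space)"
proof -
  have "closure S \<subseteq> {x. f x = g x}"
    by (rule closure_minimal) (use assms in \<open>auto intro: closed_Collect_eq\<close>)
  then show ?thesis by (auto simp: S_dense)
qed

lemma cinner_S_ext: "(\<And>x. x \<in> S \<Longrightarrow> cinner y x = cinner z x) \<Longrightarrow> y = z"
  by (rule cinner_ext_left, rule dense_ext)
    (auto intro: linear_continuous_on cinner.bounded_linear_right)

lemma bop_S_ext: "(\<And>x. x \<in> S \<Longrightarrow> app A x = app B x) \<Longrightarrow> A = B"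
  by (rule bop_eqI, rule dense_ext) (auto intro: linear_continuous_on app.bounded_linear_right)

text \<open>Equality of \<open>D\<close> with its adjoint as a test for membership in
  \<open>S\<close>: closedness of the graph, surjectivity of \<open>D - z\<close> and invariance of
  \<open>S\<close> under adjoints rest on it.\<close>

lemma adjoint_domainI:
  assumes "\<And>x. x \<in> S \<Longrightarrow> cinner y (D x) = cinner z x"
  shows "y \<in> S" "D y = z"
proof -
  have "y \<in> adjoint_domain S D" using assms by (auto simp: adjoint_domain_def)
  then show y: "y \<in> S" using selfadjoint by (simp add: selfadjoint_def)
  show "D y = z" by (rule cinner_S_ext) (simp add: symmetric y assms)
qed

text \<open>For these imaginary \<open>z\<close> the cross terms cancel by symmetry. The identity
  yields injectivity, closed range and the norm bound of the resolvent.\<close>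

lemma norm_shift:
  assumes x: "x \<in> S" and z: "z = \<i> \<or> z = - \<i>"
  shows "(norm (D x - z *\<^sub>C x))\<^sup>2 = (norm (D x))\<^sup>2 + (norm x)\<^sup>2"
proof -
  have zz: "cnj z = - z" "z * (z * c) = - c" for c
    using z by (auto simp: complex_eq_iff)
  have "cinner (D x - z *\<^sub>C x) (D x - z *\<^sub>C x) = cinner (D x) (D x) + cinner x x"
    by (simp add: zz symmetric[OF x x] cinner.diff_left cinner.diff_right cinner_scaleC_left
        cinner_scaleC_right right_diff_distrib distrib_left)
  then show ?thesis
    unfolding cinner_self by (simp only: of_real_add[symmetric] of_real_eq_iff)
qed

lemma closed_graph:
  assumes "\<And>n. x n \<in> S" "x \<longlonglongrightarrow> l" "(\<lambda>n. D (x n)) \<longlonglongrightarrow> w"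
  shows "l \<in> S" "D l = w"
proof -
  have "cinner l (D y) = cinner w y" if "y \<in> S" for y
  proof (rule LIMSEQ_unique)
    show "(\<lambda>n. cinner (x n) (D y)) \<longlonglongrightarrow> cinner l (D y)" by (intro cinner.tendsto tendsto_const assms)
    have "(\<lambda>n. cinner (D (x n)) y) \<longlonglongrightarrow> cinner w y" by (intro cinner.tendsto tendsto_const assms)
    then show "(\<lambda>n. cinner (x n) (D y)) \<longlonglongrightarrow> cinner w y" using symmetric[OF assms(1) that] by simp
  qed
  then show "l \<in> S" "D l = w" using adjoint_domainI[of l w] by auto
qed

text \<open>The range is closed since \<open>norm_shift\<close> controls both \<open>x\<close> and
  \<open>D x\<close> and the graph is closed. A vector orthogonal to the range lies in the domain of
  the adjoint, that is in \<open>S\<close>, and is an eigenvector for \<open>cnj z\<close>;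
  \<open>norm_shift\<close> forces it to vanish.\<close>

lemma surj_shift:
  assumes z: "z = \<i> \<or> z = - \<i>"
  shows "\<exists>x\<in>S. D x - z *\<^sub>C x = v"
proof -
  let ?L = "\<lambda>x. D x - z *\<^sub>C x"
  have L_diff: "?L x - ?L y = ?L (x - y)" if "x \<in> S" "y \<in> S" for x y
    using that by (simp add: D_diff scaleC_diff_right)
  have Lx: "norm x \<le> norm (?L x)" "norm (D x) \<le> norm (?L x)" if "x \<in> S" for x
    by (rule power2_le_imp_le; simp add: norm_shift[OF that z])+
  have cl: "closed (?L ` S)"
    unfolding closed_sequential_limits
  proof (intro allI impI, elim conjE)
    fix y l assume y: "\<forall>n. y n \<in> ?L ` S" and l: "y \<longlonglongrightarrow> l"
    then have "\<forall>n. \<exists>x. x \<in> S \<and> y n = ?L x" by blast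
    from choice[OF this] obtain x where x: "\<And>n. x n \<in> S" "\<And>n. y n = ?L (x n)" by blast
    have "Cauchy y" using l convergent_Cauchy convergent_def by blast
    have bd: "norm (x m - x n) \<le> norm (y m - y n)" "norm (D (x m) - D (x n)) \<le> norm (y m - y n)" for m n
      using Lx[OF S_diff[OF x(1)[of m] x(1)[of n]]] by (simp_all add: x(2) L_diff[OF x(1) x(1)] D_diff[OF x(1) x(1)])
    have "Cauchy a" if a: "\<And>m n. norm (a m - a n) \<le> norm (y m - y n)" for a :: "nat \<Rightarrow> 'h"
    proof (rule CauchyI)
      fix e :: real assume "e > 0"
      then obtain N where "\<forall>m\<ge>N. \<forall>n\<ge>N. norm (y m - y n) < e" using CauchyD[OF \<open>Cauchy y\<close>] by blast
      then have "\<forall>m\<ge>N. \<forall>n\<ge>N. norm (a m - a n) < e" by (meson a le_less_trans)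
      then show "\<exists>N. \<forall>m\<ge>N. \<forall>n\<ge>N. norm (a m - a n) < e" by blast
    qed
    from this[OF bd(1)] this[OF bd(2)] have "Cauchy x" "Cauchy (\<lambda>n. D (x n))" .
    then obtain a w where aw: "x \<longlonglongrightarrow> a" "(\<lambda>n. D (x n)) \<longlonglongrightarrow> w"
      by (auto simp: Cauchy_convergent_iff convergent_def)
    have "y \<longlonglongrightarrow> w - z *\<^sub>C a"
      unfolding x(2) by (intro tendsto_diff scaleC.tendsto tendsto_const aw)
    from LIMSEQ_unique[OF l this] have "l = ?L a" by (simp add: closed_graph[OF x(1) aw])
    moreover have "a \<in> S" by (rule closed_graph[OF x(1) aw])
    ultimately show "l \<in> ?L ` S" by blast
  qed
  have "csubspace (?L ` S)"
    unfolding csubspace_def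
  proof (intro conjI ballI allI)
    have "0 = ?L 0" using D_scaleC[OF S_zero, of 0] by simp
    then show "0 \<in> ?L ` S" using S_zero by (rule image_eqI)
  next
    fix a b assume "a \<in> ?L ` S" "b \<in> ?L ` S"
    then obtain x y where xy: "x \<in> S" "y \<in> S" "a = ?L x" "b = ?L y" by blast
    then have "a + b = ?L (x + y)" by (simp add: D_add scaleC_add_right)
    then show "a + b \<in> ?L ` S" using S_add xy by blast
  next
    fix c a assume "a \<in> ?L ` S"
    then obtain x where x: "x \<in> S" "a = ?L x" by blast
    then have "c *\<^sub>C a = ?L (c *\<^sub>C x)"
      by (simp add: D_scaleC scaleC_diff_right scaleC_scaleC mult.commute)
    then show "c *\<^sub>C a \<in> ?L ` S" using S_scaleC x by blast
  qed
  have "v \<in> ?L ` S"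
  proof (rule ccontr)
    assume "v \<notin> ?L ` S"
    with cl \<open>csubspace (?L ` S)\<close> obtain y where y: "y \<noteq> 0" "\<And>m. m \<in> ?L ` S \<Longrightarrow> cinner y m = 0"
      by (metis orthogonal_vector)
    have "cinner y (D x) = cinner (cnj z *\<^sub>C y) x" if "x \<in> S" for x
      using y(2)[of "?L x"] that by (simp add: cinner.diff_right cinner_scaleC_right cinner_scaleC_left)
    from adjoint_domainI[OF this] have "y \<in> S" "D y = cnj z *\<^sub>C y" by auto
    moreover have "cnj z = \<i> \<or> cnj z = - \<i>" using z by auto
    ultimately show False
      using norm_shift[of y "cnj z"] y(1) by (simp add: sum_power2_eq_zero_iff)
  qed
  then show ?thesis by blast
qed

lemma ex_resolvent:
  assumes z: "z = \<i> \<or> z = - \<i>"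
  shows "\<exists>R. is_resolvent S D z R"
proof -
  have "\<forall>v. \<exists>x. x \<in> S \<and> D x - z *\<^sub>C x = v" using surj_shift[OF z] by blast
  from choice[OF this] obtain f where f: "\<And>v. f v \<in> S" "\<And>v. D (f v) - z *\<^sub>C f v = v" by blast
  have inj: "x = y" if xy: "x \<in> S" "y \<in> S" "D x - z *\<^sub>C x = D y - z *\<^sub>C y" for x y
  proof -
    have "D (x - y) - z *\<^sub>C (x - y) = (D x - z *\<^sub>C x) - (D y - z *\<^sub>C y)"
      by (simp add: D_diff xy(1,2) scaleC_diff_right)
    also have "\<dots> = 0" using xy(3) by simp
    finally have "D (x - y) - z *\<^sub>C (x - y) = 0" .
    then show ?thesis using norm_shift[OF S_diff[OF xy(1,2)] z] by (simp add: sum_power2_eq_zero_iff)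
  qed
  have "\<exists>R. \<forall>v. app R v = f v"
  proof (rule ex_bop)
    show "f (u + v) = f u + f v" for u v
    proof (rule inj)
      show "D (f (u + v)) - z *\<^sub>C f (u + v) = D (f u + f v) - z *\<^sub>C (f u + f v)"
        using f(2)[of u] f(2)[of v] f(2)[of "u + v"] f(1) by (simp add: D_add scaleC_add_right add_diff_add)
    qed (intro S_add f)+
    show "f (c *\<^sub>C v) = c *\<^sub>C f v" for c v
    proof (rule inj)
      have "D (c *\<^sub>C f v) - z *\<^sub>C c *\<^sub>C f v = c *\<^sub>C (D (f v) - z *\<^sub>C f v)"
        using f(1) by (simp add: D_scaleC scaleC_diff_right scaleC_scaleC mult.commute)
      then show "D (f (c *\<^sub>C v)) - z *\<^sub>C f (c *\<^sub>C v) = D (c *\<^sub>C f v) - z *\<^sub>C c *\<^sub>C f v"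
        by (simp add: f)
    qed (intro S_scaleC f)+
    show "norm (f v) \<le> 1 * norm v" for v
      using norm_shift[OF f(1)[of v] z] by (auto intro: power2_le_imp_le simp: f)
  qed
  then obtain R where R: "\<And>v. app R v = f v" by blast
  have "is_resolvent S D z R"
    unfolding is_resolvent_def R using f inj by blast
  then show ?thesis by blast
qed

definition R :: "'h bop" where "R = (SOME R. is_resolvent S D (- \<i>) R)"
definition R' :: "'h bop" where "R' = (SOME R. is_resolvent S D \<i> R)"

lemma is_resolvent_R: "is_resolvent S D (- \<i>) R"
  unfolding R_def by (rule someI_ex, rule ex_resolvent) simp

lemma is_resolvent_R': "is_resolvent S D \<i> R'"
  unfolding R'_def by (rule someI_ex, rule ex_resolvent) simp

lemma R_S: "app R v \<in> S" and D_R: "D (app R v) + \<i> *\<^sub>C app R v = v"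
  and R_D: "x \<in> S \<Longrightarrow> app R (D x + \<i> *\<^sub>C x) = x"
  using is_resolvent_R by (auto simp: is_resolvent_def)

lemma R'_S: "app R' v \<in> S" and D_R': "D (app R' v) - \<i> *\<^sub>C app R' v = v"
  and R'_D: "x \<in> S \<Longrightarrow> app R' (D x - \<i> *\<^sub>C x) = x"
  using is_resolvent_R' by (auto simp: is_resolvent_def)

lemma is_resolvent_unique: "is_resolvent S D z A \<Longrightarrow> is_resolvent S D z B \<Longrightarrow> A = B"
  unfolding is_resolvent_def by (metis bop_eqI)

lemma range_R: "range (app R) = S"
  using R_S R_D by (auto simp: image_iff) metis

lemma adj_R: "adj R = R'"
proof (rule adj_eqI, unfold is_adjoint_def, intro allI)
  fix x y
  have "cinner (app R' x) y = cinner (app R' x) (D (app R y) + \<i> *\<^sub>C app R y)"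
    by (simp add: D_R)
  also have "\<dots> = cinner (D (app R' x) - \<i> *\<^sub>C app R' x) (app R y)"
    by (simp add: cinner_add_right cinner.diff_left cinner_scaleC_left cinner_scaleC_right symmetric R_S R'_S)
  finally show "cinner (app R' x) y = cinner x (app R y)" by (simp add: D_R')
qed

text \<open>The Cayley transform, D - i times the inverse of D + i, written so that it is visibly
  bounded and \<open>1 - U\<close> is a multiple of \<open>R\<close>, hence has range
  \<open>S\<close>.\<close>

definition U :: "'h bop" where "U = 1 - (2 * \<i>) *\<^sub>C R"

lemma app_U: "app U v = D (app R v) - \<i> *\<^sub>C app R v"
proof -
  have "app U v = (D (app R v) + \<i> *\<^sub>C app R v) - (2 * \<i>) *\<^sub>C app R v"
    by (simp add: U_def app_simps D_R)
  also have "(2 * \<i>) *\<^sub>C app R v = \<i> *\<^sub>C app R v + \<i> *\<^sub>C app R v"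
    by (simp flip: scaleC_add_left)
  finally show ?thesis by simp
qed

lemma app_adj_U: "app (adj U) v = D (app R' v) + \<i> *\<^sub>C app R' v"
proof -
  have "adj U = 1 + (2 * \<i>) *\<^sub>C R'"
    by (rule adj_eqI) (simp add: is_adjoint_def U_def app_simps cinner.diff_right cinner_add_left
        cinner_scaleC_left cinner_scaleC_right adj_R[symmetric] cinner_adj_left)
  then have "app (adj U) v = (D (app R' v) - \<i> *\<^sub>C app R' v) + (2 * \<i>) *\<^sub>C app R' v"
    by (simp add: app_simps D_R')
  also have "(2 * \<i>) *\<^sub>C app R' v = \<i> *\<^sub>C app R' v + \<i> *\<^sub>C app R' v"
    by (simp flip: scaleC_add_left)
  finally show ?thesis by simp
qed

sublocale unitary_op U
proof
  show "adj U * U = 1"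
    by (rule bop_eqI) (simp add: app_U app_adj_U R'_D[OF R_S] D_R)
  show "U * adj U = 1"
    by (rule bop_eqI) (simp add: app_U app_adj_U R_D[OF R'_S] D_R')
  have "1 - U = (2 * \<i>) *\<^sub>C R" by (simp add: U_def)
  then have eq: "app R v = app (1 - U) ((1 / (2 * \<i>)) *\<^sub>C v)" for v
    by (simp add: app_simps scaleC_scaleC)
  have "S \<subseteq> range (app (1 - U))"
  proof
    fix x assume "x \<in> S"
    then have "x = app (1 - U) ((1 / (2 * \<i>)) *\<^sub>C (D x + \<i> *\<^sub>C x))"
      unfolding eq[symmetric] by (simp add: R_D)
    then show "x \<in> range (app (1 - U))" by (rule range_eqI)
  qed
  then have "closure S \<subseteq> closure (range (app (1 - U)))" by (rule closure_mono)
  then show "closure (range (app (1 - U))) = UNIV" unfolding S_dense by blast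
qed

text \<open>The function is affine in \<open>cayley\<close>, so its Fejer sums converge in norm and
  the limit can be read off from the definition of \<open>U\<close>.\<close>

lemma calculus_R: "calculus (\<lambda>x. 1 / (complex_of_real x + \<i>)) = R"
proof -
  let ?c = "1 / (2 * \<i>)"
  have "fejer_limit (\<lambda>x. ?c + (- ?c) * cayley x) (?c *\<^sub>C 1 + ((- ?c) *\<^sub>C 1) * U)"
    by (intro fejer_limit_add fejer_limit_mult fejer_limit_const fejer_limit_cayley)
  moreover have "?c + (- ?c) * cayley x = 1 / (complex_of_real x + \<i>)" for x
  proof -
    have "?c + (- ?c) * cayley x = ?c * (1 - cayley x)" by (simp add: right_diff_distrib)
    then show ?thesis by (simp add: one_minus_cayley)
  qed
  moreover have "?c *\<^sub>C 1 + ((- ?c) *\<^sub>C 1) * U = R"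
  proof (rule bop_eqI)
    fix x
    have "app (?c *\<^sub>C 1 + ((- ?c) *\<^sub>C 1) * U) x = ?c *\<^sub>C (2 * \<i>) *\<^sub>C app R x"
      by (simp add: U_def app_simps scaleC_diff_right scaleC_scaleC)
    then show "app (?c *\<^sub>C 1 + ((- ?c) *\<^sub>C 1) * U) x = app R x"
      by (simp add: scaleC_scaleC)
  qed
  ultimately have "fejer_limit (\<lambda>x. 1 / (complex_of_real x + \<i>)) R" by (simp only:)
  moreover have "bounded_continuous (\<lambda>x. 1 / (complex_of_real x + \<i>))"
    using bounded_continuous_resolvent[of "- \<i>"] by simp
  ultimately show ?thesis by (intro calculus_fejer_limit)
qed

lemma calculus_add:
  assumes "bounded_continuous f" "bounded_continuous g"
  shows "calculus (\<lambda>x. f x + g x) = calculus f + calculus g"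
  by (rule calculus_eqI[OF bounded_continuous_add[OF assms]])
    (simp add: fejer_add app.add_left tendsto_add tendsto_calculus assms)

lemma calculus_scale:
  assumes "bounded_continuous f"
  shows "calculus (\<lambda>x. c * f x) = c *\<^sub>C calculus f"
  by (rule calculus_eqI[OF bounded_continuous_mult[OF bounded_continuous_const assms]])
    (simp add: fejer_scale scaleC.tendsto[OF tendsto_const] tendsto_calculus assms)

lemma calculus_one: "calculus (\<lambda>x. 1) = 1"
  by (rule calculus_eqI[OF bounded_continuous_const]) (simp add: fejer_one)

text \<open>The resolvent identity against the function for \<open>R\<close>, with the product
  written in either order. \<open>F1\<close> puts the values in the range of \<open>R\<close>, thus
  in \<open>S\<close>, and gives the right inverse; \<open>F2\<close> gives the left
  inverse.\<close>

lemma calculus_resolvent: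
  assumes z: "Im z \<noteq> 0"
  shows "is_resolvent S D z (calculus (\<lambda>x. 1 / (complex_of_real x - z)))"
proof -
  let ?h = "\<lambda>x. 1 / (complex_of_real x + \<i>)" and ?f = "\<lambda>x. 1 / (complex_of_real x - z)"
  have h: "bounded_continuous ?h" using bounded_continuous_resolvent[of "- \<i>"] by simp
  have f: "bounded_continuous ?f" by (rule bounded_continuous_resolvent[OF z])
  have hf: "bounded_continuous (\<lambda>x. ?h x * ?f x)" and fh: "bounded_continuous (\<lambda>x. ?f x * ?h x)"
    by (intro bounded_continuous_mult h f)+
  let ?F = "calculus ?f"
  have eq: "?f x = ?h x + (z + \<i>) * (?h x * ?f x)" "?f x = ?h x + (z + \<i>) * (?f x * ?h x)" for x
  proof -
    have nz: "complex_of_real x + \<i> \<noteq> 0" "complex_of_real x - z \<noteq> 0"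
      using of_real_add_nonreal(2)[OF z] by auto
    have "1 / a + (a - b) * (1 / a * (1 / b)) = 1 / b" if "a \<noteq> 0" "b \<noteq> 0" for a b :: complex
      using that by (simp add: field_simps)
    from this[OF nz] show "?f x = ?h x + (z + \<i>) * (?h x * ?f x)" by (simp add: add.commute)
    then show "?f x = ?h x + (z + \<i>) * (?f x * ?h x)" by (simp only: mult.commute)
  qed
  have "?F = calculus (\<lambda>x. ?h x + (z + \<i>) * (?h x * ?f x))" by (simp only: eq(1)[symmetric])
  also have "\<dots> = R + (z + \<i>) *\<^sub>C (R * ?F)"
    by (subst calculus_add[OF h bounded_continuous_mult[OF bounded_continuous_const hf]])
      (simp only: calculus_scale[OF hf] calculus_mult[OF f h hf] calculus_R)
  finally have F1: "?F = R + (z + \<i>) *\<^sub>C (R * ?F)" .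
  have "?F = calculus (\<lambda>x. ?h x + (z + \<i>) * (?f x * ?h x))" by (simp only: eq(2)[symmetric])
  also have "\<dots> = R + (z + \<i>) *\<^sub>C (?F * R)"
    by (subst calculus_add[OF h bounded_continuous_mult[OF bounded_continuous_const fh]])
      (simp only: calculus_scale[OF fh] calculus_mult[OF h f fh] calculus_R)
  finally have F2: "?F = R + (z + \<i>) *\<^sub>C (?F * R)" .
  show ?thesis
    unfolding is_resolvent_def
  proof (intro conjI allI ballI)
    fix v
    let ?w = "v + (z + \<i>) *\<^sub>C app ?F v"
    have "app ?F v = app (R + (z + \<i>) *\<^sub>C (R * ?F)) v" using F1 by simp
    also have "\<dots> = app R ?w" by (simp add: app_simps)
    finally have v: "app ?F v = app R ?w" .
    show "app ?F v \<in> S" by (rule ssubst[OF v]) (rule R_S)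
    have "D (app ?F v) + \<i> *\<^sub>C app ?F v = ?w" using D_R[of ?w] by (simp only: v[symmetric])
    then show "D (app ?F v) - z *\<^sub>C app ?F v = v"
      by (simp add: scaleC_add_left algebra_simps)
  next
    fix x assume x: "x \<in> S"
    define w where "w = D x + \<i> *\<^sub>C x"
    have Rw: "app R w = x" unfolding w_def by (rule R_D[OF x])
    have "D x - z *\<^sub>C x = w - (z + \<i>) *\<^sub>C x" by (simp add: w_def scaleC_add_left)
    then have "app ?F (D x - z *\<^sub>C x) = app ?F w - (z + \<i>) *\<^sub>C app ?F x" by (simp add: app_simps)
    also have "app ?F w = app (R + (z + \<i>) *\<^sub>C (?F * R)) w" using F2 by simp
    also have "\<dots> = x + (z + \<i>) *\<^sub>C app ?F x" by (simp add: app_simps Rw)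
    finally show "app ?F (D x - z *\<^sub>C x) = x" by simp
  qed
qed

lemma functional_calculus_calculus: "functional_calculus S D calculus"
  unfolding functional_calculus_def
proof (intro conjI allI impI)
  fix f g assume fg: "bounded_continuous f" "bounded_continuous g"
  show "calculus (\<lambda>x. f x + g x) = calculus f + calculus g" by (rule calculus_add[OF fg])
  show "calculus (\<lambda>x. f x * g x) = calculus f * calculus g"
    by (rule calculus_mult[OF fg(2,1) bounded_continuous_mult[OF fg]])
next
  fix f assume f: "bounded_continuous f"
  show "calculus (\<lambda>x. c * f x) = c *\<^sub>C calculus f" for c by (rule calculus_scale[OF f])
  show "is_adjoint (calculus f) (calculus (\<lambda>x. cnj (f x)))"
    unfolding is_adjoint_def
  proof (intro allI, rule LIMSEQ_unique)
    fix x y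
    show "(\<lambda>n. cinner (app (fejer n (\<lambda>x. cnj (f x))) x) y) \<longlonglongrightarrow> cinner (app (calculus (\<lambda>x. cnj (f x))) x) y"
      by (intro cinner.tendsto tendsto_const tendsto_calculus bounded_continuous_cnj f)
    show "(\<lambda>n. cinner (app (fejer n (\<lambda>x. cnj (f x))) x) y) \<longlonglongrightarrow> cinner x (app (calculus f) y)"
      unfolding fejer_adjoint by (intro cinner.tendsto tendsto_const tendsto_calculus f)
  qed
qed (auto intro: calculus_one calculus_resolvent)

end

section \<open>Contractivity and uniqueness of an arbitrary functional calculus\<close>

lemma functional_calculusD:
  assumes "functional_calculus S D \<Phi>"
  shows functional_calculus_add: "\<And>f g. bounded_continuous f \<Longrightarrow> bounded_continuous g \<Longrightarrow> \<Phi> (\<lambda>x. f x + g x) = \<Phi> f + \<Phi> g"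
    and functional_calculus_mult: "\<And>f g. bounded_continuous f \<Longrightarrow> bounded_continuous g \<Longrightarrow> \<Phi> (\<lambda>x. f x * g x) = \<Phi> f * \<Phi> g"
    and functional_calculus_scale: "\<And>c f. bounded_continuous f \<Longrightarrow> \<Phi> (\<lambda>x. c * f x) = c *\<^sub>C \<Phi> f"
    and functional_calculus_adjoint: "\<And>f. bounded_continuous f \<Longrightarrow> is_adjoint (\<Phi> f) (\<Phi> (\<lambda>x. cnj (f x)))"
    and functional_calculus_one: "\<Phi> (\<lambda>x. 1) = 1"
    and functional_calculus_resolvent: "\<And>z. Im z \<noteq> 0 \<Longrightarrow> is_resolvent S D z (\<Phi> (\<lambda>x. 1 / (complex_of_real x - z)))"
  using assms unfolding functional_calculus_def by blast+

text \<open>The squared modulus of \<open>f\<close> subtracted from that of \<open>c\<close> has a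
  real continuous root \<open>g\<close>. Applying the calculus to this identity shows that the
  squared norms of the images of \<open>v\<close> under \<open>\<Phi> g\<close> and
  \<open>\<Phi> f\<close> add up to the square of \<open>c * norm v\<close>.\<close>

lemma norm_functional_calculus_le:
  fixes \<Phi> :: "(real \<Rightarrow> complex) \<Rightarrow> 'h::complex_hilbert bop"
  assumes \<Phi>: "functional_calculus S D \<Phi>" and f: "bounded_continuous f"
    and c: "\<And>x. cmod (f x) \<le> c"
  shows "norm (\<Phi> f) \<le> c"
proof (rule norm_bop_le)
  show c0: "0 \<le> c" using c norm_ge_zero order_trans by blast
  fix v
  define g where "g = (\<lambda>x. complex_of_real (sqrt (c\<^sup>2 - (cmod (f x))\<^sup>2)))"
  have nonneg: "0 \<le> c\<^sup>2 - (cmod (f x))\<^sup>2" for x using c[of x] by (simp add: power_mono)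
  have g: "bounded_continuous g"
  proof (rule bounded_continuousI)
    show "isCont g x" for x
      unfolding g_def by (intro continuous_intros bounded_continuous_isCont f)
    have "sqrt (c\<^sup>2 - (cmod (f x))\<^sup>2) \<le> sqrt (c\<^sup>2)" for x by (rule real_sqrt_le_mono) simp
    then show "cmod (g x) \<le> c" for x using c0 nonneg[of x] by (simp add: g_def)
  qed
  have cn: "bounded_continuous (\<lambda>x. cnj (f x))" by (rule bounded_continuous_cnj[OF f])
  have "g x * g x + cnj (f x) * f x = complex_of_real (c\<^sup>2) * 1" for x
  proof -
    have "g x * g x = complex_of_real (c\<^sup>2 - (cmod (f x))\<^sup>2)"
      unfolding g_def of_real_mult[symmetric] using nonneg[of x] by simp
    moreover have "cnj (f x) * f x = complex_of_real ((cmod (f x))\<^sup>2)"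
      by (simp only: complex_norm_square mult.commute)
    ultimately show ?thesis by (simp flip: of_real_add)
  qed
  then have "\<Phi> (\<lambda>x. g x * g x + cnj (f x) * f x) = \<Phi> (\<lambda>x. complex_of_real (c\<^sup>2) * 1)" by simp
  also have "\<dots> = complex_of_real (c\<^sup>2) *\<^sub>C 1"
    by (simp only: functional_calculus_scale[OF \<Phi> bounded_continuous_const] functional_calculus_one[OF \<Phi>])
  finally have sum: "\<Phi> g * \<Phi> g + \<Phi> (\<lambda>x. cnj (f x)) * \<Phi> f = complex_of_real (c\<^sup>2) *\<^sub>C 1"
    using f g cn by (simp only: functional_calculus_add[OF \<Phi>] functional_calculus_mult[OF \<Phi>]
        bounded_continuous_mult)
  have adj: "cinner v (app (\<Phi> (\<lambda>x. cnj (f x))) w) = cinner (app (\<Phi> f) v) w" for w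
    using adj_eqI[OF functional_calculus_adjoint[OF \<Phi> f]] cinner_adj_right by metis
  have "cnj (g x) = g x" for x by (simp add: g_def)
  then have "adj (\<Phi> g) = \<Phi> g" using adj_eqI[OF functional_calculus_adjoint[OF \<Phi> g]] by simp
  then have adjg: "cinner v (app (\<Phi> g) w) = cinner (app (\<Phi> g) v) w" for w
    using cinner_adj_right by metis
  have "cinner v (app (\<Phi> g * \<Phi> g + \<Phi> (\<lambda>x. cnj (f x)) * \<Phi> f) v)
     = complex_of_real ((norm (app (\<Phi> g) v))\<^sup>2 + (norm (app (\<Phi> f) v))\<^sup>2)"
    by (simp add: app_simps cinner_add_right adj adjg cinner_self)
  moreover have "cinner v (app (complex_of_real (c\<^sup>2) *\<^sub>C 1) v) = complex_of_real (c\<^sup>2 * (norm v)\<^sup>2)"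
    by (simp add: cinner_scaleC_right cinner_self)
  ultimately have "(norm (app (\<Phi> g) v))\<^sup>2 + (norm (app (\<Phi> f) v))\<^sup>2 = (c * norm v)\<^sup>2"
    unfolding sum power_mult_distrib by (simp only: of_real_eq_iff)
  then have "(norm (app (\<Phi> f) v))\<^sup>2 \<le> (c * norm v)\<^sup>2" by (smt (verit) zero_le_power2)
  then show "norm (app (\<Phi> f) v) \<le> c * norm v" by (rule power2_le_imp_le) (simp add: c0)
qed

lemma functional_calculus_diff:
  assumes \<Phi>: "functional_calculus S D \<Phi>" and f: "bounded_continuous f" and g: "bounded_continuous g"
  shows "\<Phi> (\<lambda>x. f x - g x) = \<Phi> f - \<Phi> g"
proof -
  have "\<Phi> (\<lambda>x. f x + (- 1) * g x) = \<Phi> f + (- 1) *\<^sub>C \<Phi> g"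
    by (simp only: functional_calculus_add[OF \<Phi> f bounded_continuous_mult[OF bounded_continuous_const g]]
        functional_calculus_scale[OF \<Phi> g])
  then show ?thesis by simp
qed

context selfadjoint_op
begin

text \<open>The class \<open>E\<close> of agreement contains the resolvents and is closed under
  uniform limits by contractivity. Stone-Weierstrass gives agreement on the product of
  \<open>f\<close> with \<open>1 - cayley\<close>; the second factor maps to a multiple of
  \<open>R\<close>, whose dense range allows it to be cancelled.\<close>

lemma functional_calculus_unique:
  assumes \<Phi>: "functional_calculus S D \<Phi>" and \<Psi>: "functional_calculus S D \<Psi>" and f: "bounded_continuous f"
  shows "\<Phi> f = \<Psi> f"
proof -
  define E where "E = {f. bounded_continuous f \<and> \<Phi> f = \<Psi> f}"
  have const: "(\<lambda>x. c) \<in> E" for c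
    using functional_calculus_scale[OF \<Phi> bounded_continuous_const, of c 1]
      functional_calculus_scale[OF \<Psi> bounded_continuous_const, of c 1]
    by (simp add: E_def bounded_continuous_const functional_calculus_one[OF \<Phi>] functional_calculus_one[OF \<Psi>])
  have add: "(\<lambda>x. f x + g x) \<in> E" if "f \<in> E" "g \<in> E" for f g
    using that by (simp add: E_def bounded_continuous_add functional_calculus_add[OF \<Phi>] functional_calculus_add[OF \<Psi>])
  have mult: "(\<lambda>x. f x * g x) \<in> E" if "f \<in> E" "g \<in> E" for f g
    using that by (simp add: E_def bounded_continuous_mult functional_calculus_mult[OF \<Phi>] functional_calculus_mult[OF \<Psi>])
  have cnj: "(\<lambda>x. cnj (f x)) \<in> E" if "f \<in> E" for f
  proof -
    have f: "bounded_continuous f" "\<Phi> f = \<Psi> f" using that by (simp_all add: E_def)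
    have "\<Phi> (\<lambda>x. cnj (f x)) = adj (\<Phi> f)" "\<Psi> (\<lambda>x. cnj (f x)) = adj (\<Psi> f)"
      using functional_calculus_adjoint[OF \<Phi> f(1)] functional_calculus_adjoint[OF \<Psi> f(1)]
      by (simp_all add: adj_eqI)
    with f show ?thesis by (simp add: E_def bounded_continuous_cnj)
  qed
  have res: "(\<lambda>x. 1 / (complex_of_real x - z)) \<in> E" if "Im z \<noteq> 0" for z
    using is_resolvent_unique[OF functional_calculus_resolvent[OF \<Phi> that] functional_calculus_resolvent[OF \<Psi> that]]
      bounded_continuous_resolvent[OF that] by (simp add: E_def)
  have "(\<lambda>x. 1 + (- (2 * \<i>)) * (1 / (complex_of_real x - (- \<i>)))) \<in> E"
    by (intro add mult const res) simp
  moreover have "1 + (- (2 * \<i>)) * (1 / (complex_of_real x - (- \<i>))) = cayley x" for x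
    using one_minus_cayley[of x] by (simp add: algebra_simps)
  ultimately have cayley: "cayley \<in> E" by (simp only:)
  have "(\<lambda>x. f x * (1 - cayley x)) \<in> E"
  proof (rule cayley_Stone_Weierstrass[OF const add mult cayley cnj[OF cayley] _ f])
    fix f :: "real \<Rightarrow> complex"
    assume f: "bounded_continuous f"
      and approx: "\<And>e. e > 0 \<Longrightarrow> \<exists>g\<in>E. \<forall>x. cmod (f x - g x) \<le> e"
    have "norm (\<Phi> f - \<Psi> f) \<le> 0 + e" if "e > 0" for e
    proof -
      obtain g where g: "g \<in> E" "\<And>x. cmod (f x - g x) \<le> e / 2" using approx[of "e / 2"] \<open>e > 0\<close> by auto
      have bc: "bounded_continuous g" "bounded_continuous (\<lambda>x. f x - g x)"
        using g(1) bounded_continuous_add[OF f bounded_continuous_mult[OF bounded_continuous_const[of "- 1"], of g]]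
        by (auto simp: E_def)
      have "\<Phi> f - \<Psi> f = \<Phi> (\<lambda>x. f x - g x) - \<Psi> (\<lambda>x. f x - g x)"
        using g(1) by (simp add: functional_calculus_diff[OF \<Phi> f bc(1)] functional_calculus_diff[OF \<Psi> f bc(1)] E_def)
      also have "norm \<dots> \<le> e / 2 + e / 2"
        by (intro order_trans[OF norm_triangle_ineq4] add_mono norm_functional_calculus_le[OF \<Phi> bc(2)]
            norm_functional_calculus_le[OF \<Psi> bc(2)] g(2))
      finally show ?thesis by simp
    qed
    then have "norm (\<Phi> f - \<Psi> f) \<le> 0" by (rule field_le_epsilon)
    with f show "f \<in> E" by (simp add: E_def)
  qed
  then have eq: "\<Phi> (\<lambda>x. f x * (1 - cayley x)) = \<Psi> (\<lambda>x. f x * (1 - cayley x))" by (simp add: E_def)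
  have C: "(\<lambda>x. 1 - cayley x) \<in> E"
    using add[OF const[of 1] mult[OF const[of "- 1"] cayley]] by simp
  then have bC: "bounded_continuous (\<lambda>x. 1 - cayley x)" by (simp add: E_def)
  have "1 - cayley x = (2 * \<i>) * (1 / (complex_of_real x - (- \<i>)))" for x
    by (simp add: one_minus_cayley)
  then have "\<Phi> (\<lambda>x. 1 - cayley x) = (2 * \<i>) *\<^sub>C \<Phi> (\<lambda>x. 1 / (complex_of_real x - (- \<i>)))"
    using functional_calculus_scale[OF \<Phi> bounded_continuous_resolvent, of "- \<i>" "2 * \<i>"] by simp
  also have "\<Phi> (\<lambda>x. 1 / (complex_of_real x - (- \<i>))) = R"
    by (rule is_resolvent_unique[OF functional_calculus_resolvent[OF \<Phi>] is_resolvent_R]) simp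
  finally have \<Phi>C: "\<Phi> (\<lambda>x. 1 - cayley x) = (2 * \<i>) *\<^sub>C R" .
  have \<Psi>C: "\<Psi> (\<lambda>x. 1 - cayley x) = (2 * \<i>) *\<^sub>C R" using C \<Phi>C by (simp add: E_def)
  have "\<Phi> f * ((2 * \<i>) *\<^sub>C R) = \<Psi> f * ((2 * \<i>) *\<^sub>C R)"
    using eq unfolding functional_calculus_mult[OF \<Phi> f bC] functional_calculus_mult[OF \<Psi> f bC] \<Phi>C \<Psi>C .
  then have e2: "(1 / (2 * \<i>)) *\<^sub>C ((2 * \<i>) *\<^sub>C (\<Phi> f * R)) = (1 / (2 * \<i>)) *\<^sub>C ((2 * \<i>) *\<^sub>C (\<Psi> f * R))"
    by (simp add: mult_scaleC_right)
  then have e3: "\<Phi> f * R = \<Psi> f * R" by (simp add: scaleC_scaleC)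
  show ?thesis
  proof (rule bop_S_ext)
    fix x assume "x \<in> S"
    then obtain v where "x = app R v" using range_R by blast
    then show "app (\<Phi> f) x = app (\<Psi> f) x" using e3 by (metis app_mult)
  qed
qed

lemma fun_of_op_eq:
  assumes "functional_calculus S D \<Phi>" "bounded_continuous (\<lambda>x. complex_of_real (f x))"
  shows "fun_of_op S D f = \<Phi> (\<lambda>x. complex_of_real (f x))"
  unfolding fun_of_op_def
  by (rule the_equality) (use assms functional_calculus_unique in blast)+

end

section \<open>Commutators with the bounded transform\<close>

definition recip_sqrt :: "real \<Rightarrow> real" where "recip_sqrt x = 1 / sqrt (1 + x\<^sup>2)"
definition bdd_transform :: "real \<Rightarrow> real" where "bdd_transform x = x / sqrt (1 + x\<^sup>2)"

text \<open>For \<open>x = sinh s\<close> this is \<open>tanh (s / 2)\<close>.\<close>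

definition half_angle :: "real \<Rightarrow> real" where "half_angle x = x / (1 + sqrt (1 + x\<^sup>2))"

lemma sqrt_one_plus_square: "1 \<le> sqrt (1 + x\<^sup>2)" "\<bar>x\<bar> \<le> sqrt (1 + x\<^sup>2)" "sqrt (1 + x\<^sup>2) * sqrt (1 + x\<^sup>2) = 1 + x * x"
proof -
  show "1 \<le> sqrt (1 + x\<^sup>2)" by simp
  show "\<bar>x\<bar> \<le> sqrt (1 + x\<^sup>2)" by (rule real_le_rsqrt) simp
  have "0 \<le> 1 + x\<^sup>2" by (simp add: add_nonneg_nonneg)
  then show "sqrt (1 + x\<^sup>2) * sqrt (1 + x\<^sup>2) = 1 + x * x" by (simp add: power2_eq_square)
qed

lemma recip_sqrt_bounds: "0 < recip_sqrt x" "recip_sqrt x \<le> 1"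
  and bdd_transform_bound: "\<bar>bdd_transform x\<bar> \<le> 1" and half_angle_bound: "\<bar>half_angle x\<bar> \<le> 1"
proof -
  define r where "r = sqrt (1 + x\<^sup>2)"
  have "r \<ge> 1" "\<bar>x\<bar> \<le> r" using sqrt_one_plus_square[of x] by (simp_all add: r_def)
  then show "0 < recip_sqrt x" "recip_sqrt x \<le> 1" "\<bar>bdd_transform x\<bar> \<le> 1" "\<bar>half_angle x\<bar> \<le> 1"
    by (simp_all add: recip_sqrt_def bdd_transform_def half_angle_def flip: r_def)
qed

lemma bdd_transform_eq: "bdd_transform x = x * recip_sqrt x"
  by (simp add: bdd_transform_def recip_sqrt_def)

lemma bdd_transform_recip_sqrt_square: "bdd_transform x * bdd_transform x + recip_sqrt x * recip_sqrt x = 1"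
proof -
  have "0 < 1 + x * x" by (simp add: add_pos_nonneg)
  then show ?thesis
    unfolding bdd_transform_def recip_sqrt_def times_divide_times_eq sqrt_one_plus_square(3) add_divide_distrib[symmetric]
    by (simp add: add.commute)
qed

lemma half_angle_bdd_transform: "half_angle x * bdd_transform x = 1 - recip_sqrt x"
proof -
  define r where "r = sqrt (1 + x\<^sup>2)"
  have r: "r \<ge> 1" "r * r = 1 + x * x" using sqrt_one_plus_square[of x] by (simp_all add: r_def)
  have "x * x = (r - 1) * (1 + r)" using r(2) by (simp add: algebra_simps)
  then have "half_angle x * bdd_transform x = ((r - 1) * (1 + r)) / ((1 + r) * r)"
    by (simp add: half_angle_def bdd_transform_def flip: r_def)
  also have "\<dots> = (r - 1) / r" using r(1) by simp
  finally show ?thesis using r(1) by (simp add: recip_sqrt_def diff_divide_distrib flip: r_def)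
qed

lemma half_angle_recip_sqrt: "half_angle x + half_angle x * recip_sqrt x = bdd_transform x"
proof -
  define r where "r = sqrt (1 + x\<^sup>2)"
  have r: "r \<ge> 1" using sqrt_one_plus_square[of x] by (simp add: r_def)
  have "half_angle x + half_angle x * recip_sqrt x = x / (1 + r) * ((1 + r) / r)"
    using r by (simp add: half_angle_def recip_sqrt_def add_divide_distrib distrib_left flip: r_def)
  also have "\<dots> = x / r" using r by simp
  finally show ?thesis by (simp add: bdd_transform_def r_def)
qed

text \<open>With s the modulus of the half angle, the first factor is at most 2 (1 - s). Moreover (1
  - s) s^k is at most 1 / (k + 1), because each of the k + 1 terms of the geometric sum is at least
  s^k.\<close>

lemma recip_sqrt_half_angle_power: "recip_sqrt x * \<bar>half_angle x\<bar> ^ k \<le> 2 / real (Suc k)"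
proof -
  define s where "s = \<bar>half_angle x\<bar>"
  define r where "r = sqrt (1 + x\<^sup>2)"
  have r: "r \<ge> 1" "\<bar>x\<bar> \<le> r" using sqrt_one_plus_square[of x] by (simp_all add: r_def)
  have s: "0 \<le> s" "s \<le> 1" using half_angle_bound[of x] by (simp_all add: s_def)
  have "s = \<bar>x\<bar> / (1 + r)" using r by (simp add: s_def half_angle_def flip: r_def)
  then have a: "1 - s = (1 + r - \<bar>x\<bar>) / (1 + r)" using r by (simp add: field_simps)
  have b: "1 / (1 + r) \<le> (1 + r - \<bar>x\<bar>) / (1 + r)" using r by (intro divide_right_mono) auto
  have c: "1 / (2 * r) \<le> 1 / (1 + r)" using r by (intro divide_left_mono) auto
  have "recip_sqrt x = 2 * (1 / (2 * r))" by (simp add: recip_sqrt_def flip: r_def)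
  also have "\<dots> \<le> 2 * (1 - s)" unfolding a using order_trans[OF c b] by (rule mult_left_mono) simp
  finally have g: "recip_sqrt x \<le> 2 * (1 - s)" .
  have "real (Suc k) * s ^ k = (\<Sum>j<Suc k. s ^ k)" by simp
  also have "\<dots> \<le> (\<Sum>j<Suc k. s ^ j)"
    using s by (intro sum_mono power_decreasing) auto
  finally have "(1 - s) * (real (Suc k) * s ^ k) \<le> (1 - s) * (\<Sum>j<Suc k. s ^ j)"
    using s by (intro mult_left_mono) auto
  also have "\<dots> = 1 - s ^ Suc k" by (simp only: one_diff_power_eq)
  also have "\<dots> \<le> 1" using s by simp
  finally have 1: "real (Suc k) * ((1 - s) * s ^ k) \<le> 1" by (simp add: mult_ac del: of_nat_Suc)
  have "real (Suc k) * (recip_sqrt x * s ^ k) \<le> real (Suc k) * (2 * (1 - s) * s ^ k)"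
    using g s by (intro mult_left_mono mult_right_mono) auto
  also have "\<dots> = 2 * (real (Suc k) * ((1 - s) * s ^ k))" by (simp only: mult_ac)
  also have "\<dots> \<le> 2" using 1 by linarith
  finally show ?thesis by (simp add: field_simps s_def del: of_nat_Suc)
qed

lemma isCont_recip_sqrt: "isCont recip_sqrt x" and isCont_bdd_transform: "isCont bdd_transform x" and isCont_half_angle: "isCont half_angle x"
proof -
  have "1 + x\<^sup>2 > 0" by (simp add: add_pos_nonneg)
  then have nz: "sqrt (1 + x\<^sup>2) \<noteq> 0" "1 + sqrt (1 + x\<^sup>2) \<noteq> 0"
    using sqrt_one_plus_square(1)[of x] by linarith+
  show "isCont recip_sqrt x" unfolding recip_sqrt_def[abs_def] by (intro continuous_intros nz)
  show "isCont bdd_transform x" unfolding bdd_transform_def[abs_def] by (intro continuous_intros nz)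
  show "isCont half_angle x" unfolding half_angle_def[abs_def] by (intro continuous_intros nz)
qed

lemma bounded_continuous_of_real:
  "(\<And>x. isCont f x) \<Longrightarrow> (\<And>x. \<bar>f x\<bar> \<le> B) \<Longrightarrow> bounded_continuous (\<lambda>x. complex_of_real (f x))"
  by (rule bounded_continuousI[where B = B]) (auto intro: isCont_of_real)

context selfadjoint_op
begin

abbreviation \<Phi> :: "(real \<Rightarrow> real) \<Rightarrow> 'h bop" where
  "\<Phi> f \<equiv> calculus (\<lambda>x. complex_of_real (f x))"

definition G :: "'h bop" where "G = \<Phi> recip_sqrt"
definition F :: "'h bop" where "F = \<Phi> bdd_transform"
definition T :: "'h bop" where "T = \<Phi> half_angle"
text \<open>The square root of \<open>G\<close>, which carries the interpolation exponent 1/2 of the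
  commutator estimate.\<close>

definition H :: "'h bop" where "H = \<Phi> (\<lambda>x. sqrt (recip_sqrt x))"

lemma bc_recip_sqrt: "bounded_continuous (\<lambda>x. complex_of_real (recip_sqrt x))"
  by (rule bounded_continuous_of_real[where B = 1]) (use recip_sqrt_bounds isCont_recip_sqrt in \<open>auto simp: abs_of_pos\<close>)

lemma bc_bdd_transform: "bounded_continuous (\<lambda>x. complex_of_real (bdd_transform x))"
  by (rule bounded_continuous_of_real[OF isCont_bdd_transform bdd_transform_bound])

lemma bc_half_angle: "bounded_continuous (\<lambda>x. complex_of_real (half_angle x))"
  by (rule bounded_continuous_of_real[OF isCont_half_angle half_angle_bound])

lemma bc_half_angle_power: "bounded_continuous (\<lambda>x. complex_of_real (half_angle x ^ k))"
  by (rule bounded_continuous_of_real[where B = 1])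
    (auto intro!: continuous_intros isCont_half_angle power_le_one half_angle_bound simp: power_abs)

lemma bc_sqrt_recip_sqrt: "bounded_continuous (\<lambda>x. complex_of_real (sqrt (recip_sqrt x)))"
  by (rule bounded_continuous_of_real[where B = 1])
    (use recip_sqrt_bounds in \<open>auto intro!: continuous_intros isCont_recip_sqrt simp: less_imp_le\<close>)

lemma calculus_prod:
  "bounded_continuous f \<Longrightarrow> bounded_continuous g \<Longrightarrow> calculus (\<lambda>x. f x * g x) = calculus f * calculus g"
  by (rule functional_calculus_mult[OF functional_calculus_calculus])

lemma calculus_diff:
  "bounded_continuous f \<Longrightarrow> bounded_continuous g \<Longrightarrow> calculus (\<lambda>x. f x - g x) = calculus f - calculus g"
  by (rule functional_calculus_diff[OF functional_calculus_calculus])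

lemma norm_calculus_le: "bounded_continuous f \<Longrightarrow> (\<And>x. cmod (f x) \<le> c) \<Longrightarrow> norm (calculus f) \<le> c"
  by (rule norm_functional_calculus_le[OF functional_calculus_calculus])

lemma adj_calculus_real:
  "bounded_continuous (\<lambda>x. complex_of_real (f x)) \<Longrightarrow> adj (\<Phi> f) = \<Phi> f"
  using adj_eqI[OF functional_calculus_adjoint[OF functional_calculus_calculus]] by fastforce

lemma adj_G: "adj G = G" and adj_F: "adj F = F" and adj_H: "adj H = H"
  unfolding G_def F_def H_def by (intro adj_calculus_real bc_recip_sqrt bc_bdd_transform bc_sqrt_recip_sqrt)+

lemma fun_of_op_G: "inv_sqrt_op S D = G"
  using fun_of_op_eq[OF functional_calculus_calculus bc_recip_sqrt] by (simp add: G_def recip_sqrt_def[abs_def])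

lemma fun_of_op_F: "fun_of_op S D (\<lambda>x. x / sqrt (1 + x\<^sup>2)) = F"
  using fun_of_op_eq[OF functional_calculus_calculus bc_bdd_transform] by (simp add: F_def bdd_transform_def[abs_def])

lemma one_minus_FF: "1 - F * F = G * G"
proof -
  have "complex_of_real (bdd_transform x) * complex_of_real (bdd_transform x) + complex_of_real (recip_sqrt x) * complex_of_real (recip_sqrt x) = 1" for x
    using bdd_transform_recip_sqrt_square[of x] by (metis of_real_1 of_real_add of_real_mult)
  then have "F * F + G * G = calculus (\<lambda>x. 1)"
    unfolding F_def G_def
    by (simp add: bc_recip_sqrt bc_bdd_transform bounded_continuous_mult flip: calculus_prod calculus_add)
  then show ?thesis by (simp add: calculus_one algebra_simps)
qed

lemma TF: "T * F = 1 - G"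
proof -
  have "T * F = calculus (\<lambda>x. complex_of_real (half_angle x) * complex_of_real (bdd_transform x))"
    unfolding T_def F_def by (rule calculus_prod[OF bc_half_angle bc_bdd_transform, symmetric])
  also have "(\<lambda>x. complex_of_real (half_angle x) * complex_of_real (bdd_transform x)) = (\<lambda>x. 1 - complex_of_real (recip_sqrt x))"
    by (simp only: of_real_mult[symmetric] half_angle_bdd_transform of_real_diff of_real_1)
  also have "calculus \<dots> = 1 - G"
    unfolding G_def calculus_one[symmetric] by (rule calculus_diff[OF bounded_continuous_const bc_recip_sqrt])
  finally show ?thesis .
qed

lemma calculus_commute: "bounded_continuous f \<Longrightarrow> bounded_continuous g \<Longrightarrow> calculus f * calculus g = calculus g * calculus f"
  by (simp add: mult.commute flip: calculus_prod)

lemma FT: "F * T = 1 - G"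
  using TF calculus_commute[OF bc_half_angle bc_bdd_transform] by (simp add: F_def T_def)

lemma T_TG: "T + T * G = F"
proof -
  have "T + T * G = calculus (\<lambda>x. complex_of_real (half_angle x) + complex_of_real (half_angle x) * complex_of_real (recip_sqrt x))"
    unfolding T_def G_def
    by (simp add: bc_half_angle bc_recip_sqrt bounded_continuous_mult calculus_prod calculus_add)
  also have "\<dots> = F"
    unfolding F_def by (simp only: of_real_mult[symmetric] of_real_add[symmetric] half_angle_recip_sqrt)
  finally show ?thesis .
qed

lemma T_GT: "T + G * T = F"
  using T_TG calculus_commute[OF bc_half_angle bc_recip_sqrt] by (simp add: G_def T_def)

lemma T_power: "T ^ k = \<Phi> (\<lambda>x. half_angle x ^ k)"
proof (induction k)
  case (Suc k)
  have "\<Phi> (\<lambda>x. half_angle x ^ Suc k) = calculus (\<lambda>x. complex_of_real (half_angle x) * complex_of_real (half_angle x ^ k))"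
    by simp
  also have "\<dots> = T * \<Phi> (\<lambda>x. half_angle x ^ k)"
    unfolding T_def by (rule calculus_prod[OF bc_half_angle bc_half_angle_power])
  finally show ?case using Suc by simp
qed (simp add: calculus_one)

lemma norm_T_power_G: "norm (T ^ k * G) \<le> 2 / real (Suc k)"
  unfolding T_power G_def calculus_prod[OF bc_half_angle_power bc_recip_sqrt, symmetric]
proof (rule norm_calculus_le)
  show "bounded_continuous (\<lambda>x. complex_of_real (half_angle x ^ k) * complex_of_real (recip_sqrt x))"
    by (intro bounded_continuous_mult bc_half_angle_power bc_recip_sqrt)
  show "cmod (complex_of_real (half_angle x ^ k) * complex_of_real (recip_sqrt x)) \<le> 2 / real (Suc k)" for x
    using recip_sqrt_half_angle_power[of x k] recip_sqrt_bounds[of x]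
    by (simp add: norm_mult norm_power mult.commute abs_of_pos)
qed

text \<open>The function for \<open>R\<close> has modulus \<open>recip_sqrt\<close>, so the decay is
  that for \<open>G\<close>. It makes the remainder of the commutator series vanish on the range of
  \<open>R\<close>, which is \<open>S\<close>.\<close>

lemma norm_T_power_R: "norm (T ^ k * R) \<le> 2 / real (Suc k)"
proof -
  have bcR: "bounded_continuous (\<lambda>x. 1 / (complex_of_real x + \<i>))"
    using bounded_continuous_resolvent[of "- \<i>"] by simp
  show ?thesis
    unfolding T_power calculus_R[symmetric] calculus_prod[OF bc_half_angle_power bcR, symmetric]
  proof (rule norm_calculus_le)
    show "bounded_continuous (\<lambda>x. complex_of_real (half_angle x ^ k) * (1 / (complex_of_real x + \<i>)))"
      by (intro bounded_continuous_mult bc_half_angle_power bcR)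
    fix x
    have "cmod (complex_of_real x + \<i>) = sqrt (1 + x\<^sup>2)" by (simp add: cmod_def add.commute)
    then have "cmod (1 / (complex_of_real x + \<i>)) = recip_sqrt x" by (simp add: norm_divide recip_sqrt_def)
    then have "cmod (complex_of_real (half_angle x ^ k) * (1 / (complex_of_real x + \<i>))) = recip_sqrt x * \<bar>half_angle x\<bar> ^ k"
      unfolding norm_mult by (simp add: norm_power mult.commute)
    then show "cmod (complex_of_real (half_angle x ^ k) * (1 / (complex_of_real x + \<i>))) \<le> 2 / real (Suc k)"
      using recip_sqrt_half_angle_power[of x k] by simp
  qed
qed

lemma HH: "H * H = G"
proof -
  have "complex_of_real (sqrt (recip_sqrt x)) * complex_of_real (sqrt (recip_sqrt x)) = complex_of_real (recip_sqrt x)" for x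
    using recip_sqrt_bounds[of x] by (simp flip: of_real_mult)
  then show ?thesis
    unfolding H_def G_def by (simp add: bc_sqrt_recip_sqrt flip: calculus_prod)
qed

text \<open>\<open>H\<close> is selfadjoint with square \<open>G\<close>, so the left side is the
  inner product of \<open>y\<close> with \<open>app G y\<close>.\<close>

lemma norm_H_square: "(norm (app H y))\<^sup>2 \<le> norm y * norm (app G y)"
proof -
  have "cinner (app H y) (app H y) = cinner y (app G y)"
    unfolding HH[symmetric] by (simp add: adj_H flip: cinner_adj_left)
  then have "cinner y (app G y) = complex_of_real ((norm (app H y))\<^sup>2)"
    by (simp only: cinner_self)
  then show ?thesis using cinner_Cauchy_Schwarz[of y "app G y"] by (simp add: norm_power)
qed

text \<open>Writing \<open>G = H * H\<close> leaves one \<open>H\<close> on \<open>y\<close>; the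
  other absorbs the powers of \<open>T\<close> and retains the decay of \<open>G\<close> under a
  square root.\<close>

lemma norm_G_T_power_le: "norm (app G (app (T ^ k) y)) \<le> sqrt (2 / real (Suc k)) * norm (app H y)"
proof -
  let ?f = "\<lambda>x. complex_of_real (sqrt (recip_sqrt x)) * complex_of_real (half_angle x ^ k)"
  have f: "bounded_continuous ?f" by (intro bounded_continuous_mult bc_sqrt_recip_sqrt bc_half_angle_power)
  have "G * T ^ k = H * (H * T ^ k)" by (simp add: HH mult.assoc flip: HH)
  also have "H * T ^ k = T ^ k * H"
    unfolding T_power H_def by (rule calculus_commute[OF bc_sqrt_recip_sqrt bc_half_angle_power])
  also have "H * (T ^ k * H) = (H * T ^ k) * H" by (simp add: mult.assoc)
  also have "H * T ^ k = calculus ?f"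
    unfolding T_power H_def by (rule calculus_prod[OF bc_sqrt_recip_sqrt bc_half_angle_power, symmetric])
  finally have eq: "G * T ^ k = calculus ?f * H" .
  have "norm (calculus ?f) \<le> sqrt (2 / real (Suc k))"
  proof (rule norm_calculus_le[OF f])
    fix x
    have s: "0 \<le> \<bar>half_angle x\<bar>" "\<bar>half_angle x\<bar> \<le> 1" using half_angle_bound by auto
    \<comment> \<open>One of the two powers is given away so that the estimate for a single power
      applies under the root.\<close>
    have "recip_sqrt x * (\<bar>half_angle x\<bar> ^ k * \<bar>half_angle x\<bar> ^ k) \<le> recip_sqrt x * (\<bar>half_angle x\<bar> ^ k * 1)"
      using s recip_sqrt_bounds[of x] by (intro mult_left_mono power_le_one) auto
    also have "\<dots> \<le> 2 / real (Suc k)" using recip_sqrt_half_angle_power[of x k] by simp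
    finally have "sqrt (recip_sqrt x * (\<bar>half_angle x\<bar> ^ k * \<bar>half_angle x\<bar> ^ k)) \<le> sqrt (2 / real (Suc k))" by simp
    moreover have "cmod (?f x) = sqrt (recip_sqrt x * (\<bar>half_angle x\<bar> ^ k * \<bar>half_angle x\<bar> ^ k))"
      using recip_sqrt_bounds[of x] by (simp add: norm_mult norm_power real_sqrt_mult)
    ultimately show "cmod (?f x) \<le> sqrt (2 / real (Suc k))" by simp
  qed
  then have "norm (app (calculus ?f) (app H y)) \<le> sqrt (2 / real (Suc k)) * norm (app H y)"
    by (rule order_trans[OF norm_app_le mult_right_mono]) simp
  then show ?thesis by (simp flip: app_mult add: eq)
qed

text \<open>The calculus knows \<open>D\<close> only through resolvents. Since
  \<open>recip_sqrt x\<close> is \<open>?h x * ?b x\<close>, the operator \<open>G\<close> factors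
  through \<open>R\<close> on either side; this yields values in \<open>S\<close> and both relations
  with \<open>D\<close>.\<close>

lemma G_S: "app G v \<in> S" and D_G: "D (app G v) = app F v" and G_D: "x \<in> S \<Longrightarrow> app G (D x) = app F x"
proof -
  let ?h = "\<lambda>x. 1 / (complex_of_real x + \<i>)"
  let ?b = "\<lambda>x. complex_of_real (bdd_transform x) + \<i> * complex_of_real (recip_sqrt x)"
  have h: "bounded_continuous ?h" using bounded_continuous_resolvent[of "- \<i>"] by simp
  have ig: "bounded_continuous (\<lambda>x. \<i> * complex_of_real (recip_sqrt x))"
    by (intro bounded_continuous_mult bounded_continuous_const bc_recip_sqrt)
  have b: "bounded_continuous ?b" by (intro bounded_continuous_add bc_bdd_transform ig)
  have cb: "calculus ?b = F + \<i> *\<^sub>C G"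
    unfolding F_def G_def by (simp only: calculus_add[OF bc_bdd_transform ig] calculus_scale[OF bc_recip_sqrt])
  have eq: "?h x * ?b x = complex_of_real (recip_sqrt x)" for x
  proof -
    have "?b x = (complex_of_real x + \<i>) * complex_of_real (recip_sqrt x)"
      by (simp add: bdd_transform_eq distrib_right)
    then show ?thesis by simp
  qed
  have G1: "G = R * (F + \<i> *\<^sub>C G)"
  proof -
    have "R * (F + \<i> *\<^sub>C G) = calculus (\<lambda>x. ?h x * ?b x)"
      unfolding calculus_prod[OF h b] calculus_R cb ..
    then show ?thesis unfolding eq G_def by simp
  qed
  have G2: "G = (F + \<i> *\<^sub>C G) * R"
  proof -
    have "(F + \<i> *\<^sub>C G) * R = calculus (\<lambda>x. ?b x * ?h x)"
      unfolding calculus_prod[OF b h] calculus_R cb ..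
    also have "(\<lambda>x. ?b x * ?h x) = (\<lambda>x. complex_of_real (recip_sqrt x))"
      by (rule ext) (subst mult.commute, rule eq)
    finally show ?thesis unfolding G_def by simp
  qed
  have Gv: "app G v = app R (app F v + \<i> *\<^sub>C app G v)" for v
    using arg_cong[OF G1, of "\<lambda>A. app A v"] by (simp add: app_simps)
  show "app G v \<in> S" for v
    by (rule ssubst[OF Gv]) (rule R_S)
  have "D (app G v) + \<i> *\<^sub>C app G v = app F v + \<i> *\<^sub>C app G v" for v
    using D_R[of "app F v + \<i> *\<^sub>C app G v"] by (simp only: Gv[symmetric])
  then show "D (app G v) = app F v" for v by simp
  assume x: "x \<in> S"
  have "app G (D x + \<i> *\<^sub>C x) = app ((F + \<i> *\<^sub>C G) * R) (D x + \<i> *\<^sub>C x)"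
    using G2 by simp
  also have "\<dots> = app (F + \<i> *\<^sub>C G) x" by (simp only: app_mult R_D[OF x])
  also have "\<dots> = app F x + \<i> *\<^sub>C app G x" by (simp add: app_simps)
  finally show "app G (D x) = app F x" by (simp add: app_simps)
qed

text \<open>Between two copies of \<open>G\<close> the unbounded \<open>D\<close> is absorbed into
  \<open>F\<close>, by \<open>D_G\<close> on the right and by \<open>G_D\<close> on the left; the
  latter requires that \<open>A\<close> maps \<open>S\<close> to itself.\<close>

lemma GKG:
  assumes "has_bounded_commutator S D A K"
  shows "G * K * G = F * A * G - G * A * F"
proof (rule bop_eqI)
  fix v
  have AG: "app A (app G v) \<in> S" using assms G_S unfolding has_bounded_commutator_def by blast
  have "app K (app G v) = D (app A (app G v)) - app A (D (app G v))"
    using assms G_S unfolding has_bounded_commutator_def by simp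
  then show "app (G * K * G) v = app (F * A * G - G * A * F) v"
    by (simp add: app_simps D_G G_D[OF AG])
qed

text \<open>For diagonal \<open>D\<close> with entries sinh s and sinh t, the multiplier from
  \<open>G * K * G\<close> to the commutator is cosh((s - t)/2) / cosh((s + t)/2) = (1 - u v) / (1 +
  u v), where u = tanh(s/2) and v = tanh(t/2). Clearing the denominator gives this form, which no
  longer needs a diagonal \<open>D\<close>.\<close>

lemma commutator_recursion:
  assumes "has_bounded_commutator S D A K"
  shows "F * A - A * F = (G * K * G - T * (G * K * G) * T) - T * (F * A - A * F) * T"
proof -
  have 1: "T * (F * A - A * F) * T = (T * F) * A * T - T * A * (F * T)"
    by (simp add: algebra_simps)
  have 2: "T * (G * K * G) * T = (T * F) * A * G * T - T * G * A * (F * T)"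
    unfolding GKG[OF assms] by (simp add: algebra_simps)
  have 3: "F * A = T * A + T * G * A" "F * A * G = T * A * G + T * G * A * G"
    unfolding T_TG[symmetric] by (simp_all add: algebra_simps)
  have 4: "A * F = A * T + A * G * T" "G * A * F = G * A * T + G * A * G * T"
    unfolding T_GT[symmetric] by (simp_all add: algebra_simps)
  show ?thesis
    \<comment> \<open>The products of \<open>T\<close> and \<open>F\<close> are collapsed first;
      only the remaining \<open>F\<close> are expanded in \<open>T\<close> and \<open>G\<close>, and
      the resulting polynomials agree.\<close>
    unfolding 1 2 TF FT unfolding GKG[OF assms] unfolding 3 4 by (simp add: algebra_simps)
qed

section \<open>The commutator series and its remainder\<close>

lemma T_T_power: "T ^ k * T = T ^ Suc k" "T * T ^ k = T ^ Suc k"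
  by (rule power_Suc2[symmetric], rule power_Suc[symmetric])

text \<open>Kept finite, with its remainder: \<open>T\<close> may have norm 1, so the remainder has
  to be treated vector by vector.\<close>

lemma commutator_expansion:
  assumes "has_bounded_commutator S D A K"
  shows "F * A - A * F = (\<Sum>k<n. (- 1) ^ k *\<^sub>R (T ^ k * (G * K * G - T * (G * K * G) * T) * T ^ k))
    + (- 1) ^ n *\<^sub>R (T ^ n * (F * A - A * F) * T ^ n)"
proof (induction n)
  case (Suc n)
  let ?C = "F * A - A * F" and ?Z = "G * K * G - T * (G * K * G) * T"
  have "T ^ n * ?C * T ^ n = T ^ n * (?Z - T * ?C * T) * T ^ n"
    using commutator_recursion[OF assms] by simp
  also have "\<dots> = T ^ n * ?Z * T ^ n - (T ^ n * T) * ?C * (T * T ^ n)"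
    by (simp add: right_diff_distrib left_diff_distrib mult.assoc)
  finally have eq: "T ^ n * ?C * T ^ n = T ^ n * ?Z * T ^ n - T ^ Suc n * ?C * T ^ Suc n"
    by (simp only: T_T_power)
  have sgn: "(- 1) ^ Suc n *\<^sub>R X = - ((- 1) ^ n *\<^sub>R X)" for X :: "'h bop" by simp
  have "(- 1) ^ n *\<^sub>R (T ^ n * ?C * T ^ n)
     = (- 1) ^ n *\<^sub>R (T ^ n * ?Z * T ^ n) + (- 1) ^ Suc n *\<^sub>R (T ^ Suc n * ?C * T ^ Suc n)"
    unfolding sgn by (subst eq) (simp only: scaleR_diff_right add_uminus_conv_diff)
  then show ?case by (intro trans[OF Suc]) (simp only: sum.lessThan_Suc add.assoc)
qed simp

text \<open>The summand multiplies the norm decay of \<open>T ^ k * G\<close> by that of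
  \<open>G * T ^ k\<close> relative to \<open>H\<close>; the factor 2 counts the two parts of the
  inhomogeneous term in the recursion. The series is a multiple of that of k to the power
  -3/2.\<close>

definition commutator_const :: real where
  "commutator_const = (\<Sum>k. 2 * (2 / real (Suc k) * sqrt (2 / real (Suc k))))"

lemma summable_commutator_const: "summable (\<lambda>k. 2 * (2 / real (Suc k) * sqrt (2 / real (Suc k))))"
proof -
  have "2 / real (Suc k) * sqrt (2 / real (Suc k)) = 2 * sqrt 2 * real (Suc k) powr (- (3 / 2))" for k
  proof -
    have "real (Suc k) powr (3 / 2) = real (Suc k) powr (1 + 1 / 2)" by simp
    also have "\<dots> = real (Suc k) * sqrt (real (Suc k))"
      unfolding powr_add by (simp add: powr_half_sqrt)
    finally show ?thesis by (simp add: powr_minus_divide real_sqrt_divide del: of_nat_Suc)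
  qed
  moreover have "summable (\<lambda>k. real (Suc k) powr (- (3 / 2)))"
    by (subst summable_Suc_iff) (simp add: summable_real_powr_iff)
  ultimately show ?thesis by (simp only:) (intro summable_mult)
qed

lemma commutator_const_nonneg: "0 \<le> commutator_const"
  unfolding commutator_const_def by (intro suminf_nonneg summable_commutator_const) simp

text \<open>Every term of the expansion is bounded by a multiple of \<open>norm (app H y)\<close>.
  The remainder is estimated on \<open>S\<close> only; both sides are continuous in
  \<open>y\<close>, so density finishes the proof.\<close>

lemma norm_commutator_H:
  assumes A: "has_bounded_commutator S D A K"
  shows "norm (app (F * A - A * F) y) \<le> commutator_const * norm K * norm (app H y)"
proof -
  let ?C = "F * A - A * F" and ?Z = "G * K * G - T * (G * K * G) * T"
  let ?c = "\<lambda>k. 2 / real (Suc k) * sqrt (2 / real (Suc k))"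
  have GKG_le: "norm (app (T ^ k * (G * K * G) * T ^ k) y) \<le> ?c k * (norm K * norm (app H y))" for k y
  proof -
    have "norm (app (T ^ k * G) (app K (app G (app (T ^ k) y))))
       \<le> norm (T ^ k * G) * (norm K * norm (app G (app (T ^ k) y)))"
      by (intro order_trans[OF norm_app_le] mult_left_mono norm_app_le) simp
    also have "\<dots> \<le> 2 / real (Suc k) * (norm K * (sqrt (2 / real (Suc k)) * norm (app H y)))"
      by (intro mult_mono mult_left_mono norm_T_power_G norm_G_T_power_le) auto
    finally show ?thesis by (simp add: mult_ac)
  qed
  \<comment> \<open>Conjugating with \<open>T\<close> shifts the index by one, so the second part of
    \<open>?Z\<close> is the first one at \<open>Suc k\<close>, where the bound is smaller.\<close>
  have Z_le: "norm (app (T ^ k * ?Z * T ^ k) y) \<le> 2 * ?c k * (norm K * norm (app H y))" for k y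
  proof -
    have "T ^ k * ?Z * T ^ k = T ^ k * (G * K * G) * T ^ k - (T ^ k * T) * (G * K * G) * (T * T ^ k)"
      by (simp add: right_diff_distrib left_diff_distrib mult.assoc)
    then have eq: "T ^ k * ?Z * T ^ k = T ^ k * (G * K * G) * T ^ k - T ^ Suc k * (G * K * G) * T ^ Suc k"
      by (simp only: T_T_power)
    let ?X = "norm K * norm (app H y)"
    have "?c (Suc k) * ?X \<le> ?c k * ?X"
      by (intro mult_right_mono mult_mono real_sqrt_le_mono divide_left_mono) auto
    moreover have "norm (app (T ^ k * ?Z * T ^ k) y)
       \<le> norm (app (T ^ k * (G * K * G) * T ^ k) y) + norm (app (T ^ Suc k * (G * K * G) * T ^ Suc k) y)"
      unfolding eq app.diff_left by (rule norm_triangle_ineq4)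
    ultimately show ?thesis
      using GKG_le[of k y] GKG_le[of "Suc k" y] by linarith
  qed
  have on_S: "norm (app ?C y) \<le> commutator_const * norm K * norm (app H y)" if "y \<in> S" for y
  proof -
    \<comment> \<open>Presenting \<open>y\<close> as a value of \<open>R\<close> lets the remainder
      be bounded through \<open>T ^ n * R\<close>.\<close>
    define w where "w = D y + \<i> *\<^sub>C y"
    have w: "y = app R w" unfolding w_def by (rule R_D[OF that, symmetric])
    have bd: "norm (app ?C y) \<le> commutator_const * (norm K * norm (app H y)) + norm ?C * (2 / real (Suc n) * norm w)" for n
    proof -
      have "norm (app ?C y) \<le> (\<Sum>k<n. norm (app (T ^ k * ?Z * T ^ k) y)) + norm (app (T ^ n * ?C * T ^ n) y)"
      proof -
        have "app ?C y = (\<Sum>k<n. (- 1) ^ k *\<^sub>R app (T ^ k * ?Z * T ^ k) y) + (- 1) ^ n *\<^sub>R app (T ^ n * ?C * T ^ n) y"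
          by (subst commutator_expansion[OF A, of n]) (simp only: app.add_left app.sum_left app.scaleR_left)
        then show ?thesis
          by (simp only:) (intro order_trans[OF norm_triangle_ineq] add_mono sum_norm_le, simp_all)
      qed
      moreover have "(\<Sum>k<n. norm (app (T ^ k * ?Z * T ^ k) y)) \<le> commutator_const * (norm K * norm (app H y))"
      proof -
        have "(\<Sum>k<n. norm (app (T ^ k * ?Z * T ^ k) y)) \<le> (\<Sum>k<n. 2 * ?c k * (norm K * norm (app H y)))"
        by (intro sum_mono Z_le)
      also have "\<dots> = (\<Sum>k<n. 2 * ?c k) * (norm K * norm (app H y))" by (simp only: sum_distrib_right)
      also have "\<dots> \<le> commutator_const * (norm K * norm (app H y))"
        unfolding commutator_const_def
        by (intro mult_right_mono sum_le_suminf summable_commutator_const) auto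
        finally show ?thesis .
      qed
      moreover have "norm (app (T ^ n * ?C * T ^ n) y) \<le> norm ?C * (2 / real (Suc n) * norm w)"
      proof -
        have T1: "norm (T ^ n) \<le> 1"
          unfolding T_power
          by (rule norm_calculus_le[OF bc_half_angle_power]) (simp add: norm_power power_le_one half_angle_bound)
        have "norm (app (T ^ n) (app ?C (app (T ^ n * R) w))) \<le> norm (T ^ n) * norm (app ?C (app (T ^ n * R) w))"
          by (rule norm_app_le)
        also have "\<dots> \<le> 1 * (norm ?C * norm (app (T ^ n * R) w))"
          by (intro mult_mono T1 norm_app_le) auto
        also have "\<dots> \<le> 1 * (norm ?C * (2 / real (Suc n) * norm w))"
          by (intro mult_left_mono order_trans[OF norm_app_le] mult_right_mono norm_T_power_R) auto
        finally show ?thesis by (simp add: w del: of_nat_Suc)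
      qed
      ultimately show ?thesis by linarith
    qed
    have "norm (app ?C y) \<le> commutator_const * (norm K * norm (app H y))"
    proof (rule LIMSEQ_le_const)
      have "(\<lambda>n. commutator_const * (norm K * norm (app H y)) + norm ?C * (2 * inverse (real (Suc n)) * norm w))
         \<longlonglongrightarrow> commutator_const * (norm K * norm (app H y)) + norm ?C * (2 * 0 * norm w)"
        by (intro tendsto_intros LIMSEQ_inverse_real_of_nat)
      then show "(\<lambda>n. commutator_const * (norm K * norm (app H y)) + norm ?C * (2 / real (Suc n) * norm w))
         \<longlonglongrightarrow> commutator_const * (norm K * norm (app H y))"
        by (simp add: divide_inverse)
    qed (use bd in blast)
    then show ?thesis by (simp add: mult.assoc)
  qed
  have "closed {y. norm (app ?C y) \<le> commutator_const * norm K * norm (app H y)}"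
    by (intro closed_Collect_le continuous_intros linear_continuous_on app.bounded_linear_right)
  then have "closure S \<subseteq> {y. norm (app ?C y) \<le> commutator_const * norm K * norm (app H y)}"
    using on_S by (intro closure_minimal) auto
  then show ?thesis using S_dense by auto
qed

lemma norm_commutator:
  assumes A: "has_bounded_commutator S D A K"
  shows "norm (app (F * A - A * F) y) \<le> commutator_const * norm K * sqrt (norm y * norm (app G y))"
proof -
  have "norm (app H y) \<le> sqrt (norm y * norm (app G y))"
    using norm_H_square by (rule real_le_rsqrt)
  then show ?thesis
    using commutator_const_nonneg
    by (intro order_trans[OF norm_commutator_H[OF A]] mult_left_mono) auto
qed

text \<open>If \<open>L\<close> of rank at most \<open>n\<close> approximates \<open>G * B\<close>,
  then \<open>L\<close> vanishes on the range of a projection \<open>?Q\<close> of codimension at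
  most \<open>n\<close>. There the commutator bound holds with \<open>G * B - L\<close> in place of
  \<open>G * B\<close>, and what \<open>?Q\<close> cuts off has rank at most \<open>n\<close>. The
  infimum over \<open>L\<close> gives the claim.\<close>

lemma singular_number_commutator:
  assumes A: "has_bounded_commutator S D A K"
  shows "(singular_number n ((F * A - A * F) * B))\<^sup>2 \<le> (commutator_const * norm K)\<^sup>2 * norm B * singular_number n (G * B)"
proof -
  let ?C = "F * A - A * F"
  define M where "M = commutator_const * norm K"
  have M: "0 \<le> M" using commutator_const_nonneg by (simp add: M_def)
  have le: "(singular_number n (?C * B))\<^sup>2 \<le> M\<^sup>2 * norm B * norm (G * B - L)" if L: "rank_le n L" for L
  proof -
    obtain m f where mf: "m \<le> n" "orthonormal m f" "L * proj m f = L"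
      using rank_le_coE[OF L] .
    let ?Q = "1 - proj m f"
    have "rank_le m (?C * B * proj m f * 1)" by (rule rank_le_proj_mult)
    then have "rank_le n (?C * B * proj m f)" using mf(1) rank_le_mono by simp
    then have "singular_number n (?C * B) \<le> norm (?C * B - ?C * B * proj m f)"
      by (rule singular_number_le)
    also have "?C * B - ?C * B * proj m f = ?C * B * ?Q" by (simp add: right_diff_distrib)
    also have "norm (?C * B * ?Q) \<le> M * sqrt (norm B * norm (G * B - L))"
    proof (rule norm_bop_le)
      fix v
      have Qv: "norm (app ?Q v) \<le> norm v"
        using norm_app_le[of ?Q v] mult_right_mono[OF norm_proj_compl_le[OF mf(2)], of "norm v"] by simp
      let ?w = "app B (app ?Q v)"
      have w: "norm ?w \<le> norm B * norm v"
        by (intro order_trans[OF norm_app_le] mult_left_mono Qv) simp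
      have "L * ?Q = 0" by (simp add: right_diff_distrib mf(3))
      then have "app L (app ?Q v) = 0" by (metis app_mult app.zero_left)
      then have "app G ?w = app (G * B - L) (app ?Q v)" by (simp add: app.diff_left)
      then have Gw: "norm (app G ?w) \<le> norm (G * B - L) * norm v"
        using order_trans[OF norm_app_le mult_left_mono[OF Qv]] by simp
      have "norm (app (?C * B * ?Q) v) \<le> M * sqrt (norm ?w * norm (app G ?w))"
        using norm_commutator[OF A, of ?w] by (simp add: M_def)
      also have "\<dots> \<le> M * sqrt ((norm B * norm v) * (norm (G * B - L) * norm v))"
        using M by (intro mult_left_mono real_sqrt_le_mono mult_mono w Gw) auto
      also have "(norm B * norm v) * (norm (G * B - L) * norm v) = norm B * norm (G * B - L) * (norm v)\<^sup>2"
        by (simp add: power2_eq_square)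
      finally show "norm (app (?C * B * ?Q) v) \<le> M * sqrt (norm B * norm (G * B - L)) * norm v"
        by (simp add: real_sqrt_mult)
    qed (use M in simp)
    finally have "(singular_number n (?C * B))\<^sup>2 \<le> (M * sqrt (norm B * norm (G * B - L)))\<^sup>2"
      by (intro power_mono) auto
    then show ?thesis by (simp add: power_mult_distrib mult.assoc)
  qed
  show ?thesis
  \<comment> \<open>Passing to the infimum over \<open>L\<close> divides by this constant; if it is
    0, then \<open>le\<close> already forces the left side to vanish.\<close>
  proof (cases "M\<^sup>2 * norm B = 0")
    case True
    show ?thesis
      using le[OF rank_le_zero[of n]] unfolding M_def[symmetric] True by simp
  next
    case False
    then have pos: "0 < M\<^sup>2 * norm B" by (simp add: less_le)
    have "(singular_number n (?C * B))\<^sup>2 / (M\<^sup>2 * norm B) \<le> singular_number n (G * B)"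
    proof (rule singular_number_geI)
      fix L :: "'h bop" assume "rank_le n L"
      then show "(singular_number n (?C * B))\<^sup>2 / (M\<^sup>2 * norm B) \<le> norm (G * B - L)"
        using le[of L] pos by (simp add: divide_le_eq mult.commute)
    qed
    then show ?thesis using pos by (simp add: divide_le_eq mult.commute M_def)
  qed
qed

text \<open>Raising the inequality for squares of singular numbers to the power \<open>p\<close>
  turns the exponent \<open>2 * p\<close> on the left into \<open>p\<close> on the right.\<close>

lemma schatten_commutator:
  assumes A: "has_bounded_commutator S D A K" and p: "p > 0" and B: "G * B \<in> schatten p"
  shows "(F * A - A * F) * B \<in> schatten (2 * p)"
    and "schatten_norm (2 * p) ((F * A - A * F) * B)
      \<le> commutator_const * norm K * sqrt (norm B * schatten_norm p (G * B))"
proof -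
  let ?C = "F * A - A * F" and ?N = "schatten_norm p (G * B)"
  define M where "M = (commutator_const * norm K)\<^sup>2 * norm B"
  have M: "0 \<le> M" by (simp add: M_def)
  have powr2: "x powr (2 * p) = (x\<^sup>2) powr p" if "0 \<le> x" for x :: real
    using that powr_powr[of x 2 p] by (cases "x = 0") simp_all
  let ?c = "commutator_const * norm K * sqrt (norm B * ?N)"
  have c: "0 \<le> ?c" using commutator_const_nonneg by simp
  have "(\<Sum>n<k. singular_number n (?C * B) powr (2 * p)) \<le> ?c powr (2 * p)" for k
  proof -
    have "(\<Sum>n<k. singular_number n (?C * B) powr (2 * p)) \<le> (\<Sum>n<k. (M * singular_number n (G * B)) powr p)"
      using p singular_number_commutator[OF A]
      by (intro sum_mono) (simp add: powr2 powr_mono2 M_def)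
    also have "\<dots> = M powr p * (\<Sum>n<k. singular_number n (G * B) powr p)"
      using M by (simp add: powr_mult sum_distrib_left)
    also have "\<dots> \<le> M powr p * ?N powr p"
      by (intro mult_left_mono sum_singular_number_le B p) simp
    also have "\<dots> = (M * ?N) powr p" using M by (simp add: powr_mult)
    also have "M * ?N = ?c\<^sup>2" by (simp add: M_def power_mult_distrib mult.assoc)
    finally show ?thesis using c by (simp only: powr2)
  qed
  then show "?C * B \<in> schatten (2 * p)" "schatten_norm (2 * p) (?C * B) \<le> ?c"
    using schattenI[of "2 * p" ?c "?C * B"] p c by auto
qed

end

section \<open>The Kasparov module\<close>

context selfadjoint_op
begin

section \<open>Bounded commutators with \<open>D\<close>, their differences and adjoints\<close>

lemma has_bounded_commutator_unique:
  assumes "has_bounded_commutator S D A K" "has_bounded_commutator S D A L"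
  shows "K = L"
  by (rule bop_S_ext) (use assms in \<open>auto simp: has_bounded_commutator_def\<close>)

lemma has_bounded_commutator_commutator_op:
  "has_bounded_commutator S D A K \<Longrightarrow> has_bounded_commutator S D A (commutator_op S D A)"
  unfolding commutator_op_def by (rule theI) (auto intro: has_bounded_commutator_unique)

lemma has_bounded_commutator_diff:
  assumes "has_bounded_commutator S D A K" "has_bounded_commutator S D B L"
  shows "has_bounded_commutator S D (A - B) (K - L)"
proof -
  have mem: "app A x \<in> S" "app B x \<in> S" if "x \<in> S" for x
    using assms that unfolding has_bounded_commutator_def by auto
  have eq: "app K x = D (app A x) - app A (D x)" "app L x = D (app B x) - app B (D x)" if "x \<in> S" for x
    using assms that unfolding has_bounded_commutator_def by auto
  show ?thesis
    unfolding has_bounded_commutator_def by (auto simp: app_simps mem eq S_diff D_diff)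
qed

text \<open>Pairing with \<open>D y\<close> shows that \<open>adj A\<close> maps \<open>S\<close>
  into the domain of the adjoint of \<open>D\<close>, which is \<open>S\<close> by selfadjointness.
  The sign arises because taking adjoints reverses the order of a commutator.\<close>

lemma has_bounded_commutator_adj:
  assumes "has_bounded_commutator S D A K"
  shows "has_bounded_commutator S D (adj A) (- adj K)"
proof -
  have AS: "app A y \<in> S" and DA: "D (app A y) = app A (D y) + app K y" if "y \<in> S" for y
    using assms that unfolding has_bounded_commutator_def by (auto simp: algebra_simps)
  have "app (adj A) x \<in> S \<and> D (app (adj A) x) = app (adj A) (D x) - app (adj K) x" if x: "x \<in> S" for x
  proof -
    have "cinner (app (adj A) x) (D y) = cinner (app (adj A) (D x) - app (adj K) x) y" if y: "y \<in> S" for y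
    proof -
      have "cinner (app (adj A) x) (D y) = cinner x (D (app A y)) - cinner x (app K y)"
        by (simp add: cinner_adj_left DA[OF y] cinner_add_right)
      also have "cinner x (D (app A y)) = cinner (D x) (app A y)"
        by (rule symmetric[OF x AS[OF y], symmetric])
      finally show ?thesis by (simp add: cinner_adj_left cinner.diff_left)
    qed
    from adjoint_domainI[OF this] show ?thesis by auto
  qed
  then show ?thesis
    unfolding has_bounded_commutator_def by (auto simp: app_simps)
qed

text \<open>\<open>B [F, A]\<close> is minus the adjoint of the product of \<open>[F, adj A]\<close>
  with \<open>adj B\<close>, and adjoints keep singular numbers.\<close>

lemma schatten_commutator_left:
  assumes A: "has_bounded_commutator S D A K" and p: "p > 0" and B: "B * G \<in> schatten p"
  shows "B * (F * A - A * F) \<in> schatten (2 * p)"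
    and "schatten_norm (2 * p) (B * (F * A - A * F))
      \<le> commutator_const * norm K * sqrt (norm B * schatten_norm p (B * G))"
proof -
  let ?C = "F * adj A - adj A * F"
  have adj_schatten: "adj X \<in> schatten r \<longleftrightarrow> X \<in> schatten r" "schatten_norm r (adj X) = schatten_norm r X"
    for X :: "'h bop" and r
    by (simp_all add: schatten_def schatten_norm_def)
  have GB: "adj (B * G) = G * adj B" by (simp add: adj_mult adj_G)
  have "G * adj B \<in> schatten p" using B unfolding GB[symmetric] by (simp add: adj_schatten)
  note C = schatten_commutator[OF has_bounded_commutator_adj[OF A] p this]
  have "adj (?C * adj B) = - (B * (F * A - A * F))"
    by (simp add: adj_mult adj_diff adj_F right_diff_distrib)
  then have eq: "B * (F * A - A * F) = - adj (?C * adj B)" by simp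
  have mem: "adj (?C * adj B) \<in> schatten (2 * p)" using C(1) by (simp only: adj_schatten)
  have p2: "2 * p > 0" using p by simp
  show "B * (F * A - A * F) \<in> schatten (2 * p)"
    unfolding eq by (rule schatten_minus(1)[OF mem p2])
  have "schatten_norm (2 * p) (B * (F * A - A * F)) \<le> schatten_norm (2 * p) (adj (?C * adj B))"
    unfolding eq by (rule schatten_minus(2)[OF mem p2])
  also have "\<dots> \<le> commutator_const * norm (- adj K) * sqrt (norm (adj B) * schatten_norm p (adj (B * G)))"
    using C(2) unfolding GB by (simp only: adj_schatten)
  also have "\<dots> = commutator_const * norm K * sqrt (norm B * schatten_norm p (B * G))"
    by (simp add: adj_schatten)
  finally show "schatten_norm (2 * p) (B * (F * A - A * F)) \<le> commutator_const * norm K * sqrt (norm B * schatten_norm p (B * G))" .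
qed

text \<open>In both applications \<open>m\<close> multiplies the commutator of the first argument with \<open>F\<close> by the
  second argument, and \<open>h\<close> multiplies by \<open>G\<close> on the other side.\<close>

lemma continuous_map_commutator_bilinear:
  fixes f g k :: "'z \<Rightarrow> 'h bop" and m :: "'h bop \<Rightarrow> 'h bop \<Rightarrow> 'h bop" and h :: "'h bop \<Rightarrow> 'h bop"
  assumes p: "p \<ge> 1"
    and fk: "\<And>z. z \<in> topspace Z \<Longrightarrow> has_bounded_commutator S D (f z) (k z)"
    and k: "continuous_map Z euclidean k"
    and g: "continuous_map Z euclidean g"
    and hg: "continuous_map Z (schatten_topology p) (\<lambda>z. h (g z))"
    and m: "\<And>A A' B. m (A - A') B = m A B - m A' B" "\<And>A B B'. m A (B - B') = m A B - m A B'"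
    and h: "\<And>B B'. h (B - B') = h B - h B'"
    and mem: "\<And>A K B. has_bounded_commutator S D A K \<Longrightarrow> h B \<in> schatten p \<Longrightarrow> m A B \<in> schatten (2 * p)"
    and le: "\<And>A K B. has_bounded_commutator S D A K \<Longrightarrow> h B \<in> schatten p \<Longrightarrow>
      schatten_norm (2 * p) (m A B) \<le> commutator_const * norm K * sqrt (norm B * schatten_norm p (h B))"
  shows "continuous_map Z (schatten_topology (2 * p)) (\<lambda>z. m (f z) (g z))"
  unfolding continuous_map_atin
proof
  fix z assume z: "z \<in> topspace Z"
  have p2: "2 * p \<ge> 1" using p by simp
  note hmem = continuous_map_schatten_mem[OF hg]
  note lim = continuous_map_euclidean_tendsto[OF k z] continuous_map_euclidean_tendsto[OF g z]
    continuous_map_schatten_tendsto[OF p hg z]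
  let ?c = commutator_const and ?N = "schatten_norm p"
  show "limitin (schatten_topology (2 * p)) (\<lambda>z. m (f z) (g z)) (m (f z) (g z)) (atin Z z)"
  proof (rule limitin_schattenI[OF p2])
    \<comment> \<open>The first argument is measured by the norm of its commutator \<open>k\<close>,
      the second by the geometric mean of its norm and the Schatten norm of its image under
      \<open>h\<close>; varying one at a time makes both bounds tend to 0.\<close>
    show "m (f z') (g z') - m (f z) (g z) = m (f z') (g z' - g z) + m (f z' - f z) (g z)" for z'
      by (simp add: m)
    show "m (f z) (g z) \<in> schatten (2 * p)" by (rule mem[OF fk[OF z] hmem[OF z]])
    show "\<forall>\<^sub>F z' in atin Z z. m (f z') (g z' - g z) \<in> schatten (2 * p) \<and> schatten_norm (2 * p) (m (f z') (g z' - g z))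
        \<le> ?c * norm (k z') * sqrt (norm (g z' - g z) * ?N (h (g z') - h (g z)))"
      using eventually_atin_topspace
    proof eventually_elim
      case (elim z')
      have "h (g z' - g z) \<in> schatten p" unfolding h by (intro schatten_diff p hmem elim z)
      with fk[OF elim] show ?case unfolding h[symmetric] by (intro conjI mem le)
    qed
    have "((\<lambda>z'. ?c * norm (k z') * sqrt (norm (g z' - g z) * ?N (h (g z') - h (g z))))
        \<longlongrightarrow> ?c * norm (k z) * sqrt (norm (g z - g z) * 0)) (atin Z z)"
      by (intro tendsto_intros lim)
    then show "((\<lambda>z'. ?c * norm (k z') * sqrt (norm (g z' - g z) * ?N (h (g z') - h (g z)))) \<longlongrightarrow> 0) (atin Z z)"
      by simp
    show "\<forall>\<^sub>F z' in atin Z z. m (f z' - f z) (g z) \<in> schatten (2 * p) \<and> schatten_norm (2 * p) (m (f z' - f z) (g z))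
        \<le> ?c * norm (k z' - k z) * sqrt (norm (g z) * ?N (h (g z)))"
      using eventually_atin_topspace
    proof eventually_elim
      case (elim z')
      note fd = has_bounded_commutator_diff[OF fk[OF elim] fk[OF z]]
      show ?case by (intro conjI mem[OF fd] le[OF fd] hmem z)
    qed
    have "((\<lambda>z'. ?c * norm (k z' - k z) * sqrt (norm (g z) * ?N (h (g z))))
        \<longlongrightarrow> ?c * norm (k z - k z) * sqrt (norm (g z) * ?N (h (g z)))) (atin Z z)"
      by (intro tendsto_intros lim)
    then show "((\<lambda>z'. ?c * norm (k z' - k z) * sqrt (norm (g z) * ?N (h (g z)))) \<longlongrightarrow> 0) (atin Z z)"
      by simp
  qed
qed

text \<open>Conjugation by \<epsilon> reverses the sign of \<open>D\<close>, so the conjugated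
  calculus of the reflected function is again a functional calculus of \<open>D\<close>. Uniqueness
  identifies the two, and \<open>bdd_transform\<close> is odd.\<close>

lemma F_anticommute:
  assumes ee: "\<epsilon> * \<epsilon> = 1" and adj: "is_adjoint \<epsilon> \<epsilon>"
    and odd: "\<And>x. x \<in> S \<Longrightarrow> app \<epsilon> x \<in> S \<and> D (app \<epsilon> x) = - app \<epsilon> (D x)"
  shows "F * \<epsilon> = - (\<epsilon> * F)"
proof -
  define \<Psi> where "\<Psi> = (\<lambda>f :: real \<Rightarrow> complex. \<epsilon> * calculus (\<lambda>x. f (- x)) * \<epsilon>)"
  have e2: "app \<epsilon> (app \<epsilon> v) = v" for v using ee by (metis app_mult app_one)
  have bc: "bounded_continuous (\<lambda>x. f (- x))" if f: "bounded_continuous f" for f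
  proof -
    obtain B where B: "\<And>x. cmod (f x) \<le> B"
      using bounded_continuous_bounded_fun[OF f] unfolding bounded_fun_def by blast
    show ?thesis
    proof (rule bounded_continuousI[OF _ B])
      show "isCont (\<lambda>x. f (- x)) x" for x
        by (intro isCont_o2[of x uminus f] bounded_continuous_isCont f continuous_intros)
    qed
  qed
  have adje: "adj \<epsilon> = \<epsilon>" by (rule adj_eqI[OF adj])
  have mm: "(\<epsilon> * A * \<epsilon>) * (\<epsilon> * B * \<epsilon>) = \<epsilon> * (A * B) * \<epsilon>" for A B :: "'h bop"
    by (rule bop_eqI) (simp add: e2)
  note cal = functional_calculus_calculus
  have "functional_calculus S D \<Psi>"
    unfolding functional_calculus_def
  proof (intro conjI allI impI)
    fix f g assume f: "bounded_continuous f" and g: "bounded_continuous g"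
    show "\<Psi> (\<lambda>x. f x + g x) = \<Psi> f + \<Psi> g"
      unfolding \<Psi>_def functional_calculus_add[OF cal bc[OF f] bc[OF g]] by (simp add: algebra_simps)
    show "\<Psi> (\<lambda>x. f x * g x) = \<Psi> f * \<Psi> g"
      unfolding \<Psi>_def mm functional_calculus_mult[OF cal bc[OF f] bc[OF g]] ..
  next
    fix c f assume f: "bounded_continuous f"
    show "\<Psi> (\<lambda>x. c * f x) = c *\<^sub>C \<Psi> f"
      unfolding \<Psi>_def functional_calculus_scale[OF cal bc[OF f]]
      by (simp add: mult_scaleC_left mult_scaleC_right)
  next
    fix f assume f: "bounded_continuous f"
    have "adj (calculus (\<lambda>x. f (- x))) = calculus (\<lambda>x. cnj (f (- x)))"
      by (rule adj_eqI[OF functional_calculus_adjoint[OF cal bc[OF f]]])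
    then have "adj (\<Psi> f) = \<Psi> (\<lambda>x. cnj (f x))"
      by (simp add: \<Psi>_def adj_mult adje mult.assoc)
    then show "is_adjoint (\<Psi> f) (\<Psi> (\<lambda>x. cnj (f x)))" by (metis is_adjoint_adj)
  next
    show "\<Psi> (\<lambda>x. 1) = 1" by (simp add: \<Psi>_def calculus_one ee)
  next
    fix z :: complex assume z: "Im z \<noteq> 0"
    then have z': "Im (- z) \<noteq> 0" by simp
    let ?R = "calculus (\<lambda>x. 1 / (complex_of_real x - (- z)))"
    have R: "app ?R v \<in> S" "D (app ?R v) - (- z) *\<^sub>C app ?R v = v"
      and R_left: "x \<in> S \<Longrightarrow> app ?R (D x - (- z) *\<^sub>C x) = x" for v x
      using functional_calculus_resolvent[OF cal z'] unfolding is_resolvent_def by blast+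
    have "1 / (complex_of_real (- x) - z) = (- 1) * (1 / (complex_of_real x - (- z)))" for x
    proof -
      have "complex_of_real (- x) - z = - (complex_of_real x - (- z))" by simp
      then show ?thesis by (simp only: divide_minus_right) simp
    qed
    then have "calculus (\<lambda>x. 1 / (complex_of_real (- x) - z)) = (- 1) *\<^sub>C ?R"
      by (simp only: functional_calculus_scale[OF cal bounded_continuous_resolvent[OF z']])
    then have \<Psi>: "app (\<Psi> (\<lambda>x. 1 / (complex_of_real x - z))) v = - app \<epsilon> (app ?R (app \<epsilon> v))" for v
      by (simp add: \<Psi>_def app_simps)
    show "is_resolvent S D z (\<Psi> (\<lambda>x. 1 / (complex_of_real x - z)))"
      unfolding is_resolvent_def \<Psi>
    proof (intro conjI allI ballI)
      fix v
      let ?y = "app ?R (app \<epsilon> v)"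
      have y: "app \<epsilon> ?y \<in> S" "D (app \<epsilon> ?y) = - app \<epsilon> (D ?y)" using odd[OF R(1)] by blast+
      have neg: "- app \<epsilon> ?y = (- 1) *\<^sub>C app \<epsilon> ?y" by simp
      show "- app \<epsilon> ?y \<in> S" unfolding neg by (rule S_scaleC[OF y(1)])
      have "D (- app \<epsilon> ?y) = app \<epsilon> (D ?y)" unfolding neg D_scaleC[OF y(1)] y(2) by simp
      then have "D (- app \<epsilon> ?y) - z *\<^sub>C (- app \<epsilon> ?y) = app \<epsilon> (D ?y - (- z) *\<^sub>C ?y)"
        by (simp add: app_simps scaleC_minus_right)
      also have "\<dots> = v" by (simp only: R(2) e2)
      finally show "D (- app \<epsilon> ?y) - z *\<^sub>C (- app \<epsilon> ?y) = v" .
    next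
      fix x assume x: "x \<in> S"
      have "app \<epsilon> (D x - z *\<^sub>C x) = - (D (app \<epsilon> x) - (- z) *\<^sub>C app \<epsilon> x)"
        using odd[OF x] by (simp add: app_simps)
      then have "- app \<epsilon> (app ?R (app \<epsilon> (D x - z *\<^sub>C x))) = app \<epsilon> (app ?R (D (app \<epsilon> x) - (- z) *\<^sub>C app \<epsilon> x))"
        by (simp only: app.minus_right minus_minus)
      also have "\<dots> = x" by (simp only: R_left[OF conjunct1[OF odd[OF x]]] e2)
      finally show "- app \<epsilon> (app ?R (app \<epsilon> (D x - z *\<^sub>C x))) = x" .
    qed
  qed
  from functional_calculus_unique[OF this cal bc_bdd_transform]
  have "\<Psi> (\<lambda>x. complex_of_real (bdd_transform x)) = F" by (simp add: F_def)
  moreover have "\<Psi> (\<lambda>x. complex_of_real (bdd_transform x)) = - (\<epsilon> * F * \<epsilon>)"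
  proof -
    have "complex_of_real (bdd_transform (- x)) = (- 1) * complex_of_real (bdd_transform x)" for x by (simp add: bdd_transform_def)
    then have "calculus (\<lambda>x. complex_of_real (bdd_transform (- x))) = (- 1) *\<^sub>C F"
      unfolding F_def by (simp only: functional_calculus_scale[OF cal bc_bdd_transform])
    then show ?thesis by (simp add: \<Psi>_def)
  qed
  ultimately have "F * \<epsilon> = - (\<epsilon> * F * \<epsilon>) * \<epsilon>" by simp
  also have "\<dots> = - (\<epsilon> * F)" by (simp add: mult.assoc ee)
  finally show ?thesis .
qed

end

theorem proposition49:
  fixes X :: "'a::complex_algebra topology"
    and star :: "'a \<Rightarrow> 'a"
    and \<phi> :: "'a \<Rightarrow> 'h::complex_hilbert bop"
    and \<epsilon> :: "'h bop"
    and S :: "'h set" and D :: "'h \<Rightarrow> 'h"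
    and p :: real
  assumes "p \<ge> 1"
    and "even_spectral_triple (topspace X) star \<phi> \<epsilon> S D"
    and "continuous_summable_spectral_triple p X star \<phi> S D"
    and "(\<lambda>(a, b). a * b) ` (topspace X \<times> topspace X) = topspace X"
    and "open_map (prod_topology X X) X (\<lambda>(a, b). a * b)"
  shows "locally_convex_kasparov_module X (schatten_topology (2 * p)) \<phi> \<epsilon>
           (fun_of_op S D (\<lambda>x. x / sqrt (1 + x\<^sup>2)))"
proof -
  have triple: "spectral_triple (topspace X) star \<phi> S D"
    and \<epsilon>: "\<epsilon> * \<epsilon> = 1" "is_adjoint \<epsilon> \<epsilon>" "\<And>a. a \<in> topspace X \<Longrightarrow> \<phi> a * \<epsilon> = \<epsilon> * \<phi> a"
      "\<And>x. x \<in> S \<Longrightarrow> app \<epsilon> x \<in> S \<and> D (app \<epsilon> x) = - app \<epsilon> (D x)"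
    using assms(2) unfolding even_spectral_triple_def by auto
  have hom: "algebra_hom_on (topspace X) \<phi>" and sa: "selfadjoint S D"
    and ex: "\<And>a. a \<in> topspace X \<Longrightarrow> \<exists>K. has_bounded_commutator S D (\<phi> a) K"
    using triple unfolding spectral_triple_def by auto
  interpret selfadjoint_op S D by standard (rule sa)
  have X: "locally_convex_algebra X" and \<phi>: "continuous_map X euclidean \<phi>"
    and K: "continuous_map X euclidean (\<lambda>a. commutator_op S D (\<phi> a))"
    and \<phi>G: "continuous_map X (schatten_topology p) (\<lambda>a. \<phi> a * G)"
    and G\<phi>: "continuous_map X (schatten_topology p) (\<lambda>a. G * \<phi> a)"
    using assms(3) unfolding continuous_summable_spectral_triple_def fun_of_op_G by auto
  have p: "1 \<le> p" "0 < p" "1 \<le> 2 * p" "p \<le> 2 * p" using assms(1) by auto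
  let ?Y = "schatten_topology (2 * p) :: 'h bop topology"
  have idY: "continuous_map ?Y ?Y (\<lambda>b. b)" using continuous_map_id by (simp add: id_def)
  have const: "continuous_map Z euclidean (\<lambda>_. A)" for Z :: "'z topology" and A :: "'h bop" by simp
  have mult_cont: "continuous_map (prod_topology X X) X (\<lambda>(a, b). a * b)"
    using X unfolding locally_convex_algebra_def by blast
  have comm: "has_bounded_commutator S D (\<phi> a) (commutator_op S D (\<phi> a))" if "a \<in> topspace X" for a
    using ex[OF that] has_bounded_commutator_commutator_op by blast
  have ii: "F * \<epsilon> = - (\<epsilon> * F)" by (rule F_anticommute[OF \<epsilon>(1,2,4)])
  have pr: "continuous_map (prod_topology X X) euclidean (\<lambda>z. \<phi> (fst z))"
    "continuous_map (prod_topology X X) euclidean (\<lambda>z. \<phi> (snd z))"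
    "continuous_map (prod_topology X X) euclidean (\<lambda>z. commutator_op S D (\<phi> (fst z)))"
    "continuous_map (prod_topology X X) euclidean (\<lambda>z. commutator_op S D (\<phi> (snd z)))"
    "continuous_map (prod_topology X X) (schatten_topology p) (\<lambda>z. \<phi> (fst z) * G)"
    "continuous_map (prod_topology X X) (schatten_topology p) (\<lambda>z. G * \<phi> (snd z))"
    using continuous_map_compose[OF continuous_map_fst \<phi>] continuous_map_compose[OF continuous_map_snd \<phi>]
      continuous_map_compose[OF continuous_map_fst K] continuous_map_compose[OF continuous_map_snd K]
      continuous_map_compose[OF continuous_map_fst \<phi>G] continuous_map_compose[OF continuous_map_snd G\<phi>]
    by (simp_all add: o_def)
  have c1: "continuous_map (prod_topology X X) ?Y (\<lambda>z. (F * \<phi> (fst z) - \<phi> (fst z) * F) * \<phi> (snd z))"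
  proof (rule continuous_map_commutator_bilinear[where m = "\<lambda>A B. (F * A - A * F) * B" and h = "\<lambda>B. G * B",
        OF p(1) comm pr(3,2,6)])
    show "schatten_norm (2 * p) ((F * A - A * F) * B) \<le> commutator_const * norm K * sqrt (norm B * schatten_norm p (G * B))"
      if "has_bounded_commutator S D A K" "G * B \<in> schatten p" for A K B
      by (rule schatten_commutator(2)[OF that(1) p(2) that(2)])
    show "(F * A - A * F) * B \<in> schatten (2 * p)"
      if "has_bounded_commutator S D A K" "G * B \<in> schatten p" for A K B
      by (rule schatten_commutator(1)[OF that(1) p(2) that(2)])
  qed (auto simp: right_diff_distrib left_diff_distrib)
  have c2: "continuous_map (prod_topology X X) ?Y (\<lambda>z. \<phi> (fst z) * (F * \<phi> (snd z) - \<phi> (snd z) * F))"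
  proof (rule continuous_map_commutator_bilinear[where m = "\<lambda>A B. B * (F * A - A * F)" and h = "\<lambda>B. B * G",
        OF p(1) comm pr(4,1,5)])
    show "schatten_norm (2 * p) (B * (F * A - A * F)) \<le> commutator_const * norm K * sqrt (norm B * schatten_norm p (B * G))"
      if "has_bounded_commutator S D A K" "B * G \<in> schatten p" for A K B
      by (rule schatten_commutator_left(2)[OF that(1) p(2) that(2)])
    show "B * (F * A - A * F) \<in> schatten (2 * p)"
      if "has_bounded_commutator S D A K" "B * G \<in> schatten p" for A K B
      by (rule schatten_commutator_left(1)[OF that(1) p(2) that(2)])
  qed (auto simp: right_diff_distrib left_diff_distrib)
  \<comment> \<open>The sum is the Leibniz rule for \<open>[F, a b]\<close>; the factor
    \<open>- 1\<close> converts it to the opposite commutator \<open>[a, F]\<close> of a Kasparov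
    module.\<close>
  have c3: "continuous_map (prod_topology X X) ?Y
    (\<lambda>z. (- 1) * ((F * \<phi> (fst z) - \<phi> (fst z) * F) * \<phi> (snd z) + \<phi> (fst z) * (F * \<phi> (snd z) - \<phi> (snd z) * F)))"
    by (intro continuous_map_schatten_mult_left continuous_map_schatten_add p const c1 c2)
  have minus_one: "(- 1) * A = - A" for A :: "'h bop" by (rule bop_eqI) (simp add: app_simps)
  have "continuous_map (prod_topology X X) ?Y ((\<lambda>a. \<phi> a * F - F * \<phi> a) \<circ> (\<lambda>(a, b). a * b))"
  proof (rule continuous_map_eq[OF c3])
    fix z assume "z \<in> topspace (prod_topology X X)"
    then have "\<phi> (fst z * snd z) = \<phi> (fst z) * \<phi> (snd z)"
      using hom unfolding algebra_hom_on_def by (auto simp: topspace_prod_topology)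
    then show "(- 1) * ((F * \<phi> (fst z) - \<phi> (fst z) * F) * \<phi> (snd z) + \<phi> (fst z) * (F * \<phi> (snd z) - \<phi> (snd z) * F))
      = ((\<lambda>a. \<phi> a * F - F * \<phi> a) \<circ> (\<lambda>(a, b). a * b)) z"
      by (simp add: minus_one case_prod_unfold algebra_simps)
  qed
  \<comment> \<open>Surjectivity and openness of the multiplication enter here: continuity of a map
    on \<open>X\<close> may be checked after composing it with the product.\<close>
  moreover have "quotient_map (prod_topology X X) X (\<lambda>(a, b). a * b)"
    using continuous_open_imp_quotient_map[OF mult_cont assms(5)] assms(4)
    by (simp add: topspace_prod_topology)
  ultimately have comm_cont: "continuous_map X ?Y (\<lambda>a. \<phi> a * F - F * \<phi> a)"
    using continuous_compose_quotient_map by blast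
  \<comment> \<open>\<open>1 - F * F\<close> is \<open>G * G\<close>: the \<open>G\<close> next to
    the algebra element already gives the smaller ideal for \<open>p\<close>, the other is a bounded
    factor.\<close>
  have \<phi>GG: "continuous_map X ?Y (\<lambda>a. \<phi> a * G * G)"
    by (intro continuous_map_schatten_mono[OF p(1,4)] continuous_map_schatten_mult_right p const \<phi>G)
  have GG\<phi>: "continuous_map X ?Y (\<lambda>a. G * (G * \<phi> a))"
    by (intro continuous_map_schatten_mono[OF p(1,4)] continuous_map_schatten_mult_left p const G\<phi>)
  have XY: "continuous_map (prod_topology X ?Y) euclidean (\<lambda>z. \<phi> (fst z))"
    "continuous_map (prod_topology X ?Y) ?Y (\<lambda>z. snd z)"
    using continuous_map_compose[OF continuous_map_fst \<phi>] continuous_map_snd by (simp_all add: o_def)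
  show ?thesis
    unfolding locally_convex_kasparov_module_def fun_of_op_F one_minus_FF
  proof (intro conjI ballI)
    show "locally_convex_algebra ?Y" by (rule locally_convex_algebra_schatten[OF p(3)])
    show "\<phi> a * \<epsilon> - \<epsilon> * \<phi> a = 0" if "a \<in> topspace X" for a using \<epsilon>(3)[OF that] by simp
    show "continuous_map ?Y ?Y (\<lambda>b. b * F)" "continuous_map ?Y ?Y (\<lambda>b. F * b)"
      "continuous_map ?Y ?Y (\<lambda>b. \<epsilon> * b)" "continuous_map ?Y ?Y (\<lambda>b. b * \<epsilon>)"
      by (intro continuous_map_schatten_mult_left continuous_map_schatten_mult_right p const idY)+
    show "continuous_map (prod_topology X ?Y) ?Y (\<lambda>(a, b). \<phi> a * b)"
      "continuous_map (prod_topology X ?Y) ?Y (\<lambda>(a, b). b * \<phi> a)"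
      unfolding case_prod_unfold
      by (intro continuous_map_schatten_mult_left continuous_map_schatten_mult_right p XY)+
    show "continuous_map X ?Y (\<lambda>a. \<phi> a * (G * G))" "continuous_map X ?Y (\<lambda>a. G * G * \<phi> a)"
      using \<phi>GG GG\<phi> by (simp_all add: mult.assoc)
  qed (fact X hom \<epsilon>(1) ii comm_cont)+
qed

end
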